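(* Let $\alpha$ be any probability distribution on $(0,1)$ with $\langle\log\rho(0)\rangle\le 0$, let $\mu=\alpha^{\mathbb{Z}}$, and let $X=(X_n)_{n\in\mathbb{N}_0}$ be the random walk in cooling random environment with resampling rule $\alpha$ and cooling rule $\tau$. Put $T_k=\tau(k)-\tau(k-1)$, $k\in\mathbb{N}$. If $$\lim_{k\to\infty}T_k=\infty,$$ then, under the annealed law $\mathbb{P}_{\mathbb{Q}}$, $X_n/n$ converges in distribution to the constant $v_\mu$ as $n\to\infty$, where $v_\mu$ is the asymptotic speed of the static random walk in random environment with law $\mu$.
   Context: $\mathbb{N}=\{1,2,\dots\}$, $\mathbb{N}_0=\mathbb{N}\cup\{0\}$; $\langle\cdot\rangle$ denotes expectation with respect to $\alpha$, and $\rho(0)=(1-\omega(0))/\omega(0)$ where $\omega(0)$ has law $\alpha$. Static model (RWRE): $\omega=\{\omega(x):x\in\mathbb{Z}\}$ is i.i.d. with law $\mu=\alpha^{\mathbb{Z}}$. Given $\omega$, $Z=(Z_n)_{n\in\mathbb{N}_0}$ is the Markov chain on $\mathbb{Z}$ with $Z_0=0$ that jumps from $x$ to $x+1$ with probability $\omega(x)$ and to $x-1$ with probability $1-\omega(x)$; its law is $P^\omega$, and the annealed law is $\mathbb{P}_\mu(\cdot)=\int P^\omega(\cdot)\,\mu(d\omega)$. The speed $v_\mu$ is the $\mathbb{P}_\mu$-a.s. constant limit of $Z_n/n$ (Solomon's theorem): $v_\mu=\frac{1-\langle\rho(0)\rangle}{1+\langle\rho(0)\rangle}$ if $\langle\rho(0)\rangle<1$,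 and $v_\mu=0$ otherwise (i.e. if $\langle\log\rho(0)\rangle=0$, or if $\langle\log\rho(0)\rangle<0$ and $\langle\rho(0)\rangle\ge1$). Cooling model (RWCRE): the cooling rule $\tau:\mathbb{N}_0\to\mathbb{N}_0$ is strictly increasing with $\tau(0)=0$ (so $\tau(k)\ge k$). The sequence of environments $\Omega=(\omega_n)_{n\in\mathbb{N}_0}$ is defined as follows: the environments $\omega_{\tau(k)}$, $k\in\mathbb{N}_0$, are independent with law $\mu=\alpha^{\mathbb{Z}}$, and $\omega_n=\omega_{\tau(k)}$ for $\tau(k)\le n<\tau(k+1)$. The law of $\Omega$ is $\mathbb{Q}=\mathbb{Q}_{\alpha,\tau}$. Given $\Omega$, $X=(X_n)_{n\in\mathbb{N}_0}$ is the (time-inhomogeneous) Markov process on $\mathbb{Z}$ with $X_0=0$ that, at time $n$ at position $x$, jumps to $x+1$ with probability $\omega_n(x)$ and to $x-1$ with probability $1-\omega_n(x)$; its law is $P^\Omega$. The annealed law is $\mathbb{P}_{\mathbb{Q}}(\cdot)=\int P^\Omega(\cdot)\,\mathbb{Q}(d\Omega)$. *)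

theory Defs
  imports "HOL-Probability.Probability"
begin

type_synonym env = "int \<Rightarrow> real"

text \<open>
  The law of the walk in a given sequence of environments \<open>W\<close>: at time \<open>n\<close> it jumps from \<open>x\<close> to
  \<open>x + 1\<close> with probability \<open>W n x\<close>. The kernel for time \<open>n\<close> receives the trajectory up to time
  \<open>n - 1\<close>. Values of \<open>W\<close> outside \<open>[0, 1]\<close>, which have probability zero in all uses below, are
  truncated to \<open>[0, 1]\<close> by \<^const>\<open>bernoulli_pmf\<close>.
\<close>

primrec walk_kernel :: "(nat \<Rightarrow> env) \<Rightarrow> nat \<Rightarrow> (nat \<Rightarrow> int) \<Rightarrow> int measure" where
  "walk_kernel W 0 h = measure_pmf (return_pmf 0)"
| "walk_kernel W (Suc n) h =
     measure_pmf (map_pmf (\<lambda>right. if right then h n + 1 else h n - 1) (bernoulli_pmf (W n (h n))))"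

lemma walk_kernel_pmf: "\<exists>p. walk_kernel W n h = measure_pmf p"
  by (cases n) auto

lemma measurable_walk_kernel:
  "walk_kernel W n \<in> measurable (PiM {0..<n} (\<lambda>_. count_space UNIV)) (subprob_algebra (count_space UNIV))"
proof (cases n)
  case 0
  then show ?thesis by (auto intro!: measurable_const simp: walk_kernel.simps(1)[abs_def])
next
  case (Suc m)
  let ?f = "\<lambda>y. measure_pmf (map_pmf (\<lambda>right. if right then y + 1 else y - 1) (bernoulli_pmf (W m y)))"
  have "(\<lambda>h. h m) \<in> measurable (PiM {0..<n} (\<lambda>_. count_space (UNIV :: int set))) (count_space UNIV)"
    using Suc by (intro measurable_component_singleton) auto
  from measurable_compose[OF this, of ?f "subprob_algebra (count_space UNIV)"]
  show ?thesis
    by (simp add: Suc walk_kernel.simps(2)[abs_def] measure_subprob)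
qed

interpretation walk: Ionescu_Tulcea "walk_kernel W" "\<lambda>_. count_space UNIV" for W
proof (rule Ionescu_Tulcea.intro)
  show "prob_space (walk_kernel W i x)" for i x
    using walk_kernel_pmf[of W i x] by (metis measure_pmf.prob_space_axioms)
qed (rule measurable_walk_kernel)

definition quenched_law :: "(nat \<Rightarrow> env) \<Rightarrow> (nat \<Rightarrow> int) measure" where
  "quenched_law W = walk.PF.lim W"

lemma sets_quenched_law: "sets (quenched_law W) = sets (\<Pi>\<^sub>M n\<in>UNIV. count_space UNIV)"
  by (simp add: quenched_law_def)

lemma prob_space_quenched_law: "prob_space (quenched_law W)"
proof -
  have "prob_space (distr (quenched_law W) (PiM {} (\<lambda>_. count_space UNIV)) (\<lambda>x. restrict x {}))"
    unfolding quenched_law_def by (subst walk.distr_lim) (auto intro: walk.PF.prob_space_P)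
  then show ?thesis
    by (rule prob_space_distrD[rotated])
       (auto simp: measurable_cong_sets[OF sets_quenched_law refl] intro!: measurable_restrict)
qed

text \<open>Sanity check: the finite-dimensional distributions are those of the Markov chain.\<close>

definition jump_prob :: "real \<Rightarrow> int \<Rightarrow> real" where
  "jump_prob p d = (let q = min 1 (max 0 p) in if d = 1 then q else if d = - 1 then 1 - q else 0)"

context
begin

interpretation pmf_as_function .

lemma pmf_bernoulli_clip:
  "pmf (bernoulli_pmf p) b = (let q = min 1 (max 0 p) in if b then q else 1 - q)"
  by transfer (simp add: Let_def)

end

lemma emeasure_walk_kernel_Suc:
  "emeasure (walk_kernel W (Suc n) h) {y} = ennreal (jump_prob (W n (h n)) (y - h n))"
proof -
  let ?f = "\<lambda>right. if right then h n + 1 else h n - 1"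
  have k: "emeasure (walk_kernel W (Suc n) h) {y} = emeasure (bernoulli_pmf (W n (h n))) (?f -` {y})"
    by (simp only: walk_kernel.simps emeasure_map_pmf)
  consider "y = h n + 1" | "y = h n - 1" | "y \<noteq> h n + 1" "y \<noteq> h n - 1" by blast
  then show ?thesis
  proof cases
    case 1
    then have "?f -` {y} = {True}" by (auto split: if_splits)
    with 1 show ?thesis unfolding k by (simp add: jump_prob_def emeasure_pmf_single pmf_bernoulli_clip)
  next
    case 2
    then have "?f -` {y} = {False}" by (auto split: if_splits)
    with 2 show ?thesis unfolding k by (simp add: jump_prob_def emeasure_pmf_single pmf_bernoulli_clip Let_def)
  next
    case 3
    then have "?f -` {y} = {}" by (auto split: if_splits)
    with 3 show ?thesis unfolding k by (simp add: jump_prob_def Let_def)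
  qed
qed

lemma emeasure_walk_C:
  "emeasure (walk.C W 0 (Suc n) (\<lambda>_. undefined)) {restrict p {0..<Suc n}} =
     (if p 0 = 0 then \<Prod>i<n. ennreal (jump_prob (W i (p i)) (p (Suc i) - p i)) else 0)"
proof -
  let ?M = "\<lambda>_::nat. count_space (UNIV :: int set)"
  have sing: "{restrict p {0..<m}} \<in> sets (PiM {0..<m} ?M)" for m
  proof -
    have "{restrict p {0..<m}} = (\<Pi>\<^sub>E i\<in>{0..<m}. {p i})"
      by (auto simp: PiE_iff extensional_def fun_eq_iff)
    also have "\<dots> \<in> sets (PiM {0..<m} ?M)"
      by (rule sets_PiM_I_finite) auto
    finally show ?thesis .
  qed
  have eP: "emeasure (walk.eP W m h) {restrict p {0..<Suc m}} =
      emeasure (walk_kernel W m (restrict p {0..<m})) {p m} * indicator {restrict p {0..<m}} h"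
    if h: "h \<in> space (PiM {0..<m} ?M)" for m h
  proof -
    have ext: "h \<in> extensional {0..<m}" using h by (auto simp: space_PiM PiE_iff)
    have "emeasure (walk.eP W m h) {restrict p {0..<Suc m}} =
        emeasure (walk_kernel W m h) ((\<lambda>x. h(m := x)) -` {restrict p {0..<Suc m}})"
      using walk.emeasure_eP[OF h sing] by simp
    also have "(\<lambda>x. h(m := x)) -` {restrict p {0..<Suc m}} =
        (if h = restrict p {0..<m} then {p m} else {})"
    proof -
      have "h(m := x) = restrict p {0..<Suc m} \<longleftrightarrow> h = restrict p {0..<m} \<and> x = p m" for x
      proof
        assume e: "h(m := x) = restrict p {0..<Suc m}"
        have "h i = restrict p {0..<m} i" for i
          using fun_cong[OF e, of i] ext by (cases "i = m") (auto simp: extensional_def)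
        then show "h = restrict p {0..<m} \<and> x = p m"
          using fun_cong[OF e, of m] by (auto simp: fun_eq_iff)
      qed (auto simp: fun_eq_iff)
      note * = this
      show ?thesis
        by (rule set_eqI, simp only: vimage_singleton_eq *) simp
    qed
    finally show ?thesis
      by (cases "h = restrict p {0..<m}")
        (simp_all only: if_True if_False refl emeasure_empty indicator_simps singleton_iff
          mult_1_right mult_zero_right not_False_eq_True)
  qed
  have step: "emeasure (walk.C W 0 (Suc m) (\<lambda>_. undefined)) {restrict p {0..<Suc m}} =
      emeasure (walk_kernel W m (restrict p {0..<m})) {p m} *
      emeasure (walk.C W 0 m (\<lambda>_. undefined)) {restrict p {0..<m}}" for m
  proof -
    have u: "(\<lambda>_. undefined) \<in> space (PiM {0..<0} ?M)" by (simp add: space_PiM)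
    have sp: "space (walk.C W 0 m (\<lambda>_. undefined)) = space (PiM {0..<m} ?M)"
      using walk.space_C[OF u] by simp
    have st: "sets (walk.C W 0 m (\<lambda>_. undefined)) = sets (PiM {0..<m} ?M)"
      using walk.sets_C[OF u] by simp
    have "emeasure (walk.C W 0 (Suc m) (\<lambda>_. undefined)) {restrict p {0..<Suc m}} =
        (\<integral>\<^sup>+h. emeasure (walk.eP W m h) {restrict p {0..<Suc m}} \<partial>walk.C W 0 m (\<lambda>_. undefined))"
      unfolding walk.C.simps add_0
    proof (rule emeasure_bind[OF _ _ sing])
      show "space (walk.C W 0 m (\<lambda>_. undefined)) \<noteq> {}" by (simp add: sp)
      show "walk.eP W m \<in> measurable (walk.C W 0 m (\<lambda>_. undefined)) (subprob_algebra (PiM {0..<Suc m} ?M))"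
        using walk.measurable_eP[of W m] by (simp only: measurable_cong_sets[OF st refl])
    qed
    also have "\<dots> = (\<integral>\<^sup>+h. emeasure (walk_kernel W m (restrict p {0..<m})) {p m} *
        indicator {restrict p {0..<m}} h \<partial>walk.C W 0 m (\<lambda>_. undefined))"
      by (intro nn_integral_cong eP) (simp add: sp)
    also have "\<dots> = emeasure (walk_kernel W m (restrict p {0..<m})) {p m} *
      emeasure (walk.C W 0 m (\<lambda>_. undefined)) {restrict p {0..<m}}"
      by (intro nn_integral_cmult_indicator) (simp add: st sing)
    finally show ?thesis .
  qed
  show ?thesis
  proof (induction n)
    case 0
    have "emeasure (walk.C W 0 0 (\<lambda>_. undefined)) {restrict p {0..<0}} = 1"
      using sing[of 0] by (simp add: restrict_def)
    then show ?case
      unfolding step[of 0] by (simp add: emeasure_pmf_single)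
  next
    case (Suc n)
    have "restrict p {0..<Suc n} n = p n" by simp
    then show ?case
      unfolding step[of "Suc n"] Suc emeasure_walk_kernel_Suc by (simp add: mult.commute)
  qed
qed

lemma emeasure_quenched_law_cylinder:
  "emeasure (quenched_law W) {x. \<forall>i\<le>n. x i = p i} =
     (if p 0 = 0 then \<Prod>i<n. ennreal (jump_prob (W i (p i)) (p (Suc i) - p i)) else 0)"
proof -
  let ?M = "\<lambda>_::nat. count_space (UNIV :: int set)"
  let ?J = "{0..<Suc n}"
  have eq: "{restrict p ?J} = (\<Pi>\<^sub>E i\<in>?J. {p i})"
    by (auto simp: PiE_iff extensional_def fun_eq_iff)
  have sing: "{restrict p ?J} \<in> sets (PiM ?J ?M)"
    unfolding eq by (rule sets_PiM_I_finite) auto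
  have "{x. \<forall>i\<le>n. x i = p i} = prod_emb UNIV ?M ?J {restrict p ?J}"
  proof (intro set_eqI)
    fix x
    have "(\<forall>i\<le>n. x i = p i) \<longleftrightarrow> restrict x ?J = restrict p ?J"
      by (metis (mono_tags, lifting) atLeastLessThan_iff le0 less_Suc_eq_le restrict_apply' restrict_ext)
    then show "x \<in> {x. \<forall>i\<le>n. x i = p i} \<longleftrightarrow> x \<in> prod_emb UNIV ?M ?J {restrict p ?J}"
      by (simp add: prod_emb_def space_PiM)
  qed
  then have "emeasure (quenched_law W) {x. \<forall>i\<le>n. x i = p i} = emeasure (walk.CI W ?J) {restrict p ?J}"
    unfolding quenched_law_def using sing by (simp add: walk.lim)
  also have "\<dots> = emeasure (walk.C W 0 (Suc n) (\<lambda>_. undefined)) {restrict p ?J}"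
    using walk.emeasure_CI[of ?J "Suc n", OF _ sing] sets.sets_into_space[OF sing]
    by (simp add: space_PiM prod_emb_id del: walk.C.simps)
  finally show ?thesis by (simp only: emeasure_walk_C)
qed

lemma sets_path_space:
  "sets (\<Pi>\<^sub>M n\<in>UNIV. count_space UNIV) =
     sigma_sets (UNIV :: (nat \<Rightarrow> int) set) (insert {} {{x. \<forall>i\<le>n. x i = p i} | n p. True})"
proof -
  let ?S = "UNIV :: (nat \<Rightarrow> int) set"
  let ?G = "insert {} {{x :: nat \<Rightarrow> int. \<forall>i\<le>n. x i = p i} | n p. True}"
  let ?M = "\<lambda>_::nat. count_space (UNIV :: int set)"
  interpret G: sigma_algebra ?S "sigma_sets ?S ?G" by (rule sigma_algebra_sigma_sets) auto
  have "{f. f i \<in> A} \<in> sigma_sets ?S ?G" for i and A :: "int set"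
  proof -
    have "{f. f i \<in> A} = (\<Union>xs\<in>{xs. xs ! i \<in> A}. {x. \<forall>j\<le>i. x j = xs ! j})"
    proof (safe, goal_cases)
      case (1 f)
      have "(map f [0..<Suc i]) ! j = f j" if "j \<le> i" for j
        using that by (metis add_0 diff_zero le_imp_less_Suc length_upt nth_map nth_upt)
      with 1 show ?case by (intro UN_I[of "map f [0..<Suc i]"]) auto
    qed auto
    also have "\<dots> \<in> sigma_sets ?S ?G"
      by (intro G.countable_UN') (auto intro!: sigma_sets.Basic)
    finally show ?thesis .
  qed
  then have "sets (PiM UNIV ?M) \<subseteq> sigma_sets ?S ?G"
    unfolding sets_PiM_single space_count_space PiE_UNIV_domain Pi_UNIV
    by (intro G.sigma_sets_subset) auto
  moreover have "sigma_sets ?S ?G \<subseteq> sets (PiM UNIV ?M)"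
  proof -
    have "{x. \<forall>i\<le>n. x i = p i} \<in> sets (PiM UNIV ?M)" for n and p :: "nat \<Rightarrow> int"
    proof -
      have "{x. \<forall>i\<le>n. x i = p i} = prod_emb UNIV ?M {..n} (\<Pi>\<^sub>E i\<in>{..n}. {p i})"
        by (auto simp: prod_emb_PiE_same_index prod_emb_def space_PiM PiE_iff)
      then show ?thesis by (simp add: sets_PiM_I)
    qed
    then show ?thesis
      using sets.sigma_sets_subset[of ?G "PiM UNIV ?M"] by (auto simp: space_PiM)
  qed
  ultimately show ?thesis by auto
qed

lemma measurable_quenched_law:
  assumes "sets N = sets (borel :: real measure)"
  shows "quenched_law \<in> measurable (\<Pi>\<^sub>M n\<in>UNIV. \<Pi>\<^sub>M x\<in>UNIV. N) (prob_algebra (\<Pi>\<^sub>M n\<in>UNIV. count_space UNIV))"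
proof (rule measurable_prob_algebra_generated[OF sets_path_space])
  let ?G = "insert {} {{x :: nat \<Rightarrow> int. \<forall>i\<le>n. x i = p i} | n p. True}"
  have Int: "{x :: nat \<Rightarrow> int. \<forall>i\<le>n. x i = p i} \<inter> {x. \<forall>i\<le>m. x i = q i} \<in> ?G" if "n \<le> m" for n m p q
  proof (cases "\<forall>i\<le>n. p i = q i")
    case True
    with that have "{x. \<forall>i\<le>n. x i = p i} \<inter> {x. \<forall>i\<le>m. x i = q i} = {x. \<forall>i\<le>m. x i = q i}" by auto
    then show ?thesis by blast
  next
    case False
    with that have "{x. \<forall>i\<le>n. x i = p i} \<inter> {x. \<forall>i\<le>m. x i = q i} = {}" by auto
    then show ?thesis by auto
  qed
  show "Int_stable ?G"
  proof (rule Int_stableI)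
    fix A B assume "A \<in> ?G" "B \<in> ?G"
    then consider "A = {} \<or> B = {}" | n p m q where "A = {x. \<forall>i\<le>n. x i = p i}" "B = {x. \<forall>i\<le>m. x i = q i}"
      by blast
    then show "A \<inter> B \<in> ?G"
    proof cases
      case (2 n p m q)
      then show ?thesis using Int[of n m p q] Int[of m n q p]
        by (metis (no_types, lifting) Int_commute nat_le_linear)
    qed auto
  qed
  show "(\<lambda>W. emeasure (quenched_law W) A) \<in> borel_measurable (\<Pi>\<^sub>M n\<in>UNIV. \<Pi>\<^sub>M x\<in>UNIV. N)"
    if "A \<in> ?G" for A
  proof -
    have [measurable_cong]: "sets N = sets borel" by fact
    have [measurable]: "(\<lambda>W. jump_prob (W i y) d) \<in> borel_measurable (\<Pi>\<^sub>M n\<in>UNIV. \<Pi>\<^sub>M x\<in>UNIV. N)"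
      for i :: nat and y :: int and d
    proof -
      have "(\<lambda>W. W i y) \<in> borel_measurable (\<Pi>\<^sub>M n\<in>UNIV. \<Pi>\<^sub>M x\<in>UNIV. N)"
        using measurable_compose[OF measurable_component_singleton[of i UNIV "\<lambda>_. \<Pi>\<^sub>M x\<in>UNIV. N"]
            measurable_component_singleton[of y UNIV "\<lambda>_. N"]]
        by (simp add: measurable_cong_sets[OF refl assms])
      then show ?thesis unfolding jump_prob_def Let_def by measurable
    qed
    from that consider "A = {}" | n p where "A = {x. \<forall>i\<le>n. x i = p i}" by blast
    then show ?thesis
      by cases (simp_all add: emeasure_quenched_law_cylinder)
  qed
qed (auto simp: prob_space_quenched_law sets_quenched_law)

definition env_law :: "real measure \<Rightarrow> env measure" where
  "env_law \<alpha> = (\<Pi>\<^sub>M x\<in>UNIV. \<alpha>)"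

definition static_law :: "real measure \<Rightarrow> (nat \<Rightarrow> int) measure" where
  "static_law \<alpha> = env_law \<alpha> \<bind> (\<lambda>\<omega>. quenched_law (\<lambda>n. \<omega>))"

definition rwre_speed :: "real measure \<Rightarrow> real" where
  "rwre_speed \<alpha> = (THE v. AE z in static_law \<alpha>. (\<lambda>n. real_of_int (z n) / real n) \<longlonglongrightarrow> v)"

definition epoch :: "(nat \<Rightarrow> nat) \<Rightarrow> nat \<Rightarrow> nat" where
  "epoch \<tau> n = (THE k. \<tau> k \<le> n \<and> n < \<tau> (Suc k))"

text \<open>
  In \<open>cooling_env_law\<close>, \<open>\<eta> k\<close> is the environment drawn at time \<open>\<tau> k\<close>.
\<close>

definition cooling_env_law :: "real measure \<Rightarrow> (nat \<Rightarrow> nat) \<Rightarrow> (nat \<Rightarrow> env) measure" where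
  "cooling_env_law \<alpha> \<tau> =
     distr (\<Pi>\<^sub>M k\<in>UNIV. env_law \<alpha>) (\<Pi>\<^sub>M n\<in>UNIV. env_law \<alpha>) (\<lambda>\<eta> n. \<eta> (epoch \<tau> n))"

definition rwcre_law :: "real measure \<Rightarrow> (nat \<Rightarrow> nat) \<Rightarrow> (nat \<Rightarrow> int) measure" where
  "rwcre_law \<alpha> \<tau> = cooling_env_law \<alpha> \<tau> \<bind> quenched_law"

lemma
  assumes "real_distribution \<alpha>"
  shows prob_space_static_law: "prob_space (static_law \<alpha>)"
    and prob_space_rwcre_law: "prob_space (rwcre_law \<alpha> \<tau>)"
    and sets_static_law: "sets (static_law \<alpha>) = sets (\<Pi>\<^sub>M n\<in>UNIV. count_space UNIV)"
    and sets_rwcre_law: "sets (rwcre_law \<alpha> \<tau>) = sets (\<Pi>\<^sub>M n\<in>UNIV. count_space UNIV)"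
proof -
  interpret real_distribution \<alpha> by fact
  let ?path = "(\<Pi>\<^sub>M n\<in>UNIV. count_space UNIV) :: (nat \<Rightarrow> int) measure"
  let ?seq = "\<Pi>\<^sub>M n\<in>(UNIV :: nat set). env_law \<alpha>"
  have Q: "quenched_law \<in> measurable ?seq (prob_algebra ?path)"
    unfolding env_law_def by (intro measurable_quenched_law) simp
  have env: "prob_space (env_law \<alpha>)"
    unfolding env_law_def by (intro prob_space_PiM prob_space_axioms)
  have "(\<lambda>\<omega> n. \<omega>) \<in> measurable (env_law \<alpha>) ?seq"
    by (rule measurable_PiM_single') (auto simp: space_PiM)
  then have S: "(\<lambda>\<omega>. quenched_law (\<lambda>n. \<omega>)) \<in> measurable (env_law \<alpha>) (prob_algebra ?path)"
    using Q by (rule measurable_compose)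
  have "(\<lambda>\<eta> n. \<eta> (epoch \<tau> n)) \<in> measurable ?seq ?seq"
    by (rule measurable_PiM_single') (auto simp: space_PiM)
  then have "prob_space (cooling_env_law \<alpha> \<tau>)"
    unfolding cooling_env_law_def by (intro prob_space.prob_space_distr prob_space_PiM env)
  moreover have sets: "sets (cooling_env_law \<alpha> \<tau>) = sets ?seq"
    by (simp add: cooling_env_law_def)
  ultimately have C: "cooling_env_law \<alpha> \<tau> \<in> space (prob_algebra ?seq)"
    by (simp add: space_prob_algebra)
  have E: "env_law \<alpha> \<in> space (prob_algebra (env_law \<alpha>))"
    using env by (simp add: space_prob_algebra)
  show "prob_space (static_law \<alpha>)"
    using prob_space_bind'[OF E S] unfolding static_law_def by (simp add: space_prob_algebra)
  show "prob_space (rwcre_law \<alpha> \<tau>)"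
    using prob_space_bind'[OF C Q] unfolding rwcre_law_def by (simp add: space_prob_algebra)
  show "sets (static_law \<alpha>) = sets ?path"
    using sets_bind'[OF E S] unfolding static_law_def by simp
  show "sets (rwcre_law \<alpha> \<tau>) = sets ?path"
    using sets_bind'[OF C Q] unfolding rwcre_law_def by simp
qed

definition rho :: "real \<Rightarrow> real" where
  "rho w = (1 - w) / w"

text \<open>
  Expectation with values in \<open>[-\<infinity>, \<infinity>]\<close>. In \<^typ>\<open>ereal\<close> we have \<open>\<infinity> - \<infinity> = \<infinity>\<close>, so an upper bound
  \<open>ext_expectation M f \<le> 0\<close> includes that the positive part of \<open>f\<close> is integrable, i.e. that the
  expectation is well defined; the value \<open>-\<infinity>\<close> is allowed.
\<close>

definition ext_expectation :: "'a measure \<Rightarrow> ('a \<Rightarrow> real) \<Rightarrow> ereal" where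
  "ext_expectation M f =
     enn2ereal (\<integral>\<^sup>+x. ennreal (f x) \<partial>M) - enn2ereal (\<integral>\<^sup>+x. ennreal (- f x) \<partial>M)"

end

theory Submission
  imports Defs
begin

text \<open>
  By the triangle inequality in \<open>L\<^sup>1\<close>, \<open>E \<bar>X\<^sub>n - n v\<bar>\<close> is at most the sum over the epochs of
  \<open>e t = E \<bar>Z\<^sub>t - t v\<bar>\<close>, \<open>t\<close> the length of the epoch. Since \<open>e t = o(t)\<close> once \<open>Z\<^sub>t / t \<rightarrow> v\<close>, and
  the number of epochs up to time \<open>n\<close> is \<open>o(n)\<close>, everything reduces to the law of large numbers for
  the static walk. Let \<open>r = \<langle>\<rho>\<rangle>\<close>.

  Upper bound on the speed: \<open>\<phi> x = \<Prod>i<x. 1 + s A\<^sub>i\<close> satisfies \<open>E \<phi>(Z\<^sub>n) \<le> (1 + s)\<^sup>n\<close> if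
  \<open>A\<^sub>i \<le> 1 + \<rho>\<^sub>i + \<rho>\<^sub>i A\<^bsub>i-1\<^esub> / (1 + s A\<^bsub>i-1\<^esub>)\<close>. Resetting \<open>A\<close> at multiples of \<open>m\<close> makes \<open>\<phi>\<close> a
  product of independent blocks, so that the annealed probability of \<open>Z\<^sub>n \<ge> u n\<close> decays exponentially
  as soon as \<open>1 / u < (1 + r) (1 + r + r\<^sup>2 + \<dots>)\<close>, by letting first \<open>s \<rightarrow> 0\<close> and then \<open>m \<rightarrow> \<infinity>\<close>. If
  \<open>r \<ge> 1\<close>, this and its mirror image (\<open>\<langle>1 / \<rho>\<rangle> \<ge> 1\<close> because \<open>\<langle>ln \<rho>\<rangle> \<le> 0\<close>) give speed \<open>0\<close>. If \<open>r < 1\<close>, the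
  environment seen from the walk has an explicit invariant density, under which the mean step is
  \<open>v = (1 - r) / (1 + r)\<close>. A stationary average whose upper limit is at most its mean converges to the
  mean, by the maximal ergodic inequality.
\<close>

subsection \<open>The Markov property of the quenched walk\<close>

text \<open>The recursion for A is the supermartingale inequality solved for A: if \<phi>(x + 1) =
  (1 + s A_x) \<phi>(x), then one step from x > 0 multiplies the mean of \<phi> by at most 1 + s
  exactly under the stated bound, because 1 / \<omega> = 1 + \<rho>. Without resetting and with
  equality, 1 / (1 + s A_x) is the generating function at 1 / (1 + s) of the time to cross from x to
  x + 1 when a step to -1 is undone at once; A_x at s = 0 is the quenched mean of that time. Its
  annealed mean (1 + r) (1 + r + ... + r^x) increases to 1 / v if r < 1 and to infinity otherwise,
  so the exponential bound detects the true speed. The value r = \<infinity> is allowed there.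

  For r < 1 this settles only the upper limit. Exponential bounds for slow walks cannot be expected,
  since traps may delay the walk with larger probability. The mean step under the stationary law
  supplies the other half: with the upper limit under control, no mass can be left for a smaller
  lower limit, and this takes the place of ergodicity. The density is positive everywhere, so almost
  sure statements pass between the stationary and the static law in both directions.\<close>

abbreviation path_space :: "(nat \<Rightarrow> int) measure" where
  "path_space \<equiv> \<Pi>\<^sub>M n\<in>UNIV. count_space UNIV"

definition prepend_step :: "int \<Rightarrow> (nat \<Rightarrow> int) \<Rightarrow> nat \<Rightarrow> int" where
  "prepend_step d z n = (case n of 0 \<Rightarrow> 0 | Suc k \<Rightarrow> d + z k)"

text \<open>Time and space are shifted together, so that the walk after its first step is again a
  walk started at 0 at time 0. One family of quenched laws thus serves for all starting points and
  times.\<close>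

definition env_after :: "(nat \<Rightarrow> env) \<Rightarrow> int \<Rightarrow> nat \<Rightarrow> env" where
  "env_after W d = (\<lambda>n x. W (Suc n) (x + d))"

text \<open>The same clipping as in \<open>bernoulli_pmf\<close>. It lets the identities for the
  quenched walk hold for every \<open>W\<close>, without restriction to values in (0, 1).\<close>

definition right_prob :: "real \<Rightarrow> real" where
  "right_prob p = min 1 (max 0 p)"

lemma right_prob_bounds [simp]: "0 \<le> right_prob p" "right_prob p \<le> 1"
  by (auto simp: right_prob_def)

lemma right_prob_id: "0 < p \<Longrightarrow> p < 1 \<Longrightarrow> right_prob p = p"
  by (simp add: right_prob_def)

lemma space_path_space [simp]: "space path_space = UNIV"
  by (simp add: space_PiM)

lemma measurable_path_coord [measurable]: "(\<lambda>z. z n) \<in> measurable path_space (count_space UNIV)"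
  by (rule measurable_component_singleton) auto

lemma sets_quenched_law' [simp, measurable_cong]: "sets (quenched_law W) = sets path_space"
  by (rule sets_quenched_law)

lemma space_quenched_law [simp]: "space (quenched_law W) = UNIV"
  using sets_eq_imp_space_eq[OF sets_quenched_law] by simp

lemma measurable_prepend_step [measurable]: "prepend_step d \<in> measurable path_space path_space"
proof (rule measurable_PiM_single')
  fix n show "(\<lambda>z. prepend_step d z n) \<in> path_space \<rightarrow>\<^sub>M count_space UNIV"
    by (cases n) (auto simp: prepend_step_def)
qed auto

text \<open>For n = 0 the cylinder constrains only the value 0 at time 0, and the truncated
  \<open>n - 1\<close> leaves an empty product. For n > 0 the path \<open>z\<close> has to start at
  \<open>p 1 - d\<close>, which has positive mass only if \<open>p 1 = d\<close>.\<close>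

lemma emeasure_prepend_cylinder:
  "emeasure (quenched_law V) {z. \<forall>i\<le>n. prepend_step d z i = p i} =
    (if p 0 = 0 \<and> (n = 0 \<or> p 1 = d) then \<Prod>i<n - 1. ennreal (jump_prob (V i (p (Suc i) - d)) (p (Suc (Suc i)) - p (Suc i))) else 0)"
proof (cases n)
  case 0
  interpret prob_space "quenched_law V" by (rule prob_space_quenched_law)
  show ?thesis using 0 emeasure_space_1 by (simp add: prepend_step_def)
next
  case (Suc k)
  have "{z. \<forall>i\<le>n. prepend_step d z i = p i} = (if p 0 = 0 then {z. \<forall>i\<le>k. z i = p (Suc i) - d} else {})"
  proof -
    have "(\<forall>i\<le>n. prepend_step d z i = p i) \<longleftrightarrow> p 0 = 0 \<and> (\<forall>i\<le>k. z i = p (Suc i) - d)" for z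
    proof -
      have "(\<forall>i\<le>n. prepend_step d z i = p i) \<longleftrightarrow>
          prepend_step d z 0 = p 0 \<and> (\<forall>i\<le>k. prepend_step d z (Suc i) = p (Suc i))"
        unfolding Suc using All_less_Suc2[of "Suc k" "\<lambda>i. prepend_step d z i = p i"]
        by (simp only: less_Suc_eq_le)
      then show ?thesis by (auto simp: prepend_step_def algebra_simps)
    qed
    then show ?thesis by auto
  qed
  then show ?thesis using Suc
    by (auto simp: emeasure_quenched_law_cylinder)
qed

text \<open>The two measures agree on cylinders, which are stable under intersection and generate
  the path space. The Markov property and the comparison lemmas below are inductions based on this
  identity.\<close>

lemma quenched_law_first_step:
  "quenched_law W = measure_pmf (bernoulli_pmf (W 0 0)) \<bind>
     (\<lambda>b. distr (quenched_law (env_after W (if b then 1 else -1))) path_space (prepend_step (if b then 1 else -1)))"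
proof -
  let ?B = "measure_pmf (bernoulli_pmf (W 0 0))"
  let ?K = "\<lambda>b. distr (quenched_law (env_after W (if b then 1 else -1))) path_space (prepend_step (if b then 1 else -1))"
  let ?G = "insert {} {{x :: nat \<Rightarrow> int. \<forall>i\<le>n. x i = p i} | n p. True}"
  have K: "?K \<in> measurable ?B (subprob_algebra path_space)"
    by (auto simp: space_subprob_algebra intro!: prob_space_imp_subprob_space prob_space.prob_space_distr
        prob_space_quenched_law)
  have Int: "{x :: nat \<Rightarrow> int. \<forall>i\<le>n. x i = p i} \<inter> {x. \<forall>i\<le>m. x i = q i} \<in> ?G" if "n \<le> m" for n m p q
  proof (cases "\<forall>i\<le>n. p i = q i")
    case True
    with that have "{x. \<forall>i\<le>n. x i = p i} \<inter> {x. \<forall>i\<le>m. x i = q i} = {x. \<forall>i\<le>m. x i = q i}" by auto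
    then show ?thesis by blast
  next
    case False
    with that have "{x. \<forall>i\<le>n. x i = p i} \<inter> {x. \<forall>i\<le>m. x i = q i} = {}" by auto
    then show ?thesis by auto
  qed
  have cyl [measurable]: "{x. \<forall>i\<le>n. x i = p i} \<in> sets path_space" for n and p :: "nat \<Rightarrow> int"
    unfolding sets_path_space by (rule sigma_sets.Basic) auto
  have 1: "emeasure (quenched_law W) A = emeasure (Giry_Monad.bind ?B ?K) A" if "A \<in> ?G" for A
  proof -
    from that consider "A = {}" | n p where "A = {x. \<forall>i\<le>n. x i = p i}" by blast
    then show ?thesis
    proof cases
      case 2
      let ?q = "right_prob (W 0 0)"
      have "emeasure (Giry_Monad.bind ?B ?K) A = (\<integral>\<^sup>+b. emeasure (?K b) A \<partial>?B)"
        using 2 by (intro emeasure_bind[OF _ K]) auto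
      also have "\<dots> = (\<Sum>b\<in>UNIV. emeasure (?K b) A * pmf (bernoulli_pmf (W 0 0)) b)"
        by (rule nn_integral_measure_pmf_support) auto
      also have "\<dots> = ennreal ?q * emeasure (quenched_law (env_after W 1)) {z. \<forall>i\<le>n. prepend_step 1 z i = p i}
         + ennreal (1 - ?q) * emeasure (quenched_law (env_after W (-1))) {z. \<forall>i\<le>n. prepend_step (-1) z i = p i}"
        using 2 by (simp add: UNIV_bool emeasure_distr pmf_bernoulli_clip Let_def right_prob_def vimage_def mult.commute add.commute)
      also have "\<dots> = emeasure (quenched_law W) A"
      proof (cases n)
        case 0
        have "ennreal ?q + ennreal (1 - ?q) = 1"
          by (subst ennreal_plus[symmetric]) auto
        with 0 2 emeasure_quenched_law_cylinder[of W 0 p] show ?thesis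
          unfolding emeasure_prepend_cylinder by (auto simp del: One_nat_def)
      next
        case (Suc k)
        have "emeasure (quenched_law W) A = (if p 0 = 0 then ennreal (jump_prob (W 0 0) (p 1)) * (\<Prod>i<k. ennreal (jump_prob (W (Suc i) (p (Suc i))) (p (Suc (Suc i)) - p (Suc i)))) else 0)"
          using 2 Suc unfolding 2 emeasure_quenched_law_cylinder Suc prod.lessThan_Suc_shift by simp
        then show ?thesis
          unfolding emeasure_prepend_cylinder using Suc
          by (auto simp: env_after_def jump_prob_def right_prob_def Let_def)
      qed
      finally show ?thesis by simp
    qed simp
  qed
  interpret Q: prob_space "quenched_law W" by (rule prob_space_quenched_law)
  show ?thesis
  \<comment> \<open>The countable cover by cylinders fixes only the position at time 0; the constant
    function \<open>\<lambda>_. from_nat i\<close> gives it literally the form of the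
    generator.\<close>
  proof (rule measure_eqI_generator_eq[where E = ?G and \<Omega> = UNIV and A = "\<lambda>i. {x. \<forall>j\<le>0. x j = (\<lambda>_. from_nat i) j}"])
    show "Int_stable ?G"
    proof (rule Int_stableI)
      fix A B assume "A \<in> ?G" "B \<in> ?G"
      then consider "A = {} \<or> B = {}" | n p m q where "A = {x. \<forall>i\<le>n. x i = p i}" "B = {x. \<forall>i\<le>m. x i = q i}"
        by blast
      then show "A \<inter> B \<in> ?G"
      proof cases
        case (2 n p m q)
        then show ?thesis using Int[of n m p q] Int[of m n q p]
          by (metis (no_types, lifting) Int_commute nat_le_linear)
      qed auto
    qed
    show "sets (quenched_law W) = sigma_sets UNIV ?G" using sets_path_space by simp
    have "sets (Giry_Monad.bind ?B ?K) = sets path_space" by (rule sets_bind[OF sets_kernel[OF K]]) auto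
    then show "sets (Giry_Monad.bind ?B ?K) = sigma_sets UNIV ?G" using sets_path_space by simp
    show "(\<Union>i. {x :: nat \<Rightarrow> int. \<forall>j\<le>0. x j = (\<lambda>_. from_nat i) j}) = UNIV"
      by (auto intro: from_nat_to_nat[symmetric])
    show "range (\<lambda>i. {x :: nat \<Rightarrow> int. \<forall>j\<le>0. x j = (\<lambda>_. from_nat i) j}) \<subseteq> ?G"
    proof (rule image_subsetI, rule insertI2, rule CollectI)
      fix i :: nat
      show "\<exists>n p. {x :: nat \<Rightarrow> int. \<forall>j\<le>0. x j = (\<lambda>_. from_nat i) j} = {x. \<forall>i\<le>n. x i = p i} \<and> True"
        by (intro exI conjI TrueI) (rule refl)
    qed
    show "emeasure (quenched_law W) {x. \<forall>j\<le>0. x j = (\<lambda>_. from_nat i) j} \<noteq> \<infinity>" for i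
      by simp
    show "emeasure (quenched_law W) A = emeasure (Giry_Monad.bind ?B ?K) A" if "A \<in> ?G" for A
      using that by (rule 1)
  qed simp
qed

lemma nn_integral_first_step:
  assumes [measurable]: "F \<in> borel_measurable path_space"
  shows "(\<integral>\<^sup>+z. F z \<partial>quenched_law W) =
    ennreal (right_prob (W 0 0)) * (\<integral>\<^sup>+z. F (prepend_step 1 z) \<partial>quenched_law (env_after W 1)) +
    ennreal (1 - right_prob (W 0 0)) * (\<integral>\<^sup>+z. F (prepend_step (-1) z) \<partial>quenched_law (env_after W (-1)))"
proof -
  let ?B = "measure_pmf (bernoulli_pmf (W 0 0))"
  let ?K = "\<lambda>b. distr (quenched_law (env_after W (if b then 1 else -1))) path_space (prepend_step (if b then 1 else -1))"
  have K: "?K \<in> measurable ?B (subprob_algebra path_space)"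
    by (auto simp: space_subprob_algebra intro!: prob_space_imp_subprob_space prob_space.prob_space_distr
        prob_space_quenched_law)
  have "(\<integral>\<^sup>+z. F z \<partial>quenched_law W) = (\<integral>\<^sup>+b. \<integral>\<^sup>+z. F z \<partial>?K b \<partial>?B)"
    by (subst quenched_law_first_step, rule nn_integral_bind[OF assms K])
  also have "\<dots> = (\<Sum>b\<in>UNIV. (\<integral>\<^sup>+z. F z \<partial>?K b) * pmf (bernoulli_pmf (W 0 0)) b)"
    by (rule nn_integral_measure_pmf_support) auto
  finally show ?thesis
    by (simp add: UNIV_bool nn_integral_distr pmf_bernoulli_clip Let_def right_prob_def mult.commute add.commute)
qed

lemma quenched_law_0: "AE z in quenched_law W. z 0 = 0"
proof -
  interpret prob_space "quenched_law W" by (rule prob_space_quenched_law)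
  have "emeasure (quenched_law W) {z. z 0 = 0} = 1"
    using emeasure_quenched_law_cylinder[of W 0 "\<lambda>_. 0"] by simp
  then show ?thesis by (subst AE_iff_emeasure_eq_1) auto
qed

text \<open>Induction on the fixed time \<open>a\<close> by first-step decomposition.
  \<open>W\<close> has to be arbitrary because the first step replaces it by
  \<open>env_after W d\<close>.\<close>

lemma nn_integral_markov:
  assumes [measurable]: "G \<in> borel_measurable path_space"
  shows "(\<integral>\<^sup>+z. G (\<lambda>n. z (a + n) - z a) \<partial>quenched_law W) =
    (\<integral>\<^sup>+z. (\<integral>\<^sup>+y. G y \<partial>quenched_law (\<lambda>n x. W (a + n) (x + z a))) \<partial>quenched_law W)"
proof (induction a arbitrary: W)
  case 0
  interpret prob_space "quenched_law W" by (rule prob_space_quenched_law)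
  have "(\<integral>\<^sup>+z. G (\<lambda>n. z n - z 0) \<partial>quenched_law W) = (\<integral>\<^sup>+z. G z \<partial>quenched_law W)"
    by (rule nn_integral_cong_AE) (use quenched_law_0[of W] in \<open>auto elim!: eventually_mono\<close>)
  also have "\<dots> = (\<integral>\<^sup>+_. (\<integral>\<^sup>+y. G y \<partial>quenched_law W) \<partial>quenched_law W)"
    using emeasure_space_1 by simp
  also have "\<dots> = (\<integral>\<^sup>+z. (\<integral>\<^sup>+y. G y \<partial>quenched_law (\<lambda>n x. W n (x + z 0))) \<partial>quenched_law W)"
    by (rule nn_integral_cong_AE) (use quenched_law_0[of W] in \<open>auto elim!: eventually_mono\<close>)
  finally show ?case by simp
next
  case (Suc a)
  have shift: "(\<lambda>z n. z (b + n) - z b) \<in> measurable path_space path_space" for b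
    by (rule measurable_PiM_single') auto
  have 1: "(\<lambda>z. G (\<lambda>n. z (Suc a + n) - z (Suc a))) \<in> borel_measurable path_space"
    using measurable_compose[OF shift[of "Suc a"] assms] .
  have 2: "(\<lambda>z. \<integral>\<^sup>+y. G y \<partial>quenched_law (\<lambda>n x. W (Suc a + n) (x + z (Suc a)))) \<in> borel_measurable path_space"
    by (rule measurable_compose[OF measurable_path_coord[of "Suc a"], where g = "\<lambda>k. \<integral>\<^sup>+y. G y \<partial>quenched_law (\<lambda>n x. W (Suc a + n) (x + k))"]) auto
  \<comment> \<open>A prepended step d cancels in the increments and moves the time by one, so this
    is the induction hypothesis for \<open>env_after W d\<close>.\<close>
  have 3: "(\<integral>\<^sup>+z. G (\<lambda>n. prepend_step d z (Suc a + n) - prepend_step d z (Suc a)) \<partial>quenched_law (env_after W d))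
    = (\<integral>\<^sup>+z. (\<integral>\<^sup>+y. G y \<partial>quenched_law (\<lambda>n x. W (Suc a + n) (x + prepend_step d z (Suc a)))) \<partial>quenched_law (env_after W d))" for d
    using Suc.IH[of "env_after W d"] by (simp add: prepend_step_def env_after_def ac_simps)
  show ?case
    unfolding nn_integral_first_step[OF 1] nn_integral_first_step[OF 2] 3 ..
qed

text \<open>The hypothesis is invariant under translating \<open>\<omega>\<close> and
  \<open>f\<close> together, which is what the first step does to them; each step then contributes
  one factor \<open>c\<close>.\<close>

lemma nn_integral_supermartingale:
  assumes "\<And>x. ennreal (right_prob (\<omega> x)) * f (x + 1) + ennreal (1 - right_prob (\<omega> x)) * f (x - 1) \<le> c * f x"
  shows "(\<integral>\<^sup>+z. f (z n) \<partial>quenched_law (\<lambda>_. \<omega>)) \<le> c ^ n * f 0"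
  using assms
proof (induction n arbitrary: \<omega> f)
  case 0
  interpret prob_space "quenched_law (\<lambda>_. \<omega>)" by (rule prob_space_quenched_law)
  have "(\<integral>\<^sup>+z. f (z 0) \<partial>quenched_law (\<lambda>_. \<omega>)) = (\<integral>\<^sup>+z. f 0 \<partial>quenched_law (\<lambda>_. \<omega>))"
    by (rule nn_integral_cong_AE) (use quenched_law_0[of "\<lambda>_. \<omega>"] in \<open>auto elim!: eventually_mono\<close>)
  then show ?case using emeasure_space_1 by simp
next
  case (Suc n)
  have *: "(\<integral>\<^sup>+z. f (prepend_step d z (Suc n)) \<partial>quenched_law (env_after (\<lambda>_. \<omega>) d)) \<le> c ^ n * f d" for d
    using Suc.IH[of "\<lambda>x. \<omega> (x + d)" "\<lambda>x. f (d + x)"] Suc.prems[of "_ + d"]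
    by (simp add: prepend_step_def env_after_def algebra_simps)
  have "(\<integral>\<^sup>+z. f (z (Suc n)) \<partial>quenched_law (\<lambda>_. \<omega>)) \<le> ennreal (right_prob (\<omega> 0)) * (c ^ n * f 1) + ennreal (1 - right_prob (\<omega> 0)) * (c ^ n * f (-1))"
    by (subst nn_integral_first_step) (auto intro!: add_mono mult_left_mono *)
  also have "\<dots> = c ^ n * (ennreal (right_prob (\<omega> 0)) * f 1 + ennreal (1 - right_prob (\<omega> 0)) * f (-1))"
    by (simp add: algebra_simps)
  also have "\<dots> \<le> c ^ n * (c * f 0)"
    using Suc.prems[of 0] by (intro mult_left_mono) auto
  finally show ?case by (simp add: ac_simps)
qed

text \<open>Reflection of the line exchanges the two step probabilities. Only the position at a
  single time is compared: tail probabilities ask for no more, and the induction can then absorb the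
  first step into \<open>f\<close>.\<close>

lemma nn_integral_mirror:
  assumes "\<And>x. right_prob (\<omega>' x) = 1 - right_prob (\<omega> (- x))"
  shows "(\<integral>\<^sup>+z. f (- z n) \<partial>quenched_law (\<lambda>_. \<omega>)) = (\<integral>\<^sup>+z. f (z n) \<partial>quenched_law (\<lambda>_. \<omega>'))"
  using assms
proof (induction n arbitrary: \<omega> \<omega>' f)
  case 0
  interpret A: prob_space "quenched_law (\<lambda>_. \<omega>)" by (rule prob_space_quenched_law)
  interpret B: prob_space "quenched_law (\<lambda>_. \<omega>')" by (rule prob_space_quenched_law)
  have "(\<integral>\<^sup>+z. f (- z 0) \<partial>quenched_law (\<lambda>_. \<omega>)) = (\<integral>\<^sup>+z. f 0 \<partial>quenched_law (\<lambda>_. \<omega>))"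
    by (rule nn_integral_cong_AE) (use quenched_law_0[of "\<lambda>_. \<omega>"] in \<open>auto elim!: eventually_mono\<close>)
  moreover have "(\<integral>\<^sup>+z. f (z 0) \<partial>quenched_law (\<lambda>_. \<omega>')) = (\<integral>\<^sup>+z. f 0 \<partial>quenched_law (\<lambda>_. \<omega>'))"
    by (rule nn_integral_cong_AE) (use quenched_law_0[of "\<lambda>_. \<omega>'"] in \<open>auto elim!: eventually_mono\<close>)
  ultimately show ?case using A.emeasure_space_1 B.emeasure_space_1 by simp
next
  case (Suc n)
  have *: "(\<integral>\<^sup>+z. f (- prepend_step d z (Suc n)) \<partial>quenched_law (env_after (\<lambda>_. \<omega>) d))
    = (\<integral>\<^sup>+z. f (prepend_step (-d) z (Suc n)) \<partial>quenched_law (env_after (\<lambda>_. \<omega>') (-d)))" for d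
    using Suc.IH[of "\<lambda>x. \<omega>' (x - d)" "\<lambda>x. \<omega> (x + d)" "\<lambda>x. f (x - d)"] Suc.prems[of "_ - d"]
    by (simp add: prepend_step_def env_after_def algebra_simps minus_diff_commute)
  show ?case
    by (subst (1 2) nn_integral_first_step) (auto simp: * Suc.prems add.commute)
qed

text \<open>The position at time t is determined by the steps at times below t. This is used for the
  cooling walk twice: to freeze the environment during an epoch, and to see that the position at the
  start of an epoch does not involve the environment drawn there.\<close>

lemma quenched_law_local:
  assumes "\<And>n. n < t \<Longrightarrow> W n = W' n"
  shows "(\<integral>\<^sup>+z. f (z t) \<partial>quenched_law W) = (\<integral>\<^sup>+z. f (z t) \<partial>quenched_law W')"
  using assms
proof (induction t arbitrary: W W' f)
  case 0
  interpret A: prob_space "quenched_law W" by (rule prob_space_quenched_law)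
  interpret B: prob_space "quenched_law W'" by (rule prob_space_quenched_law)
  have "(\<integral>\<^sup>+z. f (z 0) \<partial>quenched_law W) = (\<integral>\<^sup>+z. f 0 \<partial>quenched_law W)" for W
    by (rule nn_integral_cong_AE) (use quenched_law_0[of W] in \<open>auto elim!: eventually_mono\<close>)
  then show ?case using A.emeasure_space_1 B.emeasure_space_1 by simp
next
  case (Suc t)
  have "(\<integral>\<^sup>+z. f (prepend_step d z (Suc t)) \<partial>quenched_law (env_after W d))
    = (\<integral>\<^sup>+z. f (prepend_step d z (Suc t)) \<partial>quenched_law (env_after W' d))" for d
    using Suc.IH[of "env_after W d" "env_after W' d" "\<lambda>x. f (d + x)"] Suc.prems[of "Suc _"]
    by (simp add: prepend_step_def env_after_def)
  with Suc.prems[of 0] show ?case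
    by (subst (1 2) nn_integral_first_step) auto
qed

text \<open>Only the step from time 0 needs an argument, valid for all environments at once; the
  Markov property carries it to time n.\<close>

lemma quenched_law_steps: "AE z in quenched_law W. \<forall>n. \<bar>z (Suc n) - z n\<bar> = 1"
proof -
  have "AE z in quenched_law W. \<bar>z (Suc n) - z n\<bar> = 1" for n
  proof -
    let ?G = "\<lambda>z :: nat \<Rightarrow> int. indicator {z. \<bar>z 1\<bar> \<noteq> 1} z :: ennreal"
    have 1: "(\<integral>\<^sup>+y. ?G y \<partial>quenched_law V) = 0" for V
    proof -
      have "(\<integral>\<^sup>+z. ?G (prepend_step d z) \<partial>quenched_law V) = 0" if "\<bar>d\<bar> = 1" for d V
      proof -
        have "(\<integral>\<^sup>+z. ?G (prepend_step d z) \<partial>quenched_law V) = (\<integral>\<^sup>+z. 0 \<partial>quenched_law V)"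
          by (rule nn_integral_cong_AE)
            (use quenched_law_0[of V] that in \<open>auto elim!: eventually_mono simp: prepend_step_def\<close>)
        then show ?thesis by simp
      qed
      then show ?thesis by (subst nn_integral_first_step) auto
    qed
    have "(\<integral>\<^sup>+z. ?G (\<lambda>k. z (n + k) - z n) \<partial>quenched_law W) = 0"
    proof (subst nn_integral_markov)
      show "?G \<in> borel_measurable path_space" by measurable
    qed (simp only: 1, simp)
    then show ?thesis by (subst (asm) nn_integral_0_iff_AE) (auto split: split_indicator_asm)
  qed
  then show ?thesis by (simp add: AE_all_countable)
qed

subsection \<open>Product measures\<close>

lemma indep_vars_PiM_coords:
  assumes M: "\<And>i. prob_space (M i)"
  shows "prob_space.indep_vars (PiM UNIV M) M (\<lambda>i \<omega>. \<omega> i) UNIV"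
proof -
  interpret prob_space "PiM UNIV M" by (rule prob_space_PiM) (rule M)
  have "distr (PiM UNIV M) (PiM UNIV M) (\<lambda>\<omega>. \<lambda>i\<in>UNIV. \<omega> i) = PiM UNIV M"
    by (simp add: restrict_UNIV distr_id2)
  moreover have "(\<lambda>i. distr (PiM UNIV M) (M i) (\<lambda>\<omega>. \<omega> i)) = M"
    using distr_PiM_component[of UNIV M] M by auto
  ultimately show ?thesis by (subst indep_vars_iff_distr_eq_PiM) auto
qed

text \<open>Dependence on the coordinates in I is expressed as a congruence property.
  \<open>fill\<close> makes it usable: completing a configuration on I by fixed values outside
  writes F as a measurable function of the restriction to I, and restrictions to disjoint index sets
  are independent.\<close>

lemma nn_integral_PiM_indep:
  fixes F G :: "('i \<Rightarrow> 'a) \<Rightarrow> ennreal"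
  assumes M: "\<And>i. prob_space (M i)"
    and F: "F \<in> borel_measurable (PiM UNIV M)" "\<And>\<omega> \<omega>'. (\<And>i. i \<in> I \<Longrightarrow> \<omega> i = \<omega>' i) \<Longrightarrow> F \<omega> = F \<omega>'"
    and G: "G \<in> borel_measurable (PiM UNIV M)" "\<And>\<omega> \<omega>'. (\<And>i. i \<in> J \<Longrightarrow> \<omega> i = \<omega>' i) \<Longrightarrow> G \<omega> = G \<omega>'"
    and "I \<inter> J = {}"
  shows "(\<integral>\<^sup>+\<omega>. F \<omega> * G \<omega> \<partial>PiM UNIV M) = (\<integral>\<^sup>+\<omega>. F \<omega> \<partial>PiM UNIV M) * (\<integral>\<^sup>+\<omega>. G \<omega> \<partial>PiM UNIV M)"
proof -
  interpret prob_space "PiM UNIV M" by (rule prob_space_PiM) (rule M)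
  define c where "c i = (SOME x. x \<in> space (M i))" for i
  have c: "c i \<in> space (M i)" for i
    unfolding c_def using prob_space.not_empty[OF M] by (rule some_in_eq[THEN iffD2])
  define fill where "fill K \<eta> i = (if i \<in> K then \<eta> i else c i)" for K :: "'i set" and \<eta> i
  have fill: "fill K \<in> measurable (PiM K M) (PiM UNIV M)" for K
    unfolding fill_def
  proof (rule measurable_PiM_single')
    fix i show "(\<lambda>\<eta>. if i \<in> K then \<eta> i else c i) \<in> PiM K M \<rightarrow>\<^sub>M M i"
      using c by (cases "i \<in> K") auto
  qed (use c in \<open>auto simp: space_PiM PiE_iff\<close>)
  have "indep_var (PiM I M) (\<lambda>\<omega>. restrict (\<lambda>i. \<omega> i) I) (PiM J M) (\<lambda>\<omega>. restrict (\<lambda>i. \<omega> i) J)"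
    using indep_vars_PiM_coords[OF M] \<open>I \<inter> J = {}\<close> by (rule indep_var_restrict) auto
  then have "indep_var borel ((F \<circ> fill I) \<circ> (\<lambda>\<omega>. restrict (\<lambda>i. \<omega> i) I)) borel ((G \<circ> fill J) \<circ> (\<lambda>\<omega>. restrict (\<lambda>i. \<omega> i) J))"
    using measurable_comp[OF fill F(1)] measurable_comp[OF fill G(1)] by (rule indep_var_compose)
  moreover have "(F \<circ> fill I) \<circ> (\<lambda>\<omega>. restrict (\<lambda>i. \<omega> i) I) = F"
    by (rule ext) (auto simp: fill_def intro!: F(2))
  moreover have "(G \<circ> fill J) \<circ> (\<lambda>\<omega>. restrict (\<lambda>i. \<omega> i) J) = G"
    by (rule ext) (auto simp: fill_def intro!: G(2))
  ultimately have "indep_var borel F borel G" by simp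
  moreover have "case_bool borel borel = (\<lambda>_. borel :: ennreal measure)"
    by (auto simp: fun_eq_iff split: bool.split)
  ultimately have "indep_vars (\<lambda>_. borel) (case_bool F G) UNIV"
    by (simp add: indep_var_def)
  from indep_vars_nn_integral[OF _ this] show ?thesis
    by (simp add: UNIV_bool mult.commute)
qed

lemma nn_integral_PiM_prod:
  fixes f :: "'i \<Rightarrow> 'a \<Rightarrow> ennreal"
  assumes M: "\<And>i. prob_space (M i)" and "finite J"
    and f: "\<And>i. i \<in> J \<Longrightarrow> f i \<in> borel_measurable (M i)"
  shows "(\<integral>\<^sup>+\<omega>. (\<Prod>i\<in>J. f i (\<omega> i)) \<partial>PiM UNIV M) = (\<Prod>i\<in>J. \<integral>\<^sup>+x. f i x \<partial>M i)"
  using \<open>finite J\<close> f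
proof (induction J)
  case empty
  interpret prob_space "PiM UNIV M" by (rule prob_space_PiM) (rule M)
  show ?case using emeasure_space_1 by simp
next
  case (insert j J)
  have m: "(\<lambda>\<omega>. f i (\<omega> i)) \<in> borel_measurable (PiM UNIV M)" if "i \<in> insert j J" for i
    using measurable_compose[OF measurable_component_singleton[of i UNIV M] insert.prems[OF that]] by simp
  have "(\<integral>\<^sup>+\<omega>. (\<Prod>i\<in>insert j J. f i (\<omega> i)) \<partial>PiM UNIV M) = (\<integral>\<^sup>+\<omega>. f j (\<omega> j) * (\<Prod>i\<in>J. f i (\<omega> i)) \<partial>PiM UNIV M)"
    using insert by simp
  also have "\<dots> = (\<integral>\<^sup>+\<omega>. f j (\<omega> j) \<partial>PiM UNIV M) * (\<integral>\<^sup>+\<omega>. (\<Prod>i\<in>J. f i (\<omega> i)) \<partial>PiM UNIV M)"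
  proof (rule nn_integral_PiM_indep[OF M, where I = "{j}" and J = J])
    show "(\<lambda>\<omega>. \<Prod>i\<in>J. f i (\<omega> i)) \<in> borel_measurable (PiM UNIV M)"
      by (rule borel_measurable_prod_ennreal) (use m in auto)
    show "(\<Prod>i\<in>J. f i (\<omega> i)) = (\<Prod>i\<in>J. f i (\<omega>' i))" if "\<And>i. i \<in> J \<Longrightarrow> \<omega> i = \<omega>' i" for \<omega> \<omega>'
      using that by (intro prod.cong) auto
  qed (use insert m in auto)
  also have "(\<integral>\<^sup>+\<omega>. f j (\<omega> j) \<partial>PiM UNIV M) = (\<integral>\<^sup>+x. f j x \<partial>M j)"
    using nn_integral_distr[OF measurable_component_singleton[of j UNIV M], of "f j"] insert.prems[of j]
    by (simp add: distr_PiM_component[of UNIV M j, OF M])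
  finally show ?case using insert by simp
qed

lemma distr_env_law_reindex:
  assumes "prob_space \<alpha>" "inj f"
  shows "distr (env_law \<alpha>) (env_law \<alpha>) (\<lambda>\<omega> x. \<omega> (f x)) = env_law \<alpha>"
  using distr_PiM_reindex[of UNIV "\<lambda>_. \<alpha>" f UNIV] assms by (simp add: env_law_def restrict_UNIV)

lemma measurable_env_reindex: "(\<lambda>\<omega> x. \<omega> (f x)) \<in> measurable (env_law \<alpha>) (env_law \<alpha>)"
  unfolding env_law_def by (rule measurable_PiM_single') (auto simp: space_PiM)

lemma nn_integral_env_reindex:
  assumes "prob_space \<alpha>" "inj f" "F \<in> borel_measurable (env_law \<alpha>)"
  shows "(\<integral>\<^sup>+\<omega>. F (\<lambda>x. \<omega> (f x)) \<partial>env_law \<alpha>) = (\<integral>\<^sup>+\<omega>. F \<omega> \<partial>env_law \<alpha>)"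
  by (subst (2) distr_env_law_reindex[OF assms(1,2), symmetric], subst nn_integral_distr)
     (use assms(3) in \<open>auto intro: measurable_env_reindex\<close>)

text \<open>A coordinatewise map keeps the coordinates independent, and the joint law of independent
  variables is the product of their laws.\<close>

lemma distr_env_law_map:
  assumes \<alpha>: "prob_space \<alpha>" and [measurable]: "p \<in> measurable \<alpha> \<beta>"
  shows "distr (env_law \<alpha>) (env_law (distr \<alpha> \<beta> p)) (\<lambda>\<omega> x. p (\<omega> x)) = env_law (distr \<alpha> \<beta> p)"
proof -
  interpret prob_space "env_law \<alpha>" unfolding env_law_def by (rule prob_space_PiM) (rule \<alpha>)
  have coord: "(\<lambda>\<omega>. \<omega> x) \<in> measurable (env_law \<alpha>) \<alpha>" for x by (simp add: env_law_def)
  have "indep_vars (\<lambda>_. \<alpha>) (\<lambda>i \<omega>. \<omega> i) UNIV"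
    using indep_vars_PiM_coords[of "\<lambda>_. \<alpha>"] \<alpha> by (simp add: env_law_def)
  then have "indep_vars (\<lambda>_. \<beta>) (\<lambda>i. p \<circ> (\<lambda>\<omega>. \<omega> i)) UNIV"
    by (rule indep_vars_compose) simp
  then have "distr (env_law \<alpha>) (PiM UNIV (\<lambda>_. \<beta>)) (\<lambda>\<omega>. \<lambda>x\<in>UNIV. p (\<omega> x)) = PiM UNIV (\<lambda>i. distr (env_law \<alpha>) \<beta> (\<lambda>\<omega>. p (\<omega> i)))"
    using measurable_compose[OF coord assms(2)]
    by (subst (asm) indep_vars_iff_distr_eq_PiM) (auto simp: comp_def)
  moreover have "distr (env_law \<alpha>) \<beta> (\<lambda>\<omega>. p (\<omega> i)) = distr \<alpha> \<beta> p" for i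
    using distr_distr[OF assms(2) coord[of i]] distr_PiM_component[of UNIV "\<lambda>_. \<alpha>" i] \<alpha>
    by (simp add: env_law_def comp_def)
  moreover have "sets (env_law (distr \<alpha> \<beta> p)) = sets (PiM UNIV (\<lambda>_. \<beta>))"
    unfolding env_law_def by (intro sets_PiM_cong) auto
  ultimately show ?thesis
    by (simp add: env_law_def[of "distr \<alpha> \<beta> p"] restrict_UNIV cong: distr_cong)
qed

subsection \<open>An exponential supermartingale\<close>

lemma static_kernel_measurable:
  assumes "real_distribution \<alpha>"
  shows "(\<lambda>\<omega>. quenched_law (\<lambda>n. \<omega>)) \<in> measurable (env_law \<alpha>) (prob_algebra path_space)"
proof -
  interpret real_distribution \<alpha> by fact
  have "quenched_law \<in> measurable (\<Pi>\<^sub>M n\<in>UNIV. env_law \<alpha>) (prob_algebra path_space)"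
    unfolding env_law_def by (intro measurable_quenched_law) simp
  moreover have "(\<lambda>\<omega> n. \<omega>) \<in> measurable (env_law \<alpha>) (\<Pi>\<^sub>M n\<in>UNIV. env_law \<alpha>)"
    by (rule measurable_PiM_single') (auto simp: space_PiM)
  ultimately show ?thesis by (rule measurable_compose[rotated])
qed

lemma nn_integral_static_law:
  assumes "real_distribution \<alpha>" "F \<in> borel_measurable path_space"
  shows "(\<integral>\<^sup>+z. F z \<partial>static_law \<alpha>) = (\<integral>\<^sup>+\<omega>. \<integral>\<^sup>+z. F z \<partial>quenched_law (\<lambda>_. \<omega>) \<partial>env_law \<alpha>)"
  unfolding static_law_def
  by (rule nn_integral_bind[OF assms(2)])
     (rule measurable_prob_algebraD[OF static_kernel_measurable[OF assms(1)]])

lemma prob_space_env_law: "prob_space \<alpha> \<Longrightarrow> prob_space (env_law \<alpha>)"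
  unfolding env_law_def by (rule prob_space_PiM)

lemma env_coord_measurable:
  assumes "real_distribution \<alpha>"
  shows "(\<lambda>\<omega>. \<omega> x) \<in> borel_measurable (env_law \<alpha>)"
proof -
  interpret real_distribution \<alpha> by fact
  have "(\<lambda>\<omega>. \<omega> x) \<in> measurable (env_law \<alpha>) \<alpha>" by (simp add: env_law_def)
  then show ?thesis by (simp add: measurable_cong_sets[OF refl events_eq_borel])
qed

lemma AE_env_law:
  assumes "prob_space \<alpha>" "AE w in \<alpha>. P w"
  shows "AE \<omega> in env_law \<alpha>. \<forall>x. P (\<omega> x)"
proof -
  have "AE \<omega> in PiM UNIV (\<lambda>_ :: int. \<alpha>). P (\<omega> x)" for x
    by (rule AE_PiM_component) (use assms in auto)
  then show ?thesis unfolding env_law_def AE_all_countable by blast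
qed

section \<open>The potential, its supermartingale property and its block structure\<close>

lemma rho_measurable [measurable]: "rho \<in> borel_measurable borel"
  unfolding rho_def[abs_def] by measurable

lemma rho_pos: "0 < w \<Longrightarrow> w < 1 \<Longrightarrow> 0 < rho w"
  by (simp add: rho_def)

text \<open>For s = 0 this is the equation T_j = 1 / \<omega>_j + \<rho>_j T_(j-1) of the mean
  crossing times with T_(-1) = 0, since 1 / \<omega> = 1 + \<rho>. For s > 0 it is the choice that
  turns the supermartingale inequality into an equality.\<close>

primrec excess :: "real \<Rightarrow> env \<Rightarrow> nat \<Rightarrow> real" where
  "excess s \<omega> 0 = 1 + rho (\<omega> 0)"
| "excess s \<omega> (Suc j) = 1 + rho (\<omega> (int (Suc j))) +
     rho (\<omega> (int (Suc j))) * (excess s \<omega> j / (1 + s * excess s \<omega> j))"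

definition cell_excess :: "nat \<Rightarrow> real \<Rightarrow> env \<Rightarrow> nat \<Rightarrow> real" where
  "cell_excess m s \<omega> i = excess s (\<lambda>x. \<omega> (x + int (m * (i div m)))) (i mod m)"

text \<open>\<open>nat x\<close> makes the potential equal to 1 on the nonpositive integers, where a
  constant satisfies the required inequality. At x > 0 only the sites 0, ..., x - 1 enter.\<close>

definition potential :: "nat \<Rightarrow> real \<Rightarrow> env \<Rightarrow> int \<Rightarrow> real" where
  "potential m s \<omega> x = (\<Prod>i<nat x. 1 + s * cell_excess m s \<omega> i)"

lemma excess_ge_1:
  assumes "\<And>x. 0 < \<omega> x \<and> \<omega> x < 1" "0 \<le> s"
  shows "1 \<le> excess s \<omega> j"
proof (induction j)
  case 0
  show ?case using rho_pos[of "\<omega> 0"] assms by (simp add: less_imp_le)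
next
  case (Suc j)
  have "0 \<le> rho (\<omega> (int (Suc j))) * (excess s \<omega> j / (1 + s * excess s \<omega> j))"
    using rho_pos[of "\<omega> (int (Suc j))"] assms Suc by (intro mult_nonneg_nonneg divide_nonneg_nonneg add_nonneg_nonneg) (auto simp del: of_nat_Suc simp: less_imp_le)
  then show ?case using rho_pos[of "\<omega> (int (Suc j))"] assms by (simp del: of_nat_Suc add: less_imp_le)
qed

lemma excess_cong: "(\<And>x. 0 \<le> x \<Longrightarrow> x \<le> int j \<Longrightarrow> \<omega> x = \<omega>' x) \<Longrightarrow> excess s \<omega> j = excess s \<omega>' j"
  by (induction j) auto

lemma cell_excess_ge_1:
  assumes "\<And>x. 0 < \<omega> x \<and> \<omega> x < 1" "0 \<le> s"
  shows "1 \<le> cell_excess m s \<omega> i"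
  unfolding cell_excess_def by (rule excess_ge_1) (use assms in auto)

lemma potential_ge_1:
  assumes "\<And>x. 0 < \<omega> x \<and> \<omega> x < 1" "0 \<le> s"
  shows "1 \<le> potential m s \<omega> x"
  unfolding potential_def
proof (rule prod_ge_1)
  fix i show "1 \<le> 1 + s * cell_excess m s \<omega> i"
    using cell_excess_ge_1[where \<omega> = \<omega> and m = m and i = i, OF assms] assms by simp
qed

lemma potential_mono:
  assumes "\<And>x. 0 < \<omega> x \<and> \<omega> x < 1" "0 \<le> s" "x \<le> y"
  shows "potential m s \<omega> x \<le> potential m s \<omega> y"
  unfolding potential_def
proof (rule prod_mono2)
  fix i show "1 \<le> 1 + s * cell_excess m s \<omega> i" "0 \<le> 1 + s * cell_excess m s \<omega> i"
    using cell_excess_ge_1[where \<omega> = \<omega> and m = m and i = i, OF assms(1,2)] assms by auto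
qed (use assms in auto)

lemma cell_excess_0: "cell_excess m s \<omega> 0 = 1 + rho (\<omega> 0)"
  by (simp add: cell_excess_def)

text \<open>Inside a block this is the recursion, with equality. At the first site of a block the
  restart drops the last summand, which is nonnegative.\<close>

lemma cell_excess_Suc_le:
  assumes \<omega>: "\<And>x. 0 < \<omega> x \<and> \<omega> x < 1" and s: "0 \<le> s" and m: "0 < m"
  shows "cell_excess m s \<omega> (Suc i) \<le> 1 + rho (\<omega> (int (Suc i))) +
     rho (\<omega> (int (Suc i))) * (cell_excess m s \<omega> i / (1 + s * cell_excess m s \<omega> i))"
proof (cases "Suc i mod m = 0")
  case True
  then have "m * (Suc i div m) = Suc i" by auto
  then have "cell_excess m s \<omega> (Suc i) = 1 + rho (\<omega> (int (Suc i)))"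
    using True unfolding cell_excess_def by simp
  moreover have "0 \<le> rho (\<omega> (int (Suc i))) * (cell_excess m s \<omega> i / (1 + s * cell_excess m s \<omega> i))"
    using rho_pos[of "\<omega> (int (Suc i))"] \<omega>[of "int (Suc i)"] cell_excess_ge_1[where \<omega> = \<omega> and m = m and i = i, OF \<omega> s] s
    by (intro mult_nonneg_nonneg divide_nonneg_nonneg add_nonneg_nonneg) (auto simp del: of_nat_Suc simp: less_imp_le)
  ultimately show ?thesis by linarith
next
  case False
  then have md: "Suc i mod m = Suc (i mod m)" "Suc i div m = i div m"
    by (auto simp: mod_Suc div_Suc split: if_splits)
  have eq: "int (Suc (i mod m)) + int (m * (i div m)) = int (Suc i)"
    by (metis add_Suc mod_mult_div_eq of_nat_add)
  show ?thesis unfolding cell_excess_def md by (simp only: excess.simps eq order_refl)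
qed

text \<open>Left of 0 the potential is constant, and at 0 equality holds because \<omega> (1 +
  \<rho>) = 1. For x > 0 the common factor \<open>P\<close> splits off and the recursive bound on
  \<open>d\<close> remains.\<close>

lemma potential_supermartingale:
  assumes \<omega>: "\<And>x. 0 < \<omega> x \<and> \<omega> x < 1" and s: "0 \<le> s" and m: "0 < m"
  shows "\<omega> x * potential m s \<omega> (x + 1) + (1 - \<omega> x) * potential m s \<omega> (x - 1) \<le> (1 + s) * potential m s \<omega> x"
proof -
  have \<omega>x: "0 < \<omega> x" "\<omega> x < 1" using \<omega>[of x] by auto
  have wr: "\<omega> x * (1 + rho (\<omega> x)) = 1" "\<omega> x * rho (\<omega> x) = 1 - \<omega> x"
    using \<omega>x by (auto simp: rho_def field_simps)
  consider "x < 0" | "x = 0" | i where "x = int (Suc i)"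
    by (metis not0_implies_Suc linorder_not_less nonneg_int_cases of_nat_0)
  then show ?thesis
  proof cases
    case 1 then show ?thesis using s by (simp add: potential_def)
  next
    case 2
    have "\<omega> 0 * (1 + s * (1 + rho (\<omega> 0))) + (1 - \<omega> 0) = 1 + s * (\<omega> 0 * (1 + rho (\<omega> 0)))"
      by (simp add: algebra_simps)
    then show ?thesis using 2 wr by (simp add: potential_def cell_excess_0)
  next
    case (3 i)
    define c d P where "c = cell_excess m s \<omega> i" and "d = cell_excess m s \<omega> (Suc i)" and "P = potential m s \<omega> (int i)"
    have c: "1 \<le> c" and P: "1 \<le> P"
      unfolding c_def P_def using cell_excess_ge_1[OF \<omega> s] potential_ge_1[OF \<omega> s] by auto
    have sc: "0 < 1 + s * c" using s c by (simp add: add_pos_nonneg)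
    have pS: "potential m s \<omega> (int (Suc k)) = potential m s \<omega> (int k) * (1 + s * cell_excess m s \<omega> k)" for k
      by (simp add: potential_def del: of_nat_Suc)
    have "x - 1 = int i" "x + 1 = int (Suc (Suc i))" using 3 by auto
    then have e: "potential m s \<omega> (x - 1) = P" "potential m s \<omega> x = P * (1 + s * c)" "potential m s \<omega> (x + 1) = P * (1 + s * c) * (1 + s * d)"
      by (simp_all only: 3 pS P_def c_def d_def)
    have "d \<le> 1 + rho (\<omega> x) + rho (\<omega> x) * (c / (1 + s * c))"
      unfolding c_def d_def 3 by (rule cell_excess_Suc_le[OF \<omega> s m])
    \<comment> \<open>Multiplication by \<omega> turns 1 + \<rho> into 1 and \<rho> into 1 -
      \<omega>; clearing the denominator 1 + s c afterwards leaves the supermartingale inequality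
      divided by \<open>P\<close>.\<close>
    then have "\<omega> x * d \<le> \<omega> x * (1 + rho (\<omega> x) + rho (\<omega> x) * (c / (1 + s * c)))"
      using \<omega>x by (intro mult_left_mono) auto
    also have "\<dots> = \<omega> x * (1 + rho (\<omega> x)) + \<omega> x * rho (\<omega> x) * (c / (1 + s * c))"
      by (simp add: algebra_simps)
    also have "\<dots> = 1 + (1 - \<omega> x) * (c / (1 + s * c))"
      unfolding wr ..
    finally have "(\<omega> x * d) * (1 + s * c) \<le> (1 + (1 - \<omega> x) * (c / (1 + s * c))) * (1 + s * c)"
      using sc by (intro mult_right_mono) auto
    also have "\<dots> = 1 + s * c + (1 - \<omega> x) * c" using sc by (simp add: field_simps)
    finally have "s * ((\<omega> x * d) * (1 + s * c)) \<le> s * (1 + s * c + (1 - \<omega> x) * c)"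
      using s by (rule mult_left_mono)
    then have "\<omega> x * ((1 + s * c) * (1 + s * d)) + (1 - \<omega> x) \<le> (1 + s) * (1 + s * c)"
      by (simp add: algebra_simps)
    then have "P * (\<omega> x * ((1 + s * c) * (1 + s * d)) + (1 - \<omega> x)) \<le> P * ((1 + s) * (1 + s * c))"
      using P by (intro mult_left_mono) auto
    then show ?thesis unfolding e by (simp add: algebra_simps)
  qed
qed

definition cell_factor :: "nat \<Rightarrow> real \<Rightarrow> env \<Rightarrow> real" where
  "cell_factor m s \<omega> = (\<Prod>j<m. 1 / (1 + s * excess s \<omega> j))"

lemma inverse_potential:
  assumes "0 < m"
  shows "1 / potential m s \<omega> (int (m * K)) = (\<Prod>k<K. cell_factor m s (\<lambda>x. \<omega> (x + int (m * k))))"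
proof -
  have "potential m s \<omega> (int (m * K)) = (\<Prod>k<K. \<Prod>i\<in>{k*m..<k*m+m}. 1 + s * cell_excess m s \<omega> i)"
    unfolding potential_def by (simp only: nat_int prod.nat_group mult.commute)
  also have "\<dots> = (\<Prod>k<K. \<Prod>j<m. 1 + s * excess s (\<lambda>x. \<omega> (x + int (m * k))) j)"
  proof (rule prod.cong[OF refl])
    fix k
    have "(\<Prod>i\<in>{k*m..<k*m+m}. 1 + s * cell_excess m s \<omega> i) = (\<Prod>j\<in>{0..<m}. 1 + s * cell_excess m s \<omega> (j + k*m))"
      using prod.shift_bounds_nat_ivl[of "\<lambda>i. 1 + s * cell_excess m s \<omega> i" 0 "k*m" m] by (simp add: add.commute)
    also have "\<dots> = (\<Prod>j<m. 1 + s * excess s (\<lambda>x. \<omega> (x + int (m * k))) j)"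
      by (rule prod.cong) (auto simp: cell_excess_def)
    finally show "(\<Prod>i\<in>{k*m..<k*m+m}. 1 + s * cell_excess m s \<omega> i) = (\<Prod>j<m. 1 + s * excess s (\<lambda>x. \<omega> (x + int (m * k))) j)" .
  qed
  finally show ?thesis by (simp add: cell_factor_def prod_dividef)
qed

lemma excess_measurable:
  assumes "real_distribution \<alpha>"
  shows "(\<lambda>\<omega>. excess s \<omega> j) \<in> borel_measurable (env_law \<alpha>)"
proof -
  note [measurable] = env_coord_measurable[OF assms]
  show ?thesis by (induction j) auto
qed

lemma cell_factor_measurable:
  assumes "real_distribution \<alpha>"
  shows "cell_factor m s \<in> borel_measurable (env_law \<alpha>)"
proof -
  note [measurable] = excess_measurable[OF assms]
  show ?thesis unfolding cell_factor_def[abs_def] by measurable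
qed

lemma cell_factor_bounds:
  assumes "\<And>x. 0 < \<omega> x \<and> \<omega> x < 1" "0 \<le> s"
  shows "0 \<le> cell_factor m s \<omega>" "cell_factor m s \<omega> \<le> 1"
proof -
  have "1 \<le> 1 + s * excess s \<omega> j" for j
    using excess_ge_1[where \<omega> = \<omega> and j = j, OF assms] assms by simp
  then have "0 \<le> 1 / (1 + s * excess s \<omega> j) \<and> 1 / (1 + s * excess s \<omega> j) \<le> 1" for j
    by (metis divide_le_eq_1 le_numeral_extra(4) less_le_trans zero_le_divide_1_iff zero_less_one le_less)
  then show "0 \<le> cell_factor m s \<omega>" "cell_factor m s \<omega> \<le> 1"
    unfolding cell_factor_def by (auto intro!: prod_nonneg prod_le_1)
qed

text \<open>Block k reads only the sites m k, ..., m k + m - 1. The factors of the blocks are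
  therefore independent, and they have the same mean by translation invariance.\<close>

lemma nn_integral_inverse_potential:
  assumes \<alpha>: "real_distribution \<alpha>" and "AE w in \<alpha>. 0 < w \<and> w < 1" and "0 \<le> s" "0 < m"
  shows "(\<integral>\<^sup>+\<omega>. ennreal (1 / potential m s \<omega> (int (m * K))) \<partial>env_law \<alpha>) = (\<integral>\<^sup>+\<omega>. ennreal (cell_factor m s \<omega>) \<partial>env_law \<alpha>) ^ K"
proof -
  interpret real_distribution \<alpha> by fact
  let ?F = "\<lambda>k \<omega>. ennreal (cell_factor m s (\<lambda>x. \<omega> (x + int (m * k))))"
  have ae: "AE \<omega> in env_law \<alpha>. \<forall>x. 0 < \<omega> x \<and> \<omega> x < 1"
    by (rule AE_env_law) (use assms prob_space_axioms in auto)
  note [measurable] = cell_factor_measurable[OF \<alpha>] measurable_env_reindex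
  have F: "?F k \<in> borel_measurable (env_law \<alpha>)" for k
    using measurable_compose[OF measurable_env_reindex cell_factor_measurable[OF \<alpha>]] by simp
  have "(\<integral>\<^sup>+\<omega>. ennreal (1 / potential m s \<omega> (int (m * K))) \<partial>env_law \<alpha>) = (\<integral>\<^sup>+\<omega>. (\<Prod>k<K. ?F k \<omega>) \<partial>env_law \<alpha>)"
  proof (rule nn_integral_cong_AE, use ae in eventually_elim)
    fix \<omega> :: env assume "\<forall>x. 0 < \<omega> x \<and> \<omega> x < 1"
    then have "0 \<le> cell_factor m s (\<lambda>x. \<omega> (x + int (m * k)))" for k
      by (intro cell_factor_bounds) (use assms in auto)
    then show "ennreal (1 / potential m s \<omega> (int (m * K))) = (\<Prod>k<K. ?F k \<omega>)"
      unfolding inverse_potential[OF assms(4)] by (simp add: prod_ennreal)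
  qed
  also have "\<dots> = (\<integral>\<^sup>+\<omega>. ennreal (cell_factor m s \<omega>) \<partial>env_law \<alpha>) ^ K"
  proof (induction K)
    case 0
    show ?case using prob_space.emeasure_space_1[OF prob_space_env_law[OF prob_space_axioms]] by simp
  next
    case (Suc K)
    have "(\<integral>\<^sup>+\<omega>. (\<Prod>k<Suc K. ?F k \<omega>) \<partial>env_law \<alpha>) = (\<integral>\<^sup>+\<omega>. (\<Prod>k<K. ?F k \<omega>) * ?F K \<omega> \<partial>env_law \<alpha>)"
      by simp
    also have "\<dots> = (\<integral>\<^sup>+\<omega>. (\<Prod>k<K. ?F k \<omega>) \<partial>env_law \<alpha>) * (\<integral>\<^sup>+\<omega>. ?F K \<omega> \<partial>env_law \<alpha>)"
      unfolding env_law_def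
    proof (rule nn_integral_PiM_indep[where I = "{x. x < int (m * K)}" and J = "{x. int (m * K) \<le> x}"])
      fix \<omega> \<omega>' :: env assume eq: "\<And>x. x \<in> {x. x < int (m * K)} \<Longrightarrow> \<omega> x = \<omega>' x"
      show "(\<Prod>k<K. ?F k \<omega>) = (\<Prod>k<K. ?F k \<omega>')"
      proof (rule prod.cong[OF refl])
        fix k assume k: "k \<in> {..<K}"
        have "excess s (\<lambda>x. \<omega> (x + int (m * k))) j = excess s (\<lambda>x. \<omega>' (x + int (m * k))) j" if "j < m" for j
        proof (rule excess_cong, rule eq)
          fix x assume "x \<le> int j"
          moreover have "m * k + m \<le> m * K" using k by (metis Suc_leI lessThan_iff mult_Suc_right mult_le_mono2 add.commute)
          then have "int j + int (m * k) < int (m * K)" using that by linarith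
          ultimately show "x + int (m * k) \<in> {x. x < int (m * K)}" by simp
        qed
        then show "?F k \<omega> = ?F k \<omega>'" by (simp add: cell_factor_def)
      qed
    next
      fix \<omega> \<omega>' :: env assume eq: "\<And>x. x \<in> {x. int (m * K) \<le> x} \<Longrightarrow> \<omega> x = \<omega>' x"
      have "excess s (\<lambda>x. \<omega> (x + int (m * K))) j = excess s (\<lambda>x. \<omega>' (x + int (m * K))) j" for j
        by (rule excess_cong, rule eq) auto
      then show "?F K \<omega> = ?F K \<omega>'" by (simp add: cell_factor_def)
    next
      show "(\<lambda>\<omega>. \<Prod>k<K. ?F k \<omega>) \<in> borel_measurable (Pi\<^sub>M UNIV (\<lambda>x. \<alpha>))"
        by (rule borel_measurable_prod_ennreal) (rule F[unfolded env_law_def])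
      show "?F K \<in> borel_measurable (Pi\<^sub>M UNIV (\<lambda>x. \<alpha>))"
        by (rule F[unfolded env_law_def])
      show "{x. x < int (m * K)} \<inter> {x. int (m * K) \<le> x} = {}" by auto
    qed (rule prob_space_axioms)
    also have "(\<integral>\<^sup>+\<omega>. ?F K \<omega> \<partial>env_law \<alpha>) = (\<integral>\<^sup>+\<omega>. ennreal (cell_factor m s \<omega>) \<partial>env_law \<alpha>)"
      by (rule nn_integral_env_reindex[of _ _ "\<lambda>\<omega>. ennreal (cell_factor m s \<omega>)"]) (auto simp: prob_space_axioms inj_def)
    finally show ?case using Suc by (simp add: mult.commute)
  qed
  finally show ?thesis .
qed

text \<open>Markov's inequality for the increasing potential is applied in a fixed environment.
  Dividing by the quenched value at the level m K before averaging leaves only the inverse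
  potential, whose mean factorizes over blocks.\<close>

lemma static_exceed_le:
  assumes \<alpha>: "real_distribution \<alpha>" and ae: "AE w in \<alpha>. 0 < w \<and> w < 1" and s: "0 \<le> s" and m: "0 < m"
  shows "emeasure (static_law \<alpha>) {z. int (m * K) \<le> z n} \<le> ennreal (1 + s) ^ n * (\<integral>\<^sup>+\<omega>. ennreal (cell_factor m s \<omega>) \<partial>env_law \<alpha>) ^ K"
proof -
  interpret real_distribution \<alpha> by fact
  have [measurable_cong]: "sets (static_law \<alpha>) = sets path_space" by (rule sets_static_law[OF \<alpha>])
  have m1: "{z. int (m * K) \<le> z n} \<in> sets path_space"
    using measurable_sets[OF measurable_path_coord[of n], of "{int (m * K)..}"] by (simp add: vimage_def)
  have "emeasure (static_law \<alpha>) {z. int (m * K) \<le> z n} = (\<integral>\<^sup>+z. indicator {z. int (m * K) \<le> z n} z \<partial>static_law \<alpha>)"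
    using m1 sets_static_law[OF \<alpha>] by simp
  also have "\<dots> = (\<integral>\<^sup>+\<omega>. \<integral>\<^sup>+z. indicator {z. int (m * K) \<le> z n} z \<partial>quenched_law (\<lambda>_. \<omega>) \<partial>env_law \<alpha>)"
    using m1 by (intro nn_integral_static_law[OF \<alpha>]) auto
  also have "\<dots> \<le> (\<integral>\<^sup>+\<omega>. ennreal (1 + s) ^ n * ennreal (1 / potential m s \<omega> (int (m * K))) \<partial>env_law \<alpha>)"
  proof (rule nn_integral_mono_AE, use AE_env_law[OF prob_space_axioms ae] in eventually_elim)
    fix \<omega> :: env assume "\<forall>x. 0 < \<omega> x \<and> \<omega> x < 1"
    then have \<omega>: "\<And>x. 0 < \<omega> x \<and> \<omega> x < 1" by auto
    let ?p = "potential m s \<omega>"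
    have p: "1 \<le> ?p x" for x by (rule potential_ge_1[OF \<omega> s])
    have p0: "0 \<le> ?p x" for x using p[of x] by linarith
    have "(\<integral>\<^sup>+z. indicator {z. int (m * K) \<le> z n} z \<partial>quenched_law (\<lambda>_. \<omega>)) \<le> (\<integral>\<^sup>+z. ennreal (1 / ?p (int (m * K))) * ennreal (?p (z n)) \<partial>quenched_law (\<lambda>_. \<omega>))"
    proof (rule nn_integral_mono)
      fix z :: "nat \<Rightarrow> int"
      show "indicator {z. int (m * K) \<le> z n} z \<le> ennreal (1 / ?p (int (m * K))) * ennreal (?p (z n))"
      proof (cases "int (m * K) \<le> z n")
        case True
        have "?p (int (m * K)) \<le> ?p (z n)" by (rule potential_mono[OF \<omega> s True])
        then have "1 \<le> 1 / ?p (int (m * K)) * ?p (z n)" using p[of "int (m * K)"] by simp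
        then have "1 \<le> ennreal (1 / ?p (int (m * K)) * ?p (z n))" by simp
        then show ?thesis using True p0 by (simp add: ennreal_mult del: times_divide_eq_left)
      qed simp
    qed
    also have "\<dots> = ennreal (1 / ?p (int (m * K))) * (\<integral>\<^sup>+z. ennreal (?p (z n)) \<partial>quenched_law (\<lambda>_. \<omega>))"
      by (rule nn_integral_cmult) measurable
    also have "\<dots> \<le> ennreal (1 / ?p (int (m * K))) * (ennreal (1 + s) ^ n * ennreal (?p 0))"
    proof (rule mult_left_mono[OF nn_integral_supermartingale])
      fix x
      have "ennreal (\<omega> x * ?p (x + 1) + (1 - \<omega> x) * ?p (x - 1)) \<le> ennreal ((1 + s) * ?p x)"
        by (rule ennreal_leI[OF potential_supermartingale[OF \<omega> s m]])
      then show "ennreal (right_prob (\<omega> x)) * ennreal (?p (x + 1)) + ennreal (1 - right_prob (\<omega> x)) * ennreal (?p (x - 1)) \<le> ennreal (1 + s) * ennreal (?p x)"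
        using \<omega>[of x] p0 s by (simp add: right_prob_id ennreal_plus[symmetric] ennreal_mult[symmetric] del: ennreal_plus)
    qed simp
    finally show "(\<integral>\<^sup>+z. indicator {z. int (m * K) \<le> z n} z \<partial>quenched_law (\<lambda>_. \<omega>)) \<le> ennreal (1 + s) ^ n * ennreal (1 / ?p (int (m * K)))"
      by (simp add: potential_def mult.commute)
  qed
  also have "\<dots> = ennreal (1 + s) ^ n * (\<integral>\<^sup>+\<omega>. ennreal (1 / potential m s \<omega> (int (m * K))) \<partial>env_law \<alpha>)"
  proof (rule nn_integral_cmult)
    have "(\<lambda>\<omega>. cell_factor m s (\<lambda>x. \<omega> (x + int (m * k)))) \<in> borel_measurable (env_law \<alpha>)" for k
      using measurable_compose[OF measurable_env_reindex cell_factor_measurable[OF \<alpha>]] by simp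
    then show "(\<lambda>\<omega>. ennreal (1 / potential m s \<omega> (int (m * K)))) \<in> borel_measurable (env_law \<alpha>)"
      unfolding inverse_potential[OF m] by measurable
  qed
  finally show ?thesis unfolding nn_integral_inverse_potential[OF \<alpha> ae s m] .
qed

section \<open>Mean crossing times and the choice of s and m\<close>

lemma nn_integral_env_coord:
  assumes "real_distribution \<alpha>" "F \<in> borel_measurable borel"
  shows "(\<integral>\<^sup>+\<omega>. F (\<omega> x) \<partial>env_law \<alpha>) = (\<integral>\<^sup>+w. F w \<partial>\<alpha>)"
proof -
  interpret real_distribution \<alpha> by fact
  have "(\<integral>\<^sup>+w. F w \<partial>\<alpha>) = (\<integral>\<^sup>+w. F w \<partial>distr (env_law \<alpha>) \<alpha> (\<lambda>\<omega>. \<omega> x))"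
    using distr_PiM_component[of UNIV "\<lambda>_. \<alpha>" x] prob_space_axioms by (simp add: env_law_def)
  also have "\<dots> = (\<integral>\<^sup>+\<omega>. F (\<omega> x) \<partial>env_law \<alpha>)"
    by (rule nn_integral_distr) (use assms(2) in \<open>auto simp: env_law_def measurable_cong_sets[OF events_eq_borel refl]\<close>)
  finally show ?thesis by simp
qed

text \<open>For s = 0 the denominators are 1, and \<open>excess 0 \<omega> j\<close> reads only
  sites up to j, so it is independent of \<rho> at j + 1. The means satisfy a_(j+1) = 1 + r + r a_j,
  also for r = \<infinity>.\<close>

lemma nn_integral_excess_0:
  assumes \<alpha>: "real_distribution \<alpha>" and ae: "AE w in \<alpha>. 0 < w \<and> w < 1"
  defines "r \<equiv> (\<integral>\<^sup>+w. ennreal (rho w) \<partial>\<alpha>)"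
  shows "(\<integral>\<^sup>+\<omega>. ennreal (excess 0 \<omega> j) \<partial>env_law \<alpha>) = (1 + r) * (\<Sum>i\<le>j. r ^ i)"
proof -
  interpret real_distribution \<alpha> by fact
  interpret E: prob_space "env_law \<alpha>" by (rule prob_space_env_law) (rule prob_space_axioms)
  note [measurable] = env_coord_measurable[OF \<alpha>] excess_measurable[OF \<alpha>]
  have r: "(\<integral>\<^sup>+\<omega>. ennreal (rho (\<omega> x)) \<partial>env_law \<alpha>) = r" for x
    unfolding r_def by (rule nn_integral_env_coord[OF \<alpha>]) measurable
  have AE: "AE \<omega> in env_law \<alpha>. \<forall>x. 0 < \<omega> x \<and> \<omega> x < 1"
    by (rule AE_env_law[OF prob_space_axioms ae])
  show ?thesis
  proof (induction j)
    case 0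
    have "(\<integral>\<^sup>+\<omega>. ennreal (excess 0 \<omega> 0) \<partial>env_law \<alpha>) = (\<integral>\<^sup>+\<omega>. 1 + ennreal (rho (\<omega> 0)) \<partial>env_law \<alpha>)"
      by (rule nn_integral_cong_AE, use AE in eventually_elim) (simp add: rho_pos less_imp_le)
    also have "\<dots> = 1 + r"
      by (simp add: nn_integral_add r E.emeasure_space_1)
    finally show ?case by simp
  next
    case (Suc j)
    let ?x = "int (Suc j)"
    have "(\<integral>\<^sup>+\<omega>. ennreal (excess 0 \<omega> (Suc j)) \<partial>env_law \<alpha>) =
      (\<integral>\<^sup>+\<omega>. 1 + ennreal (rho (\<omega> ?x)) + ennreal (rho (\<omega> ?x)) * ennreal (excess 0 \<omega> j) \<partial>env_law \<alpha>)"
    proof (rule nn_integral_cong_AE, use AE in eventually_elim)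
      fix \<omega> :: env assume \<omega>: "\<forall>x. 0 < \<omega> x \<and> \<omega> x < 1"
      then have "0 \<le> rho (\<omega> ?x)" by (simp add: rho_pos less_imp_le del: of_nat_Suc)
      moreover have "1 \<le> excess 0 \<omega> j" by (rule excess_ge_1) (use \<omega> in auto)
      ultimately show "ennreal (excess 0 \<omega> (Suc j)) = 1 + ennreal (rho (\<omega> ?x)) + ennreal (rho (\<omega> ?x)) * ennreal (excess 0 \<omega> j)"
        by (simp add: ennreal_mult del: of_nat_Suc)
    qed
    also have "\<dots> = 1 + r + (\<integral>\<^sup>+\<omega>. ennreal (rho (\<omega> ?x)) * ennreal (excess 0 \<omega> j) \<partial>env_law \<alpha>)"
      by (simp add: nn_integral_add r E.emeasure_space_1 del: of_nat_Suc)
    also have "(\<integral>\<^sup>+\<omega>. ennreal (rho (\<omega> ?x)) * ennreal (excess 0 \<omega> j) \<partial>env_law \<alpha>) =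
        (\<integral>\<^sup>+\<omega>. ennreal (rho (\<omega> ?x)) \<partial>env_law \<alpha>) * (\<integral>\<^sup>+\<omega>. ennreal (excess 0 \<omega> j) \<partial>env_law \<alpha>)"
      unfolding env_law_def
    proof (rule nn_integral_PiM_indep[where I = "{?x}" and J = "{..<?x}"])
      show "(\<lambda>\<omega>. ennreal (rho (\<omega> ?x))) \<in> borel_measurable (Pi\<^sub>M UNIV (\<lambda>x. \<alpha>))"
        "(\<lambda>\<omega>. ennreal (excess 0 \<omega> j)) \<in> borel_measurable (Pi\<^sub>M UNIV (\<lambda>x. \<alpha>))"
        unfolding env_law_def[symmetric] by measurable
      show "ennreal (excess 0 \<omega> j) = ennreal (excess 0 \<omega>' j)" if "\<And>i. i \<in> {..<?x} \<Longrightarrow> \<omega> i = \<omega>' i" for \<omega> \<omega>'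
        by (intro arg_cong[where f = ennreal] excess_cong that) auto
    qed (auto intro: prob_space_axioms)
    also have "1 + r + \<dots> = 1 + r + r * ((1 + r) * (\<Sum>i\<le>j. r ^ i))"
      unfolding r Suc ..
    also have "\<dots> = (1 + r) * (\<Sum>i\<le>Suc j. r ^ i)"
      unfolding sum.atMost_Suc_shift by (simp add: sum_distrib_left algebra_simps)
    finally show ?case .
  qed
qed

lemma one_plus_sum_le_prod:
  fixes f :: "'a \<Rightarrow> real"
  assumes "finite A" "\<And>i. i \<in> A \<Longrightarrow> 0 \<le> f i"
  shows "1 + (\<Sum>i\<in>A. f i) \<le> (\<Prod>i\<in>A. 1 + f i)"
  using assms
proof (induction A)
  case (insert x A)
  have "(\<Sum>i\<in>A. f i) \<ge> 0" using insert by (intro sum_nonneg) auto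
  then have "1 + (\<Sum>i\<in>insert x A. f i) \<le> (1 + f x) * (1 + (\<Sum>i\<in>A. f i))"
    using insert by (simp add: algebra_simps)
  also have "\<dots> \<le> (1 + f x) * (\<Prod>i\<in>A. 1 + f i)"
    using insert by (intro mult_left_mono) auto
  finally show ?case using insert by simp
qed simp

lemma excess_tendsto:
  assumes \<omega>: "\<And>x. 0 < \<omega> x \<and> \<omega> x < 1" and s: "s \<longlonglongrightarrow> 0"
  shows "(\<lambda>k. excess (s k) \<omega> j) \<longlonglongrightarrow> excess 0 \<omega> j"
proof (induction j)
  case (Suc j)
  have "(\<lambda>k. 1 + rho (\<omega> (int (Suc j))) + rho (\<omega> (int (Suc j))) * (excess (s k) \<omega> j / (1 + s k * excess (s k) \<omega> j)))
      \<longlonglongrightarrow> 1 + rho (\<omega> (int (Suc j))) + rho (\<omega> (int (Suc j))) * (excess 0 \<omega> j / (1 + 0 * excess 0 \<omega> j))"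
    by (intro tendsto_intros Suc s) simp
  then show ?case by simp
qed simp

text \<open>At s = 0 the mean b of the block factor is 1, and formally its slope there is minus the
  mean of the sum of the A_j, which may be infinite. Fatou's lemma along a null sequence replaces
  differentiation under the integral.\<close>

lemma cell_factor_mean_small:
  assumes \<alpha>: "real_distribution \<alpha>" and ae: "AE w in \<alpha>. 0 < w \<and> w < 1"
    and C: "0 \<le> C" "ennreal C < (\<integral>\<^sup>+\<omega>. ennreal (\<Sum>j<m. excess 0 \<omega> j) \<partial>env_law \<alpha>)"
  shows "\<exists>s>0. \<exists>b\<ge>0. (\<integral>\<^sup>+\<omega>. ennreal (cell_factor m s \<omega>) \<partial>env_law \<alpha>) = ennreal b \<and> s * C < 1 - b"
proof -
  interpret real_distribution \<alpha> by fact
  interpret E: prob_space "env_law \<alpha>" by (rule prob_space_env_law) (rule prob_space_axioms)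
  note [measurable] = excess_measurable[OF \<alpha>] cell_factor_measurable[OF \<alpha>]
  have AE: "AE \<omega> in env_law \<alpha>. \<forall>x. 0 < \<omega> x \<and> \<omega> x < 1"
    by (rule AE_env_law[OF prob_space_axioms ae])
  define s where "s k = inverse (real (Suc k))" for k
  have s: "s k > 0" for k by (simp add: s_def)
  have s0: "s \<longlonglongrightarrow> 0" unfolding s_def by (rule LIMSEQ_inverse_real_of_nat)
  define S where "S k \<omega> = (\<Sum>j<m. excess (s k) \<omega> j)" for k \<omega>
  \<comment> \<open>Since the product of the 1 + s A_j is at least 1 + s S, the factor is at most 1
    / (1 + s S), so 1 minus the factor is at least s times this quotient.\<close>
  define h where "h k \<omega> = ennreal (S k \<omega> / (1 + s k * S k \<omega>))" for k \<omega>
  have [measurable]: "h k \<in> borel_measurable (env_law \<alpha>)" for k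
    unfolding h_def[abs_def] S_def[abs_def] by measurable
  have "ennreal C < (\<integral>\<^sup>+\<omega>. ennreal (\<Sum>j<m. excess 0 \<omega> j) \<partial>env_law \<alpha>)" by (rule C)
  also have "\<dots> = (\<integral>\<^sup>+\<omega>. liminf (\<lambda>k. h k \<omega>) \<partial>env_law \<alpha>)"
  proof (rule nn_integral_cong_AE, use AE in eventually_elim)
    fix \<omega> :: env assume "\<forall>x. 0 < \<omega> x \<and> \<omega> x < 1"
    then have "(\<lambda>k. S k \<omega>) \<longlonglongrightarrow> (\<Sum>j<m. excess 0 \<omega> j)"
      unfolding S_def by (intro tendsto_sum excess_tendsto s0) auto
    then have "(\<lambda>k. S k \<omega> / (1 + s k * S k \<omega>)) \<longlonglongrightarrow> (\<Sum>j<m. excess 0 \<omega> j) / (1 + 0 * (\<Sum>j<m. excess 0 \<omega> j))"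
      by (intro tendsto_intros s0) auto
    then have "(\<lambda>k. h k \<omega>) \<longlonglongrightarrow> ennreal (\<Sum>j<m. excess 0 \<omega> j)"
      unfolding h_def by (intro tendsto_ennrealI) simp
    then show "ennreal (\<Sum>j<m. excess 0 \<omega> j) = liminf (\<lambda>k. h k \<omega>)"
      by (simp add: lim_imp_Liminf)
  qed
  also have "\<dots> \<le> liminf (\<lambda>k. \<integral>\<^sup>+\<omega>. h k \<omega> \<partial>env_law \<alpha>)"
    by (rule nn_integral_liminf) simp
  finally have "\<forall>\<^sub>F k in sequentially. ennreal C < (\<integral>\<^sup>+\<omega>. h k \<omega> \<partial>env_law \<alpha>)"
    by (rule less_LiminfD)
  then obtain k where k: "ennreal C < (\<integral>\<^sup>+\<omega>. h k \<omega> \<partial>env_law \<alpha>)"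
    by (auto simp: eventually_sequentially)
  let ?b = "\<integral>\<^sup>+\<omega>. ennreal (cell_factor m (s k) \<omega>) \<partial>env_law \<alpha>"
  have "ennreal (s k * C) < ennreal (s k) * (\<integral>\<^sup>+\<omega>. h k \<omega> \<partial>env_law \<alpha>)"
    using k s[of k] C(1) by (simp add: ennreal_mult ennreal_mult_strict_left_mono)
  also have "\<dots> = (\<integral>\<^sup>+\<omega>. ennreal (s k) * h k \<omega> \<partial>env_law \<alpha>)"
    by (simp add: nn_integral_cmult)
  also have "\<dots> \<le> (\<integral>\<^sup>+\<omega>. ennreal (1 - cell_factor m (s k) \<omega>) \<partial>env_law \<alpha>)"
  proof (rule nn_integral_mono_AE, use AE in eventually_elim)
    fix \<omega> :: env assume "\<forall>x. 0 < \<omega> x \<and> \<omega> x < 1"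
    then have e: "1 \<le> excess (s k) \<omega> j" for j
      by (intro excess_ge_1) (use s[of k] in auto)
    then have e0: "0 \<le> excess (s k) \<omega> j" for j by (meson order_trans zero_le_one)
    have S0: "0 \<le> S k \<omega>" unfolding S_def by (intro sum_nonneg e0)
    have "1 + s k * S k \<omega> \<le> (\<Prod>j<m. 1 + s k * excess (s k) \<omega> j)"
      unfolding S_def sum_distrib_left using s[of k] e0 by (intro one_plus_sum_le_prod) (auto simp: less_imp_le)
    moreover have "0 < 1 + s k * S k \<omega>" using s[of k] S0 by (simp add: add_pos_nonneg)
    ultimately have "cell_factor m (s k) \<omega> \<le> 1 / (1 + s k * S k \<omega>)"
      unfolding cell_factor_def prod_dividef by (simp add: frac_le)
    also have "\<dots> = 1 - s k * (S k \<omega> / (1 + s k * S k \<omega>))"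
      using s[of k] S0 by (simp add: field_simps add_pos_nonneg add_nonneg_eq_0_iff)
    finally have "s k * (S k \<omega> / (1 + s k * S k \<omega>)) \<le> 1 - cell_factor m (s k) \<omega>" by simp
    then show "ennreal (s k) * h k \<omega> \<le> ennreal (1 - cell_factor m (s k) \<omega>)"
      unfolding h_def using s[of k] S0 by (simp add: ennreal_mult[symmetric] ennreal_leI)
  qed
  finally have 1: "ennreal (s k * C) < (\<integral>\<^sup>+\<omega>. ennreal (1 - cell_factor m (s k) \<omega>) \<partial>env_law \<alpha>)" .
  \<comment> \<open>The factor and its complement have means adding up to 1. Both are therefore
    finite, and the estimate can be rewritten with real numbers as s C < 1 - b.\<close>
  have "(\<integral>\<^sup>+\<omega>. ennreal (1 - cell_factor m (s k) \<omega>) \<partial>env_law \<alpha>) + ?b =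
      (\<integral>\<^sup>+\<omega>. ennreal (1 - cell_factor m (s k) \<omega>) + ennreal (cell_factor m (s k) \<omega>) \<partial>env_law \<alpha>)"
    by (rule nn_integral_add[symmetric]) measurable
  also have "\<dots> = (\<integral>\<^sup>+\<omega>. 1 \<partial>env_law \<alpha>)"
  proof (rule nn_integral_cong_AE, use AE in eventually_elim)
    fix \<omega> :: env assume "\<forall>x. 0 < \<omega> x \<and> \<omega> x < 1"
    then have "0 \<le> cell_factor m (s k) \<omega>" "cell_factor m (s k) \<omega> \<le> 1"
      using cell_factor_bounds[of \<omega> "s k" m] s[of k] by auto
    then show "ennreal (1 - cell_factor m (s k) \<omega>) + ennreal (cell_factor m (s k) \<omega>) = 1"
      by (simp add: ennreal_plus[symmetric] del: ennreal_plus)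
  qed
  finally have 2: "(\<integral>\<^sup>+\<omega>. ennreal (1 - cell_factor m (s k) \<omega>) \<partial>env_law \<alpha>) + ?b = 1"
    by (simp add: E.emeasure_space_1)
  then have fin: "?b \<noteq> \<top>" "(\<integral>\<^sup>+\<omega>. ennreal (1 - cell_factor m (s k) \<omega>) \<partial>env_law \<alpha>) \<noteq> \<top>"
    by auto
  then obtain a b where a: "0 \<le> a" "(\<integral>\<^sup>+\<omega>. ennreal (1 - cell_factor m (s k) \<omega>) \<partial>env_law \<alpha>) = ennreal a"
    and b: "0 \<le> b" "?b = ennreal b"
    by (metis ennreal_cases)
  have "a + b = 1" using 2 a b by (simp add: ennreal_plus[symmetric] del: ennreal_plus)
  moreover have "s k * C < a"
    using 1 s[of k] C(1) unfolding a(2) by (subst (asm) ennreal_less_iff) auto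
  ultimately show ?thesis
    using s[of k] b by (intro exI[of _ "s k"] conjI exI[of _ b]) auto
qed

text \<open>The hypothesis says that crossing one site takes on average more than 1 / u, once j
  sites to its left are taken into account. A long block then needs on average more than m / u
  steps, and the bound for u n / m such blocks decays exponentially in n.\<close>

lemma summable_static_exceed:
  assumes \<alpha>: "real_distribution \<alpha>" and ae: "AE w in \<alpha>. 0 < w \<and> w < 1" and u: "0 < u"
    and r: "ennreal (1 / u) < (1 + (\<integral>\<^sup>+w. ennreal (rho w) \<partial>\<alpha>)) * (\<Sum>i\<le>j. (\<integral>\<^sup>+w. ennreal (rho w) \<partial>\<alpha>) ^ i)"
  shows "summable (\<lambda>n. measure (static_law \<alpha>) {z. u * real n \<le> real_of_int (z n)})"
proof -
  interpret real_distribution \<alpha> by fact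
  interpret S: prob_space "static_law \<alpha>" by (rule prob_space_static_law[OF \<alpha>])
  let ?r = "\<integral>\<^sup>+w. ennreal (rho w) \<partial>\<alpha>"
  let ?e = "\<lambda>j. (1 + ?r) * (\<Sum>i\<le>j. ?r ^ i)"
  note [measurable] = excess_measurable[OF \<alpha>]
  have AE: "AE \<omega> in env_law \<alpha>. \<forall>x. 0 < \<omega> x \<and> \<omega> x < 1"
    by (rule AE_env_law[OF prob_space_axioms ae])
  \<comment> \<open>A value strictly between leaves room to discard the first j sites of each block.
    It also passes to a real number when the right-hand side is infinite.\<close>
  obtain c' where c': "ennreal (1 / u) < c'" "c' < ?e j" using dense[OF r] by auto
  define c where "c = enn2real c'"
  have cc: "c' = ennreal c" using less_le_trans[OF c'(2) top_greatest] unfolding c_def by simp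
  have c: "1 / u < c" "0 < c"
  proof -
    have c0: "0 \<le> c" by (simp add: c_def)
    show "1 / u < c" using c'(1) u unfolding cc by (subst (asm) ennreal_less_iff) auto
    then show "0 < c" using u by (meson less_trans zero_less_divide_1_iff)
  qed
  \<comment> \<open>The bound on m is m / u < (m - j) c solved for m: the sites from j on alone make
    up the required mean.\<close>
  obtain M :: nat where M: "real j * c / (c - 1 / u) < real M" using reals_Archimedean2 by blast
  define m where "m = max M (Suc j)"
  have m: "j < m" "real j * c / (c - 1 / u) < real m" using M by (auto simp: m_def)
  have "real m / u < (real m - real j) * c"
    using m(2) c by (simp add: field_simps)
  then have "ennreal (real m / u) < ennreal ((real m - real j) * c)"
    using u by (subst ennreal_less_iff) auto
  also have "\<dots> = (\<Sum>i\<in>{j..<m}. ennreal c)" using m c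
    by (simp add: ennreal_of_nat_eq_real_of_nat ennreal_mult[symmetric] of_nat_diff)
  also have "\<dots> \<le> (\<Sum>i\<in>{j..<m}. ?e i)"
  proof (rule sum_mono)
    fix i assume "i \<in> {j..<m}"
    then have "?e j \<le> ?e i" by (intro mult_left_mono sum_mono2) auto
    then show "ennreal c \<le> ?e i" using c'(2) cc by auto
  qed
  also have "\<dots> \<le> (\<Sum>i<m. ?e i)" by (rule sum_mono2) auto
  also have "\<dots> = (\<Sum>i<m. \<integral>\<^sup>+\<omega>. ennreal (excess 0 \<omega> i) \<partial>env_law \<alpha>)"
    by (simp add: nn_integral_excess_0[OF \<alpha> ae])
  also have "\<dots> = (\<integral>\<^sup>+\<omega>. (\<Sum>i<m. ennreal (excess 0 \<omega> i)) \<partial>env_law \<alpha>)"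
    by (rule nn_integral_sum[symmetric]) measurable
  also have "\<dots> = (\<integral>\<^sup>+\<omega>. ennreal (\<Sum>i<m. excess 0 \<omega> i) \<partial>env_law \<alpha>)"
  proof (rule nn_integral_cong_AE, use AE in eventually_elim)
    fix \<omega> :: env assume "\<forall>x. 0 < \<omega> x \<and> \<omega> x < 1"
    then have "1 \<le> excess 0 \<omega> i" for i by (intro excess_ge_1) auto
    then have "0 \<le> excess 0 \<omega> i" for i by (meson order_trans zero_le_one)
    then show "(\<Sum>i<m. ennreal (excess 0 \<omega> i)) = ennreal (\<Sum>i<m. excess 0 \<omega> i)" by (simp add: sum_ennreal)
  qed
  finally obtain s b where s: "0 < s" and b: "0 \<le> b" "(\<integral>\<^sup>+\<omega>. ennreal (cell_factor m s \<omega>) \<partial>env_law \<alpha>) = ennreal b"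
      and sb: "s * (real m / u) < 1 - b"
    using cell_factor_mean_small[OF \<alpha> ae, of "real m / u" m] u by auto
  have m0: "0 < m" using m by simp
  \<comment> \<open>Decay rate: n steps cost s n in the exponent, and about u n / m blocks gain 1 -
    b each.\<close>
  define \<delta> where "\<delta> = (1 - b) * u / real m - s"
  have \<delta>: "\<delta> > 0" unfolding \<delta>_def using sb u m0 by (simp add: field_simps)
  have b1: "b < 1" using sb s u by (smt (verit) divide_nonneg_pos mult_nonneg_nonneg of_nat_0_le_iff)
  let ?A = "\<lambda>n. {z. u * real n \<le> real_of_int (z n)}"
  have mA: "?A n \<in> sets (static_law \<alpha>)" for n
    using measurable_sets[OF measurable_path_coord[of n], of "{x. u * real n \<le> real_of_int x}"] sets_static_law[OF \<alpha>]
    by (simp add: vimage_def)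
  have bound: "measure (static_law \<alpha>) (?A n) \<le> exp (1 - b) * exp (- \<delta>) ^ n" for n
  proof -
    \<comment> \<open>The number of complete blocks below the level u n. Rounding down loses less
      than one block, which gives the constant factor \<open>exp (1 - b)\<close>.\<close>
    define K where "K = nat \<lfloor>u * real n / real m\<rfloor>"
    have K: "real K \<le> u * real n / real m" "u * real n / real m < real K + 1"
      unfolding K_def using u by auto
    have "real m * real K \<le> u * real n" using K(1) m0 by (simp add: field_simps)
    then have sub: "?A n \<subseteq> {z. int (m * K) \<le> z n}"
    proof (intro subsetI CollectI)
      fix z :: "nat \<Rightarrow> int" assume "z \<in> ?A n"
      with \<open>real m * real K \<le> u * real n\<close> have "real_of_int (int (m * K)) \<le> real_of_int (z n)" by simp
      then show "int (m * K) \<le> z n" by (simp only: of_int_le_iff)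
    qed
    have mB: "{z. int (m * K) \<le> z n} \<in> sets (static_law \<alpha>)"
      using measurable_sets[OF measurable_path_coord[of n], of "{int (m * K)..}"] sets_static_law[OF \<alpha>]
      by (simp add: vimage_def)
    have "emeasure (static_law \<alpha>) (?A n) \<le> ennreal (1 + s) ^ n * ennreal b ^ K"
      using emeasure_mono[OF sub mB] static_exceed_le[OF \<alpha> ae, of s m K n] s m0 b by (auto intro: order_trans)
    also have "\<dots> = ennreal ((1 + s) ^ n * b ^ K)"
      using s b by (simp add: ennreal_power ennreal_mult del: ennreal_plus)
    finally have "measure (static_law \<alpha>) (?A n) \<le> (1 + s) ^ n * b ^ K"
      using s b by (simp add: S.emeasure_eq_measure)
    \<comment> \<open>Both factors use 1 + x \<le> exp x, the second one with x = - (1 - b).\<close>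
    also have "\<dots> \<le> exp s ^ n * exp (- (1 - b)) ^ K"
      using s b exp_ge_add_one_self[of s] exp_ge_add_one_self[of "- (1 - b)"]
      by (intro mult_mono power_mono) auto
    also have "\<dots> = exp (s * real n - (1 - b) * real K)"
      by (simp add: exp_of_nat_mult[symmetric] exp_add[symmetric] algebra_simps flip: exp_of_nat_mult)
    also have "\<dots> \<le> exp (s * real n - (1 - b) * (u * real n / real m - 1))"
    proof -
      have "(1 - b) * (u * real n / real m - 1) \<le> (1 - b) * real K"
        using K b1 by (intro mult_left_mono) auto
      then show ?thesis by simp
    qed
    also have "\<dots> = exp (1 - b) * exp (- \<delta>) ^ n"
      by (simp add: exp_of_nat_mult[symmetric] exp_add[symmetric] \<delta>_def algebra_simps diff_divide_distrib)
    finally show ?thesis .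
  qed
  show ?thesis
  proof (rule summable_comparison_test')
    show "summable (\<lambda>n. exp (1 - b) * exp (- \<delta>) ^ n)"
      using \<delta> by (intro summable_mult summable_geometric) auto
    show "norm (measure (static_law \<alpha>) (?A n)) \<le> exp (1 - b) * exp (- \<delta>) ^ n" for n
      using bound by simp
  qed
qed

section \<open>From tail bounds to almost sure bounds; reflection and zero speed\<close>

lemma path_level_sets: "{z. P (z n)} \<in> sets path_space"
  using measurable_sets[OF measurable_path_coord[of n], of "{x. P x}"] by (simp add: vimage_def)

lemma static_eventually_of_summable:
  assumes "real_distribution \<alpha>" "summable (\<lambda>n. measure (static_law \<alpha>) {z. P n (z n)})"
  shows "AE z in static_law \<alpha>. \<forall>\<^sub>F n in sequentially. \<not> P n (z n)"
proof -
  interpret prob_space "static_law \<alpha>" by (rule prob_space_static_law) fact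
  have "AE z in static_law \<alpha>. \<forall>\<^sub>F n in sequentially. z \<in> space (static_law \<alpha>) - {z. P n (z n)}"
    by (rule borel_cantelli_AE1)
      (use assms path_level_sets sets_static_law[OF assms(1)] in \<open>auto simp: emeasure_eq_measure\<close>)
  then show ?thesis by eventually_elim (auto elim: eventually_mono)
qed

lemma right_prob_mirror: "right_prob (1 - p) = 1 - right_prob p"
  by (auto simp: right_prob_def min_def max_def)

lemma real_distribution_mirror:
  assumes "real_distribution \<alpha>"
  shows "real_distribution (distr \<alpha> borel (\<lambda>w. 1 - w))"
proof -
  interpret real_distribution \<alpha> by fact
  show ?thesis by (rule real_distribution_distr) simp
qed

text \<open>The reflected walk sees the environment 1 - \<omega>(-x). Replacing w by 1 - w yields
  the mirrored product law, and x by -x leaves a product law unchanged.\<close>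

lemma measure_static_mirror:
  assumes \<alpha>: "real_distribution \<alpha>"
  shows "measure (static_law (distr \<alpha> borel (\<lambda>w. 1 - w))) {z. P (z n)} = measure (static_law \<alpha>) {z. P (- z n)}"
proof -
  interpret real_distribution \<alpha> by fact
  let ?\<beta> = "distr \<alpha> borel (\<lambda>w. 1 - w)"
  have \<beta>: "real_distribution ?\<beta>" by (rule real_distribution_mirror[OF \<alpha>])
  define H where "H \<omega> = (\<integral>\<^sup>+z. indicator {z. P (z n)} z \<partial>quenched_law (\<lambda>_. \<omega>))" for \<omega>
  have ind: "indicator {z. P (z n)} \<in> borel_measurable path_space"
    "indicator {z. P (- z n)} \<in> borel_measurable path_space"
    using path_level_sets[of P n] path_level_sets[of "\<lambda>x. P (- x)" n] by auto
  have H: "H \<in> borel_measurable (env_law ?\<beta>)"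
    unfolding H_def
    by (rule measurable_compose[OF measurable_prob_algebraD[OF static_kernel_measurable[OF \<beta>]]
         nn_integral_measurable_subprob_algebra[OF ind(1)]])
  have map: "(\<lambda>\<omega> x. 1 - \<omega> x) \<in> measurable (env_law \<alpha>) (env_law ?\<beta>)"
    unfolding env_law_def
    by (rule measurable_PiM_single') (auto simp: space_PiM intro!: borel_measurable_diff env_coord_measurable[OF \<alpha>, unfolded env_law_def])
  have "emeasure (static_law ?\<beta>) {z. P (z n)} = (\<integral>\<^sup>+z. indicator {z. P (z n)} z \<partial>static_law ?\<beta>)"
    using path_level_sets[of P n] sets_static_law[OF \<beta>] by simp
  also have "\<dots> = (\<integral>\<^sup>+\<omega>. H \<omega> \<partial>env_law ?\<beta>)"
    unfolding H_def by (rule nn_integral_static_law[OF \<beta> ind(1)])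
  also have "\<dots> = (\<integral>\<^sup>+\<omega>. H (\<lambda>x. 1 - \<omega> x) \<partial>env_law \<alpha>)"
    using distr_env_law_map[OF prob_space_axioms, of "\<lambda>w. 1 - w" borel] nn_integral_distr[OF map, of H] H by simp
  also have "\<dots> = (\<integral>\<^sup>+\<omega>. H (\<lambda>x. 1 - \<omega> (- x)) \<partial>env_law \<alpha>)"
    using nn_integral_env_reindex[OF prob_space_axioms, of uminus "\<lambda>\<omega>. H (\<lambda>x. 1 - \<omega> x)"] measurable_compose[OF map H]
    by (simp add: inj_def)
  also have "\<dots> = (\<integral>\<^sup>+\<omega>. \<integral>\<^sup>+z. indicator {z. P (- z n)} z \<partial>quenched_law (\<lambda>_. \<omega>) \<partial>env_law \<alpha>)"
  proof (rule nn_integral_cong)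
    fix \<omega>
    show "H (\<lambda>x. 1 - \<omega> (- x)) = (\<integral>\<^sup>+z. indicator {z. P (- z n)} z \<partial>quenched_law (\<lambda>_. \<omega>))"
      using nn_integral_mirror[of "\<lambda>x. 1 - \<omega> (- x)" \<omega> "indicator {x. P x}" n]
      by (simp add: H_def right_prob_mirror indicator_def)
  qed
  also have "\<dots> = (\<integral>\<^sup>+z. indicator {z. P (- z n)} z \<partial>static_law \<alpha>)"
    by (rule nn_integral_static_law[OF \<alpha> ind(2), symmetric])
  also have "\<dots> = emeasure (static_law \<alpha>) {z. P (- z n)}"
    using path_level_sets[of "\<lambda>x. P (- x)" n] sets_static_law[OF \<alpha>] by simp
  finally show ?thesis by (simp add: measure_def)
qed

text \<open>Every power of r is at least 1, so the geometric sums exceed 1 / u however small u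
  is.\<close>

lemma summable_static_exceed_of_mean_ge_1:
  assumes \<alpha>: "real_distribution \<alpha>" and ae: "AE w in \<alpha>. 0 < w \<and> w < 1" and u: "0 < u"
    and r: "1 \<le> (\<integral>\<^sup>+w. ennreal (rho w) \<partial>\<alpha>)"
  shows "summable (\<lambda>n. measure (static_law \<alpha>) {z. u * real n \<le> real_of_int (z n)})"
proof -
  let ?r = "\<integral>\<^sup>+w. ennreal (rho w) \<partial>\<alpha>"
  obtain j :: nat where j: "1 / u < real j" using reals_Archimedean2 by blast
  have "ennreal (1 / u) < ennreal (real j)" using j u by (subst ennreal_less_iff) auto
  also have "\<dots> \<le> of_nat (Suc j)" by (simp add: ennreal_of_nat_eq_real_of_nat[symmetric] del: of_nat_Suc)
  also have "\<dots> = (\<Sum>i\<le>j. 1)" by simp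
  also have "\<dots> \<le> (\<Sum>i\<le>j. ?r ^ i)" using r by (intro sum_mono one_le_power) auto
  also have "\<dots> \<le> (1 + ?r) * (\<Sum>i\<le>j. ?r ^ i)"
    by (metis mult_right_mono mult_1 le_iff_add zero_le)
  finally show ?thesis by (rule summable_static_exceed[OF \<alpha> ae u])
qed

text \<open>Jensen's inequality for \<open>E[1 / \<rho>] = E[exp (- ln \<rho>)]\<close>, without assuming that \<open>ln \<rho>\<close> is integrable.\<close>

lemma mean_rho_mirror_ge_1:
  assumes \<alpha>: "real_distribution \<alpha>" and ae: "AE w in \<alpha>. 0 < w \<and> w < 1"
    and log: "ext_expectation \<alpha> (\<lambda>w. ln (rho w)) \<le> 0"
  shows "1 \<le> (\<integral>\<^sup>+w. ennreal (rho w) \<partial>distr \<alpha> borel (\<lambda>w. 1 - w))"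
proof -
  interpret real_distribution \<alpha> by fact
  have [measurable_cong]: "sets \<alpha> = sets borel" by simp
  let ?P = "\<integral>\<^sup>+w. ennreal (ln (rho w)) \<partial>\<alpha>" and ?N = "\<integral>\<^sup>+w. ennreal (- ln (rho w)) \<partial>\<alpha>"
  let ?r = "\<integral>\<^sup>+w. ennreal (rho (1 - w)) \<partial>\<alpha>"
  have log': "enn2ereal ?P - enn2ereal ?N \<le> 0" using log by (simp add: ext_expectation_def)
  \<comment> \<open>An infinite positive part would make the difference \<open>\<infinity>\<close>
    in \<open>ereal\<close>, contrary to the bound. Finiteness of \<open>?P\<close> is what permits
    cancelling it at the end; \<open>?N\<close> may be infinite.\<close>
  have P: "?P \<noteq> \<top>"
    using log' by (auto simp: top_ennreal.rep_eq)
  have PN: "?P \<le> ?N"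
    using log' by (cases "?N = \<top>") (auto simp: less_eq_ennreal.rep_eq ereal_minus_le_iff)
  have "1 + ?P \<le> 1 + ?N" using PN by (intro add_left_mono)
  also have "\<dots> = (\<integral>\<^sup>+w. 1 + ennreal (- ln (rho w)) \<partial>\<alpha>)"
    using emeasure_space_1 by (simp add: nn_integral_add)
  \<comment> \<open>This is 1 - ln \<rho> \<le> 1 / \<rho> with the positive part of ln \<rho> moved
    to the other side, so that all terms are nonnegative.\<close>
  also have "\<dots> \<le> (\<integral>\<^sup>+w. ennreal (rho (1 - w)) + ennreal (ln (rho w)) \<partial>\<alpha>)"
  proof (rule nn_integral_mono_AE, use ae in eventually_elim)
    fix w :: real assume w: "0 < w \<and> w < 1"
    have p: "rho w > 0" using w by (simp add: rho_pos)
    have i: "rho (1 - w) = exp (- ln (rho w))"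
      using w p by (simp add: exp_minus, simp add: rho_def field_simps)
    have le: "1 - ln (rho w) \<le> rho (1 - w)" unfolding i using exp_ge_add_one_self[of "- ln (rho w)"] by simp
    show "1 + ennreal (- ln (rho w)) \<le> ennreal (rho (1 - w)) + ennreal (ln (rho w))"
    proof (cases "ln (rho w) \<le> 0")
      case True
      then have "1 + ennreal (- ln (rho w)) = ennreal (1 - ln (rho w))"
        by (simp add: ennreal_plus[symmetric] del: ennreal_plus flip: ennreal_1)
      also have "\<dots> \<le> ennreal (rho (1 - w))" using le by (rule ennreal_leI)
      finally show ?thesis using True by (simp add: ennreal_neg)
    next
      case False
      have "0 \<le> rho (1 - w)" using w by (simp add: rho_def)
      then have "ennreal (rho (1 - w)) + ennreal (ln (rho w)) = ennreal (rho (1 - w) + ln (rho w))"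
        using False by (simp add: ennreal_plus[symmetric] del: ennreal_plus)
      also have "\<dots> \<ge> ennreal 1" using le by (intro ennreal_leI) simp
      finally show ?thesis using False by (simp add: ennreal_neg)
    qed
  qed
  also have "\<dots> = ?r + ?P" by (rule nn_integral_add) auto
  finally have "1 \<le> ?r" using P by (simp add: add.commute[of _ ?P] ennreal_add_left_cancel_le)
  then show ?thesis by (subst nn_integral_distr) auto
qed

lemma AE_mirror:
  assumes "real_distribution \<alpha>" "AE w in \<alpha>. 0 < w \<and> w < 1"
  shows "AE w in distr \<alpha> borel (\<lambda>w. 1 - w :: real). 0 < w \<and> w < 1"
proof -
  interpret real_distribution \<alpha> by fact
  show ?thesis by (subst AE_distr_iff) (use assms(2) in \<open>auto elim: eventually_mono\<close>)
qed

lemma static_speed_zero: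
  assumes \<alpha>: "real_distribution \<alpha>" and ae: "AE w in \<alpha>. 0 < w \<and> w < 1"
    and log: "ext_expectation \<alpha> (\<lambda>w. ln (rho w)) \<le> 0"
    and r: "1 \<le> (\<integral>\<^sup>+w. ennreal (rho w) \<partial>\<alpha>)"
  shows "AE z in static_law \<alpha>. (\<lambda>n. real_of_int (z n) / real n) \<longlonglongrightarrow> 0"
proof -
  \<comment> \<open>The thresholds 1 / (k + 1) keep the number of exceptional null sets countable.
    The original walk gives the upper bound and the mirrored walk the lower one.\<close>
  have "AE z in static_law \<alpha>. (\<forall>\<^sub>F n in sequentially. \<bar>real_of_int (z n)\<bar> < inverse (real (Suc k)) * real n)" for k
  proof -
    let ?u = "inverse (real (Suc k))"
    have u: "?u > 0" by simp
    have "summable (\<lambda>n. measure (static_law \<alpha>) {z. ?u * real n \<le> real_of_int (z n)})"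
      by (rule summable_static_exceed_of_mean_ge_1[OF \<alpha> ae u r])
    from static_eventually_of_summable[OF \<alpha> this]
    have 1: "AE z in static_law \<alpha>. \<forall>\<^sub>F n in sequentially. real_of_int (z n) < ?u * real n"
      by (simp add: not_le)
    have eq: "measure (static_law (distr \<alpha> borel (\<lambda>w. 1 - w))) {z. ?u * real n \<le> real_of_int (z n)} =
        measure (static_law \<alpha>) {z. ?u * real n \<le> real_of_int (- z n)}" for n
      by (rule measure_static_mirror[OF \<alpha>, of "\<lambda>x. ?u * real n \<le> real_of_int x"])
    have "summable (\<lambda>n. measure (static_law \<alpha>) {z. ?u * real n \<le> real_of_int (- z n)})"
      using summable_static_exceed_of_mean_ge_1[OF real_distribution_mirror[OF \<alpha>] AE_mirror[OF \<alpha> ae] u mean_rho_mirror_ge_1[OF \<alpha> ae log]]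
      unfolding eq .
    from static_eventually_of_summable[OF \<alpha> this]
    have "AE z in static_law \<alpha>. \<forall>\<^sub>F n in sequentially. - real_of_int (z n) < ?u * real n"
      by (simp add: not_le)
    with 1 show ?thesis
    proof eventually_elim
      fix z assume "\<forall>\<^sub>F n in sequentially. real_of_int (z n) < ?u * real n"
        "\<forall>\<^sub>F n in sequentially. - real_of_int (z n) < ?u * real n"
      then show "\<forall>\<^sub>F n in sequentially. \<bar>real_of_int (z n)\<bar> < ?u * real n"
        by eventually_elim (rule abs_less_iff[THEN iffD2], simp)
    qed
  qed
  then have "AE z in static_law \<alpha>. \<forall>k. \<forall>\<^sub>F n in sequentially. \<bar>real_of_int (z n)\<bar> < inverse (real (Suc k)) * real n"
    by (simp only: AE_all_countable) simp
  then show ?thesis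
  proof eventually_elim
    fix z :: "nat \<Rightarrow> int" assume *: "\<forall>k. \<forall>\<^sub>F n in sequentially. \<bar>real_of_int (z n)\<bar> < inverse (real (Suc k)) * real n"
    show "(\<lambda>n. real_of_int (z n) / real n) \<longlonglongrightarrow> 0"
    proof (rule tendstoI)
      fix e :: real assume "0 < e"
      then obtain k where k: "inverse (real (Suc k)) < e" using reals_Archimedean by blast
      show "\<forall>\<^sub>F n in sequentially. dist (real_of_int (z n) / real n) 0 < e"
        using *[rule_format, of k] eventually_gt_at_top[of 0]
      proof eventually_elim
        fix n :: nat assume n: "\<bar>real_of_int (z n)\<bar> < inverse (real (Suc k)) * real n" "0 < n"
        then have "\<bar>real_of_int (z n)\<bar> / real n < inverse (real (Suc k))"
          by (simp add: pos_divide_less_eq)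
        with k show "dist (real_of_int (z n) / real n) 0 < e" by simp
      qed
    qed
  qed
qed

subsection \<open>Stationary averages\<close>

definition birkhoff_sum :: "('a \<Rightarrow> 'a) \<Rightarrow> ('a \<Rightarrow> real) \<Rightarrow> nat \<Rightarrow> 'a \<Rightarrow> real" where
  "birkhoff_sum T D n x = (\<Sum>i<n. D ((T ^^ i) x))"

text \<open>The maximum of the Birkhoff sums of lengths 0, ..., n. The recursion is the relation
  between the maximum at x and at T x on which the maximal inequality rests.\<close>

primrec max_birkhoff_sum :: "('a \<Rightarrow> 'a) \<Rightarrow> ('a \<Rightarrow> real) \<Rightarrow> nat \<Rightarrow> 'a \<Rightarrow> real" where
  "max_birkhoff_sum T D 0 x = 0"
| "max_birkhoff_sum T D (Suc n) x = max 0 (D x + max_birkhoff_sum T D n (T x))"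

lemma birkhoff_sum_Suc: "birkhoff_sum T D (Suc n) x = D x + birkhoff_sum T D n (T x)"
  unfolding birkhoff_sum_def sum.lessThan_Suc_shift by (simp add: funpow_swap1)

lemma birkhoff_sum_abs_le:
  assumes "\<And>x. \<bar>D x\<bar> \<le> K"
  shows "\<bar>birkhoff_sum T D n x\<bar> \<le> real n * K"
proof -
  have "\<bar>birkhoff_sum T D n x\<bar> \<le> (\<Sum>i<n. \<bar>D ((T ^^ i) x)\<bar>)" unfolding birkhoff_sum_def by (rule sum_abs)
  also have "\<dots> \<le> (\<Sum>i<n. K)" by (intro sum_mono assms)
  finally show ?thesis by simp
qed

lemma max_birkhoff_sum_nonneg: "0 \<le> max_birkhoff_sum T D n x"
  by (cases n) auto

lemma max_birkhoff_sum_mono: "max_birkhoff_sum T D n x \<le> max_birkhoff_sum T D (Suc n) x"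
proof (induction n arbitrary: x)
  case (Suc n)
  have "max 0 (D x + max_birkhoff_sum T D n (T x)) \<le> max 0 (D x + max_birkhoff_sum T D (Suc n) (T x))"
    using Suc[of "T x"] by (intro max.mono) auto
  then show ?case by (simp only: max_birkhoff_sum.simps)
qed simp

lemma birkhoff_sum_le_max: "n \<le> N \<Longrightarrow> birkhoff_sum T D n x \<le> max_birkhoff_sum T D N x"
proof (induction N arbitrary: n x)
  case (Suc N)
  show ?case
  proof (cases n)
    case (Suc k)
    with Suc.IH[of k "T x"] Suc.prems show ?thesis by (simp add: birkhoff_sum_Suc)
  qed (simp add: birkhoff_sum_def)
qed (simp add: birkhoff_sum_def)

lemma max_birkhoff_sum_le:
  assumes "\<And>x. \<bar>D x\<bar> \<le> K"
  shows "max_birkhoff_sum T D n x \<le> real n * K"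
proof (induction n arbitrary: x)
  case (Suc n)
  have "0 \<le> K" using assms[of x] by linarith
  then show ?case using Suc[of "T x"] assms[of x] by (auto simp: algebra_simps max_def)
qed simp

lemma (in prob_space) integral_measure_preserving:
  fixes f :: "'a \<Rightarrow> real"
  assumes "T \<in> measurable M M" "distr M M T = M" "f \<in> borel_measurable M"
  shows "(\<integral>x. f (T x) \<partial>M) = (\<integral>x. f x \<partial>M)"
  using integral_distr[OF assms(1), of f] assms by simp

text \<open>Garsia's proof: on \<open>{m > 0}\<close> with \<open>m = max_birkhoff_sum T g (Suc N)\<close> one has
  \<open>g \<ge> m - m \<circ> T\<close>, and the integral of \<open>m - m \<circ> T\<close> vanishes.\<close>

lemma (in prob_space) maximal_ergodic:
  fixes g :: "'a \<Rightarrow> real"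
  assumes T [measurable]: "T \<in> measurable M M" and pres: "distr M M T = M"
    and g [measurable]: "g \<in> borel_measurable M" and bounded: "\<And>x. \<bar>g x\<bar> \<le> K"
  shows "0 \<le> (\<integral>x. g x * indicator {x. 0 < max_birkhoff_sum T g (Suc N) x} x \<partial>M)"
proof -
  let ?m = "max_birkhoff_sum T g (Suc N)"
  have meas: "max_birkhoff_sum T g n \<in> borel_measurable M" for n
  proof (induction n)
    case (Suc n)
    note [measurable] = Suc
    show ?case by simp
  qed simp
  have [measurable]: "?m \<in> borel_measurable M" by (rule meas)
  have "\<bar>?m x\<bar> \<le> real (Suc N) * K" for x
    using max_birkhoff_sum_le[where D = g and T = T and n = "Suc N" and x = x, OF bounded] max_birkhoff_sum_nonneg[of T g "Suc N" x] by linarith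
  then have int: "integrable M ?m" "integrable M (\<lambda>x. ?m (T x))"
    using meas[of "Suc N"] measurable_compose[OF T meas[of "Suc N"]]
    by (intro integrable_const_bound[of _ "real (Suc N) * K"]; auto simp del: max_birkhoff_sum.simps of_nat_Suc)+
  have [measurable]: "Measurable.pred M (\<lambda>x. 0 < ?m x)" by measurable
  have int_g: "integrable M (\<lambda>x. g x * indicator {x. 0 < ?m x} x)"
  proof (rule integrable_const_bound[of _ K])
    show "(\<lambda>x. g x * indicator {x. 0 < ?m x} x) \<in> borel_measurable M" by measurable
    have "0 \<le> K" using order_trans[OF abs_ge_zero bounded] .
    then show "AE x in M. norm (g x * indicator {x. 0 < ?m x} x) \<le> K"
      using bounded by (auto simp: indicator_def simp del: max_birkhoff_sum.simps)
  qed
  have "0 = (\<integral>x. ?m x - ?m (T x) \<partial>M)"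
    using Bochner_Integration.integral_diff[OF int] integral_measure_preserving[OF T pres meas[of "Suc N"]]
    by (simp del: max_birkhoff_sum.simps)
  also have "\<dots> \<le> (\<integral>x. g x * indicator {x. 0 < ?m x} x \<partial>M)"
  proof (rule integral_mono)
    show "integrable M (\<lambda>x. ?m x - ?m (T x))" using int by (rule Bochner_Integration.integrable_diff)
    fix x
    show "?m x - ?m (T x) \<le> g x * indicator {x. 0 < ?m x} x"
    proof (cases "0 < ?m x")
      case True
      then have "?m x = g x + max_birkhoff_sum T g N (T x)" by (simp add: max_def split: if_splits)
      with True max_birkhoff_sum_mono[of T g N "T x"] show ?thesis by (simp del: max_birkhoff_sum.simps)
    next
      case False
      then show ?thesis using max_birkhoff_sum_nonneg[of T g "Suc N" "T x"]
        by (simp del: max_birkhoff_sum.simps)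
    qed
  qed (rule int_g)
  finally show ?thesis .
qed

text \<open>The n-th average at T x and the average of length n + 1 at x differ by at most 2 / n:
  the sums differ by one bounded term, and changing the divisor from n + 1 to n costs at most 1 /
  n.\<close>

lemma liminf_birkhoff_invariant:
  assumes D: "\<And>x. \<bar>D x\<bar> \<le> 1"
  shows "liminf (\<lambda>n. ereal (birkhoff_sum T D n (T x) / real n)) = liminf (\<lambda>n. ereal (birkhoff_sum T D n x / real n))"
proof -
  let ?S = "birkhoff_sum T D"
  define d where "d n = ?S n (T x) / real n - ?S (Suc n) x / real (Suc n)" for n
  have frac: "(s - \<delta>) / N - s / (1 + N) = s / (N * (1 + N)) - \<delta> / N" if "0 < N" for s \<delta> N :: real
    using that by (simp add: diff_divide_distrib) (simp add: diff_frac_eq algebra_simps)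
  have "d \<longlonglongrightarrow> 0"
  proof (rule tendsto_rabs_zero_cancel, rule tendsto_sandwich[OF _ _ tendsto_const])
    show "(\<lambda>n. 2 / real n) \<longlonglongrightarrow> 0" by (rule lim_const_over_n)
    show "\<forall>\<^sub>F n in sequentially. \<bar>d n\<bar> \<le> 2 / real n"
      using eventually_gt_at_top[of 0]
    proof eventually_elim
      fix n :: nat assume n: "0 < n"
      have e: "?S n (T x) = ?S (Suc n) x - D x" by (simp add: birkhoff_sum_Suc)
      have "d n = ?S (Suc n) x / (real n * real (Suc n)) - D x / real n"
        unfolding d_def e using frac[of "real n"] n by simp
      also have "\<bar>\<dots>\<bar> \<le> \<bar>?S (Suc n) x\<bar> / (real n * real (Suc n)) + \<bar>D x\<bar> / real n"
        by (rule order_trans[OF abs_triangle_ineq4]) (simp add: abs_mult)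
      also have "\<dots> \<le> real (Suc n) / (real n * real (Suc n)) + 1 / real n"
        using birkhoff_sum_abs_le[where D = D and T = T and n = "Suc n" and x = x, OF D] D[of x]
        by (intro add_mono divide_right_mono) auto
      also have "\<dots> = 2 / real n" using n by (simp del: of_nat_Suc)
      finally show "\<bar>d n\<bar> \<le> 2 / real n" .
    qed
  qed auto
  then have "(\<lambda>n. ereal (d n)) \<longlonglongrightarrow> ereal 0" by (rule tendsto_ereal)
  then have "liminf (\<lambda>n. ereal (d n) + ereal (?S (Suc n) x / real (Suc n))) = ereal 0 + liminf (\<lambda>n. ereal (?S (Suc n) x / real (Suc n)))"
    by (rule ereal_liminf_lim_add) simp
  moreover have "liminf (\<lambda>n. ereal (?S (Suc n) x / real (Suc n))) = liminf (\<lambda>n. ereal (?S n x / real n))"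
    using liminf_shift[of "\<lambda>n. ereal (?S n x / real n)"] by simp
  ultimately show ?thesis by (simp add: d_def)
qed

text \<open>For c < v let A be the invariant set where the lower limit is below c, and a its
  probability. The maximal inequality bounds the integral of D over A by c a, and the hypothesis on
  the upper limit bounds it over the complement by v (1 - a). Since the total is at least v, a (v -
  c) \<le> 0 and A is null.\<close>

lemma (in prob_space) birkhoff_average_tendsto:
  assumes T [measurable]: "T \<in> measurable M M" and pres: "distr M M T = M"
    and D [measurable]: "D \<in> borel_measurable M" and bounded: "\<And>x. \<bar>D x\<bar> \<le> 1"
    and upper: "\<And>u. v < u \<Longrightarrow> AE x in M. \<forall>\<^sub>F n in sequentially. birkhoff_sum T D n x < u * real n"
    and mean: "v \<le> (\<integral>x. D x \<partial>M)"
  shows "AE x in M. (\<lambda>n. birkhoff_sum T D n x / real n) \<longlonglongrightarrow> v"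
proof -
  let ?S = "birkhoff_sum T D"
  have powT [measurable]: "(T ^^ i) \<in> measurable M M" for i
    by (induction i) (auto simp: measurable_comp[OF _ T, unfolded comp_def] comp_def)
  have [measurable]: "?S n \<in> borel_measurable M" for n
    unfolding birkhoff_sum_def[abs_def] by measurable
  define L where "L x = liminf (\<lambda>n. ereal (?S n x / real n))" for x
  have [measurable]: "L \<in> borel_measurable M" unfolding L_def[abs_def] by measurable
  have inv: "L (T x) = L x" for x unfolding L_def by (rule liminf_birkhoff_invariant[OF bounded])
  have intD: "integrable M D" by (rule integrable_const_bound[of _ 1]) (use bounded in auto)
  have null: "AE x in M. ereal c \<le> L x" if c: "c < v" for c
  proof -
    define A where "A = {x. L x < ereal c}"
    have invA: "indicator A (T x) = (indicator A x :: real)" for x by (simp add: A_def inv indicator_def)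
    have [measurable]: "Measurable.pred M (\<lambda>x. x \<in> A)" unfolding A_def by measurable
    have Asets: "A \<inter> space M \<in> sets M" by measurable
    define a where "a = prob (A \<inter> space M)"
    have int_A: "(\<integral>x. indicator A x \<partial>M) = a"
    proof -
      have "(\<integral>x. indicator A x \<partial>M) = (\<integral>x. indicator (A \<inter> space M) x \<partial>M :: real)"
        by (rule Bochner_Integration.integral_cong) (auto simp: indicator_def)
      then show ?thesis using Asets by (simp add: a_def)
    qed
    have intA: "integrable M (\<lambda>x. indicator A x :: real)" by (rule integrable_const_bound[of _ 1]) auto
    have intDA: "integrable M (\<lambda>x. D x * indicator A x)"
      by (rule integrable_const_bound[of _ 1]) (use bounded in \<open>auto simp: indicator_def\<close>)
    have intDB: "integrable M (\<lambda>x. D x * (1 - indicator A x))"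
      by (rule integrable_const_bound[of _ 1]) (use bounded in \<open>auto simp: indicator_def\<close>)
    \<comment> \<open>By invariance of A, the Birkhoff sums of g are n c - S_n on A and 0 off A. On
      A some of them is positive, because the averages fall below c infinitely often.\<close>
    define g where "g x = (c - D x) * indicator A x" for x
    have [measurable]: "g \<in> borel_measurable M" unfolding g_def[abs_def] by measurable
    have gb: "\<bar>g x\<bar> \<le> \<bar>c\<bar> + 1" for x
      using bounded[of x] by (auto simp: g_def indicator_def)
    have off: "max_birkhoff_sum T g N x = 0" if "x \<notin> A" for N x
      using that
    proof (induction N arbitrary: x)
      case (Suc N)
      have "T x \<notin> A" using Suc.prems by (simp add: A_def inv)
      with Suc show ?case by (simp add: g_def)
    qed simp
    have gsum: "birkhoff_sum T g n x = (real n * c - ?S n x) * indicator A x" for n x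
    proof (induction n arbitrary: x)
      case (Suc n)
      from Suc[of "T x"] show ?case by (simp add: birkhoff_sum_Suc invA g_def algebra_simps)
    qed (simp add: birkhoff_sum_def)
    \<comment> \<open>Hence the sets in the maximal inequality exhaust A as N grows, and its
      integrals converge to the integral of g.\<close>
    have "(\<lambda>N. \<integral>x. g x * indicator {x. 0 < max_birkhoff_sum T g (Suc N) x} x \<partial>M) \<longlonglongrightarrow> (\<integral>x. g x \<partial>M)"
    proof (rule integral_dominated_convergence[where w = "\<lambda>_. \<bar>c\<bar> + 1"])
      have meas: "max_birkhoff_sum T g n \<in> borel_measurable M" for n
      proof (induction n)
        case (Suc n)
        note [measurable] = Suc
        show ?case by simp
      qed simp
      fix N
      have [measurable]: "Measurable.pred M (\<lambda>x. 0 < max_birkhoff_sum T g (Suc N) x)"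
        using meas[of "Suc N"] by measurable
      show "(\<lambda>x. g x * indicator {x. 0 < max_birkhoff_sum T g (Suc N) x} x) \<in> borel_measurable M"
        by measurable
      show "AE x in M. norm (g x * indicator {x. 0 < max_birkhoff_sum T g (Suc N) x} x) \<le> \<bar>c\<bar> + 1"
        using gb by (auto simp: indicator_def)
    next
      show "AE x in M. (\<lambda>N. g x * indicator {x. 0 < max_birkhoff_sum T g (Suc N) x} x) \<longlonglongrightarrow> g x"
      proof (rule AE_I2)
        fix x
        show "(\<lambda>N. g x * indicator {x. 0 < max_birkhoff_sum T g (Suc N) x} x) \<longlonglongrightarrow> g x"
        proof (cases "x \<in> A")
          case True
          then have "L x < ereal c" by (simp add: A_def)
          then have "\<not> (\<forall>\<^sub>F n in sequentially. ereal c \<le> ereal (?S n x / real n))"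
            unfolding L_def using Liminf_bounded[of "ereal c" "\<lambda>n. ereal (?S n x / real n)" sequentially]
            by (meson not_le)
          then have "\<exists>\<^sub>F n in sequentially. ereal (?S n x / real n) < ereal c"
            unfolding frequently_def not_less .
          then have "\<exists>\<^sub>F n in sequentially. ereal (?S n x / real n) < ereal c \<and> 0 < n"
            using eventually_gt_at_top[of 0] by (rule frequently_eventually_frequently)
          from frequently_ex[OF this] obtain n where n: "?S n x / real n < c" "0 < n"
            by auto
          then have "0 < birkhoff_sum T g n x" using True by (simp add: gsum field_simps)
          then have "0 < max_birkhoff_sum T g (Suc N) x" if "n \<le> N" for N
            using birkhoff_sum_le_max[of n "Suc N" T g x] that by simp
          then have "\<forall>\<^sub>F N in sequentially. g x * indicator {x. 0 < max_birkhoff_sum T g (Suc N) x} x = g x"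
            by (auto simp: eventually_sequentially simp del: max_birkhoff_sum.simps intro!: exI[of _ n])
          then show ?thesis by (rule tendsto_eventually)
        qed (simp add: g_def)
      qed
    qed (use gb in auto)
    then have "0 \<le> (\<integral>x. g x \<partial>M)"
      by (rule LIMSEQ_le_const) (use maximal_ergodic[OF T pres \<open>g \<in> borel_measurable M\<close> gb] in blast)
    also have "(\<integral>x. g x \<partial>M) = c * a - (\<integral>x. D x * indicator A x \<partial>M)"
      using intDA intA by (simp add: g_def left_diff_distrib a_def)
    finally have 1: "(\<integral>x. D x * indicator A x \<partial>M) \<le> c * a" by simp

    have 2: "(\<integral>x. D x * (1 - indicator A x) \<partial>M) \<le> u * (1 - a)" if u: "v < u" for u
    proof -
      \<comment> \<open>Indicator of the complement of A. By its invariance each of the n terms of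
        S_n has the same integral over the complement as D.\<close>
      define B where "B x = (1 - indicator A x :: real)" for x
      have [measurable]: "B \<in> borel_measurable M" unfolding B_def[abs_def] by measurable
      have B01: "0 \<le> B x" "B x \<le> 1" for x by (auto simp: B_def indicator_def)
      have BT: "B ((T ^^ i) x) = B x" for i x by (induction i arbitrary: x) (auto simp: B_def invA)
      have int_B: "(\<integral>x. B x \<partial>M) = 1 - a" unfolding B_def using intA by (simp add: a_def prob_space)
      have intB: "integrable M B" by (rule integrable_const_bound[of _ 1]) (use B01 in auto)
      have shift: "(\<integral>x. D ((T ^^ i) x) * B x \<partial>M) = (\<integral>x. D x * B x \<partial>M)" for i
      proof (induction i)
        case (Suc i)
        have "(\<integral>x. D ((T ^^ Suc i) x) * B x \<partial>M) = (\<integral>x. (\<lambda>x. D ((T ^^ i) x) * B x) (T x) \<partial>M)"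
          using BT[of 1] by (simp add: funpow_swap1)
        also have "\<dots> = (\<integral>x. D ((T ^^ i) x) * B x \<partial>M)"
          by (rule integral_measure_preserving[OF T pres]) measurable
        finally show ?case using Suc by simp
      qed simp
      have intDT: "integrable M (\<lambda>x. D ((T ^^ i) x) * B x)" for i
      proof (rule integrable_const_bound[of _ 1])
        have "\<bar>D ((T ^^ i) x)\<bar> * \<bar>B x\<bar> \<le> 1 * 1" for x
          using bounded B01[of x] by (intro mult_mono) auto
        then show "AE x in M. norm (D ((T ^^ i) x) * B x) \<le> 1" by (simp add: abs_mult)
      qed measurable
      have sumB: "(\<integral>x. ?S n x * B x \<partial>M) = real n * (\<integral>x. D x * B x \<partial>M)" for n
        unfolding birkhoff_sum_def sum_distrib_right
        by (subst Bochner_Integration.integral_sum) (auto simp: shift intDT)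
      \<comment> \<open>The overshoot of the n-th average above u on the complement. It is bounded
        and eventually zero almost everywhere, so its integral vanishes in the limit.\<close>
      define f where "f n x = max 0 (?S n x / real n - u) * B x" for n x
      have [measurable]: "f n \<in> borel_measurable M" for n unfolding f_def[abs_def] by measurable
      have fb: "\<bar>f n x\<bar> \<le> 1 + \<bar>u\<bar>" for n x
      proof -
        have "\<bar>?S n x / real n\<bar> \<le> 1"
          using birkhoff_sum_abs_le[where D = D and T = T and n = n and x = x, OF bounded] by (cases "n = 0") (auto simp: divide_le_eq)
        then have "max 0 (?S n x / real n - u) \<le> 1 + \<bar>u\<bar>" by (intro max.boundedI) linarith+
        then have "max 0 (?S n x / real n - u) * B x \<le> (1 + \<bar>u\<bar>) * 1"
          using B01 by (intro mult_mono) auto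
        then show ?thesis using B01[of x] by (simp add: f_def abs_mult)
      qed
      have "(\<lambda>n. \<integral>x. f n x \<partial>M) \<longlonglongrightarrow> (\<integral>x. 0 \<partial>M)"
      proof (rule integral_dominated_convergence[where w = "\<lambda>_. 1 + \<bar>u\<bar>"])
        show "AE x in M. (\<lambda>n. f n x) \<longlonglongrightarrow> 0"
          using upper[OF u]
        proof eventually_elim
          fix x assume "\<forall>\<^sub>F n in sequentially. ?S n x < u * real n"
          then have "\<forall>\<^sub>F n in sequentially. f n x = 0"
            using eventually_gt_at_top[of 0]
            by eventually_elim (simp add: f_def max_def field_simps)
          then show "(\<lambda>n. f n x) \<longlonglongrightarrow> 0" by (rule tendsto_eventually)
        qed
      qed (use fb in auto)
      then have f0: "(\<lambda>n. u * (1 - a) + (\<integral>x. f n x \<partial>M)) \<longlonglongrightarrow> u * (1 - a) + 0"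
        by (intro tendsto_add tendsto_const) simp
      have "(\<integral>x. D x * B x \<partial>M) \<le> u * (1 - a) + (\<integral>x. f n x \<partial>M)" if n: "1 \<le> n" for n
      proof -
        have if': "integrable M (f n)" by (rule integrable_const_bound[of _ "1 + \<bar>u\<bar>"]) (use fb in auto)
        have intS: "integrable M (\<lambda>x. ?S n x * B x)"
          unfolding birkhoff_sum_def sum_distrib_right by (intro Bochner_Integration.integrable_sum intDT)
        have "(\<integral>x. D x * B x \<partial>M) = (\<integral>x. ?S n x * B x / real n \<partial>M)"
          using n by (simp add: sumB)
        also have "\<dots> \<le> (\<integral>x. u * B x + f n x \<partial>M)"
        proof (rule integral_mono)
          fix x
          have "?S n x / real n * B x \<le> (u + max 0 (?S n x / real n - u)) * B x"
            using B01 by (intro mult_right_mono) auto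
          then show "?S n x * B x / real n \<le> u * B x + f n x" by (simp add: f_def algebra_simps)
        qed (use intS if' intB in auto)
        also have "\<dots> = u * (1 - a) + (\<integral>x. f n x \<partial>M)"
          using if' intB by (simp add: int_B)
        finally show ?thesis .
      qed
      then have "(\<integral>x. D x * B x \<partial>M) \<le> u * (1 - a) + 0"
        by (intro LIMSEQ_le_const[OF f0]) blast
      then show ?thesis by (simp add: B_def)
    qed
    have a01: "0 \<le> a" "a \<le> 1" by (auto simp: a_def)
    have "v \<le> (\<integral>x. D x * indicator A x + D x * (1 - indicator A x) \<partial>M)"
      using mean by (simp add: algebra_simps)
    also have "\<dots> = (\<integral>x. D x * indicator A x \<partial>M) + (\<integral>x. D x * (1 - indicator A x) \<partial>M)"
      using intDA intDB by (rule Bochner_Integration.integral_add)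
    finally have "v \<le> c * a + u * (1 - a)" if "v < u" for u using 1 2[OF that] by linarith
    \<comment> \<open>The bound is available only for u above v; let u decrease to v.\<close>
    moreover have "((\<lambda>u. c * a + u * (1 - a)) \<longlongrightarrow> c * a + v * (1 - a)) (at_right v)"
      by (intro tendsto_intros)
    ultimately have "v \<le> c * a + v * (1 - a)"
      by (intro tendsto_lowerbound[of _ _ "at_right v"]) (auto simp: eventually_at_right_less intro: eventually_mono[OF eventually_at_right_less])
    then have "a * (v - c) \<le> 0" by (simp add: algebra_simps)
    then have "a = 0" using a01 c by (simp add: mult_le_0_iff)
    then have "AE x in M. x \<notin> A \<inter> space M"
      using Asets by (intro AE_not_in) (auto simp: a_def emeasure_eq_measure null_sets_def)
    then show ?thesis by (rule AE_mp) (auto simp: A_def not_less intro!: AE_I2)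
  qed
  have "AE x in M. \<forall>k. ereal (v - inverse (real (Suc k))) \<le> L x"
    unfolding AE_all_countable by (intro allI null) simp
  moreover have "AE x in M. \<forall>k. \<forall>\<^sub>F n in sequentially. ?S n x < (v + inverse (real (Suc k))) * real n"
    unfolding AE_all_countable by (intro allI upper) simp
  ultimately show ?thesis
  proof eventually_elim
    fix x assume lo: "\<forall>k. ereal (v - inverse (real (Suc k))) \<le> L x"
      and hi: "\<forall>k. \<forall>\<^sub>F n in sequentially. ?S n x < (v + inverse (real (Suc k))) * real n"
    show "(\<lambda>n. ?S n x / real n) \<longlonglongrightarrow> v"
    proof (rule tendstoI)
      fix e :: real assume "0 < e"
      then obtain k where k: "inverse (real (Suc k)) < e" using reals_Archimedean by blast
      have "ereal (v - e) < ereal (v - inverse (real (Suc k)))" using k by simp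
      also have "\<dots> \<le> L x" using lo by blast
      finally have "\<forall>\<^sub>F n in sequentially. ereal (v - e) < ereal (?S n x / real n)"
        unfolding L_def by (rule less_LiminfD)
      with hi[rule_format, of k] eventually_gt_at_top[of 0]
      show "\<forall>\<^sub>F n in sequentially. dist (?S n x / real n) v < e"
      proof eventually_elim
        fix n :: nat assume n: "?S n x < (v + inverse (real (Suc k))) * real n" "0 < n" "ereal (v - e) < ereal (?S n x / real n)"
        then have "?S n x / real n < v + inverse (real (Suc k))" by (simp add: pos_divide_less_eq)
        with n k show "dist (?S n x / real n) v < e" by (simp add: dist_real_def abs_less_iff)
      qed
    qed
  qed
qed

subsection \<open>The environment seen from the walk\<close>

text \<open>The series 1 + \<rho>_1 + \<rho>_1 \<rho>_2 + ..., taken in \<open>ennreal\<close> so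
  that it is defined for every environment. It reads only sites right of 0 and is thus independent
  of \<rho>_0, which makes the means below factorize.\<close>

definition future_weight :: "env \<Rightarrow> ennreal" where
  "future_weight \<omega> = (\<Sum>j. \<Prod>i<j. ennreal (rho (\<omega> (1 + int i))))"

text \<open>Up to normalization, the density with respect to \<open>env_law \<alpha>\<close> of the stationary law of the
  environment seen from the walk.\<close>

definition particle_density :: "env \<Rightarrow> ennreal" where
  "particle_density \<omega> = (1 + ennreal (rho (\<omega> 0))) * future_weight \<omega>"

lemma future_weight_rec: "future_weight \<omega> = 1 + ennreal (rho (\<omega> 1)) * future_weight (\<lambda>x. \<omega> (x + 1))"
proof -
  let ?f = "\<lambda>\<omega> j. \<Prod>i<j. ennreal (rho (\<omega> (1 + int i)))"
  have "?f (\<lambda>x. \<omega> (x + 1)) sums future_weight (\<lambda>x. \<omega> (x + 1))"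
    unfolding future_weight_def by (rule summable_sums) simp
  have "(\<lambda>j. ?f \<omega> (Suc j)) = (\<lambda>j. ennreal (rho (\<omega> 1)) * ?f (\<lambda>x. \<omega> (x + 1)) j)"
    unfolding prod.lessThan_Suc_shift by (simp add: ac_simps)
  then have "(\<Sum>j. ?f \<omega> (Suc j)) = ennreal (rho (\<omega> 1)) * future_weight (\<lambda>x. \<omega> (x + 1))"
    unfolding future_weight_def by simp
  then have "(\<lambda>j. ?f \<omega> (Suc j)) sums (ennreal (rho (\<omega> 1)) * future_weight (\<lambda>x. \<omega> (x + 1)))"
    by (metis summableI summable_sums)
  from sums_unique[OF sums_Suc[OF this]] show ?thesis
    unfolding future_weight_def by (simp add: add.commute)
qed

lemma future_weight_ge_1: "1 \<le> future_weight \<omega>"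
  by (subst future_weight_rec) simp

lemma
  assumes "real_distribution \<alpha>"
  shows future_weight_measurable: "future_weight \<in> borel_measurable (env_law \<alpha>)"
    and particle_density_measurable: "particle_density \<in> borel_measurable (env_law \<alpha>)"
proof -
  note [measurable] = env_coord_measurable[OF assms]
  show [measurable]: "future_weight \<in> borel_measurable (env_law \<alpha>)"
    unfolding future_weight_def[abs_def] by measurable
  show "particle_density \<in> borel_measurable (env_law \<alpha>)"
    unfolding particle_density_def[abs_def] by measurable
qed

lemma future_weight_cong: "(\<And>x. 1 \<le> x \<Longrightarrow> \<omega> x = \<omega>' x) \<Longrightarrow> future_weight \<omega> = future_weight \<omega>'"
  unfolding future_weight_def by simp

lemma nn_integral_future_weight:
  assumes \<alpha>: "real_distribution \<alpha>"
  shows "(\<integral>\<^sup>+\<omega>. future_weight \<omega> \<partial>env_law \<alpha>) = (\<Sum>j. (\<integral>\<^sup>+w. ennreal (rho w) \<partial>\<alpha>) ^ j)"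
proof -
  interpret real_distribution \<alpha> by fact
  note [measurable] = env_coord_measurable[OF assms]
  have [measurable_cong]: "sets \<alpha> = sets borel" by simp
  have "(\<integral>\<^sup>+\<omega>. (\<Prod>i<j. ennreal (rho (\<omega> (1 + int i)))) \<partial>env_law \<alpha>) = (\<integral>\<^sup>+w. ennreal (rho w) \<partial>\<alpha>) ^ j" for j
  proof -
    have inj: "inj_on (\<lambda>i. 1 + int i) {..<j}" by (auto simp: inj_on_def)
    have "(\<integral>\<^sup>+\<omega>. (\<Prod>i<j. ennreal (rho (\<omega> (1 + int i)))) \<partial>env_law \<alpha>) =
        (\<integral>\<^sup>+\<omega>. (\<Prod>x\<in>(\<lambda>i. 1 + int i) ` {..<j}. ennreal (rho (\<omega> x))) \<partial>PiM UNIV (\<lambda>_. \<alpha>))"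
      unfolding env_law_def prod.reindex[OF inj] by simp
    also have "\<dots> = (\<Prod>x\<in>(\<lambda>i. 1 + int i) ` {..<j}. \<integral>\<^sup>+w. ennreal (rho w) \<partial>\<alpha>)"
      by (rule nn_integral_PiM_prod) (auto intro: prob_space_axioms)
    finally show ?thesis by (simp add: card_image[OF inj])
  qed
  then show ?thesis
    unfolding future_weight_def by (subst nn_integral_suminf) auto
qed

lemma nn_integral_mult_future_weight:
  assumes \<alpha>: "real_distribution \<alpha>" and F: "F \<in> borel_measurable borel"
  shows "(\<integral>\<^sup>+\<omega>. F (\<omega> 0) * future_weight \<omega> \<partial>env_law \<alpha>) = (\<integral>\<^sup>+w. F w \<partial>\<alpha>) * (\<Sum>j. (\<integral>\<^sup>+w. ennreal (rho w) \<partial>\<alpha>) ^ j)"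
proof -
  interpret real_distribution \<alpha> by fact
  have m: "(\<lambda>\<omega>. F (\<omega> 0)) \<in> borel_measurable (env_law \<alpha>)"
    by (rule measurable_compose[OF env_coord_measurable[OF \<alpha>] F])
  have "(\<integral>\<^sup>+\<omega>. F (\<omega> 0) * future_weight \<omega> \<partial>env_law \<alpha>) = (\<integral>\<^sup>+\<omega>. F (\<omega> 0) \<partial>env_law \<alpha>) * (\<integral>\<^sup>+\<omega>. future_weight \<omega> \<partial>env_law \<alpha>)"
    unfolding env_law_def
  proof (rule nn_integral_PiM_indep[where I = "{0}" and J = "{1..}"])
    show "future_weight \<omega> = future_weight \<omega>'" if "\<And>i. i \<in> {1..} \<Longrightarrow> \<omega> i = \<omega>' i" for \<omega> \<omega>'
      by (rule future_weight_cong) (use that in auto)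
  qed (use m future_weight_measurable[OF \<alpha>] prob_space_axioms in \<open>auto simp: env_law_def\<close>)
  then show ?thesis
    by (simp only: nn_integral_future_weight[OF \<alpha>] nn_integral_env_coord[OF \<alpha> F])
qed

text \<open>The measure-preserving map acts on paths rather than on environments: the increments of
  the path already carry what the averages need, and the environment can be integrated out.\<close>

definition recenter :: "(nat \<Rightarrow> int) \<Rightarrow> nat \<Rightarrow> int" where
  "recenter z = (\<lambda>n. z (Suc n) - z 1)"

lemma recenter_measurable [measurable]: "recenter \<in> measurable path_space path_space"
  unfolding recenter_def[abs_def] by (rule measurable_PiM_single') auto

text \<open>The case i = 0 stands apart because the zeroth iterate does not move the path to the
  origin.\<close>

lemma recenter_funpow: "(recenter ^^ i) z = (\<lambda>n. z (n + i) - (if i = 0 then 0 else z i))"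
  by (induction i) (auto simp: recenter_def)

lemma nn_integral_recenter:
  assumes [measurable]: "F \<in> borel_measurable path_space"
  shows "(\<integral>\<^sup>+z. F (recenter z) \<partial>quenched_law (\<lambda>_. \<omega>)) =
    ennreal (right_prob (\<omega> 0)) * (\<integral>\<^sup>+z. F z \<partial>quenched_law (\<lambda>_ x. \<omega> (x + 1))) +
    ennreal (1 - right_prob (\<omega> 0)) * (\<integral>\<^sup>+z. F z \<partial>quenched_law (\<lambda>_ x. \<omega> (x - 1)))"
proof -
  have "(\<integral>\<^sup>+z. F (recenter (prepend_step d z)) \<partial>quenched_law V) = (\<integral>\<^sup>+z. F z \<partial>quenched_law V)" for d V
  proof (rule nn_integral_cong_AE, use quenched_law_0[of V] in eventually_elim)
    fix z :: "nat \<Rightarrow> int" assume "z 0 = 0"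
    then have "recenter (prepend_step d z) = z" by (simp add: recenter_def prepend_step_def fun_eq_iff)
    then show "F (recenter (prepend_step d z)) = F z" by simp
  qed
  then show ?thesis by (subst nn_integral_first_step) (auto simp: env_after_def)
qed

lemma emeasure_first_step:
  "emeasure (quenched_law (\<lambda>_. \<omega>)) {z. z 1 = 1} = ennreal (right_prob (\<omega> 0))"
  "emeasure (quenched_law (\<lambda>_. \<omega>)) {z. z 1 = - 1} = ennreal (1 - right_prob (\<omega> 0))"
proof -
  have *: "(\<integral>\<^sup>+z. indicator {z. z 1 = c} (prepend_step d z) \<partial>quenched_law V) = (if c = d then 1 else 0 :: ennreal)" for c d V
  proof -
    interpret prob_space "quenched_law V" by (rule prob_space_quenched_law)
    have "(\<integral>\<^sup>+z. indicator {z. z 1 = c} (prepend_step d z) \<partial>quenched_law V) = (\<integral>\<^sup>+z. (if c = d then 1 else 0) \<partial>quenched_law V)"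
      by (rule nn_integral_cong_AE) (use quenched_law_0[of V] in \<open>auto elim!: eventually_mono simp: prepend_step_def\<close>)
    then show ?thesis using emeasure_space_1 by simp
  qed
  have sets: "{z. z 1 = c} \<in> sets path_space" for c :: int by (rule path_level_sets)
  have "emeasure (quenched_law (\<lambda>_. \<omega>)) {z. z 1 = c} = (\<integral>\<^sup>+z. indicator {z. z 1 = c} z \<partial>quenched_law (\<lambda>_. \<omega>))" for c
    using sets[of c] by simp
  also have "\<dots> c = ennreal (right_prob (\<omega> 0)) * (if c = 1 then 1 else 0) + ennreal (1 - right_prob (\<omega> 0)) * (if c = - 1 then 1 else 0)" for c
    using nn_integral_first_step[OF borel_measurable_indicator[OF sets[of c]], of "\<lambda>_. \<omega>"] unfolding * .
  finally have e: "emeasure (quenched_law (\<lambda>_. \<omega>)) {z. z 1 = c} = ennreal (right_prob (\<omega> 0)) * (if c = 1 then 1 else 0) + ennreal (1 - right_prob (\<omega> 0)) * (if c = - 1 then 1 else 0)" for c .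
  show "emeasure (quenched_law (\<lambda>_. \<omega>)) {z. z 1 = 1} = ennreal (right_prob (\<omega> 0))"
    "emeasure (quenched_law (\<lambda>_. \<omega>)) {z. z 1 = - 1} = ennreal (1 - right_prob (\<omega> 0))"
    unfolding e by simp_all
qed

text \<open>Since (1 + \<rho>) \<omega> = 1 and (1 + \<rho>) (1 - \<omega>) = \<rho>, with F the
  future weight the inflow from the left is 1 + \<rho>_0 F, and that from the right is \<rho>_1
  times F seen from site 1. By F = 1 + \<rho>_1 F(shifted) they add up to (1 + \<rho>_0) F.\<close>

lemma particle_density_stationary:
  assumes "\<And>x. 0 < \<omega> x \<and> \<omega> x < 1"
  shows "particle_density (\<lambda>x. \<omega> (x - 1)) * ennreal (\<omega> (- 1)) + particle_density (\<lambda>x. \<omega> (x + 1)) * ennreal (1 - \<omega> 1) = particle_density \<omega>"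
proof -
  have r: "0 < \<omega> x" "\<omega> x < 1" "0 < rho (\<omega> x)" for x using assms rho_pos by auto
  have 1: "(1 + ennreal (rho (\<omega> x))) * ennreal (\<omega> x) = 1" for x
  proof -
    have "(1 + ennreal (rho (\<omega> x))) * ennreal (\<omega> x) = ennreal ((1 + rho (\<omega> x)) * \<omega> x)"
      using r[of x] by (simp add: ennreal_mult less_imp_le)
    then show ?thesis using r[of x] by (simp add: rho_def field_simps)
  qed
  have 2: "(1 + ennreal (rho (\<omega> x))) * ennreal (1 - \<omega> x) = ennreal (rho (\<omega> x))" for x
  proof -
    have "(1 + ennreal (rho (\<omega> x))) * ennreal (1 - \<omega> x) = ennreal ((1 + rho (\<omega> x)) * (1 - \<omega> x))"
      using r[of x] by (simp add: ennreal_mult less_imp_le)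
    also have "(1 + rho (\<omega> x)) * (1 - \<omega> x) = rho (\<omega> x)" using r[of x] by (simp add: rho_def field_simps)
    finally show ?thesis .
  qed
  have "particle_density (\<lambda>x. \<omega> (x - 1)) * ennreal (\<omega> (- 1)) = (1 + ennreal (rho (\<omega> (- 1)))) * ennreal (\<omega> (- 1)) * future_weight (\<lambda>x. \<omega> (x - 1))"
    by (simp add: particle_density_def ac_simps)
  also have "\<dots> = 1 + ennreal (rho (\<omega> 0)) * future_weight \<omega>"
    unfolding 1 by (subst future_weight_rec) simp
  finally have a: "particle_density (\<lambda>x. \<omega> (x - 1)) * ennreal (\<omega> (- 1)) = 1 + ennreal (rho (\<omega> 0)) * future_weight \<omega>" .
  have "particle_density (\<lambda>x. \<omega> (x + 1)) * ennreal (1 - \<omega> 1) = (1 + ennreal (rho (\<omega> 1))) * ennreal (1 - \<omega> 1) * future_weight (\<lambda>x. \<omega> (x + 1))"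
    by (simp add: particle_density_def ac_simps)
  also have "\<dots> = ennreal (rho (\<omega> 1)) * future_weight (\<lambda>x. \<omega> (x + 1))" unfolding 2 ..
  finally have b: "particle_density (\<lambda>x. \<omega> (x + 1)) * ennreal (1 - \<omega> 1) = ennreal (rho (\<omega> 1)) * future_weight (\<lambda>x. \<omega> (x + 1))" .
  have "particle_density \<omega> = future_weight \<omega> + ennreal (rho (\<omega> 0)) * future_weight \<omega>"
    by (simp add: particle_density_def distrib_right)
  also have "\<dots> = (1 + ennreal (rho (\<omega> 1)) * future_weight (\<lambda>x. \<omega> (x + 1))) + ennreal (rho (\<omega> 0)) * future_weight \<omega>"
    by (subst (1) future_weight_rec) simp
  finally show ?thesis unfolding a b by (simp add: ac_simps)
qed

text \<open>The factor \<open>c\<close> is kept free: invariance holds for every value, and the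
  total mass is computed only where the normalizing value is inserted.\<close>

definition stationary_law :: "real measure \<Rightarrow> ennreal \<Rightarrow> (nat \<Rightarrow> int) measure" where
  "stationary_law \<alpha> c = density (env_law \<alpha>) (\<lambda>\<omega>. c * particle_density \<omega>) \<bind> (\<lambda>\<omega>. quenched_law (\<lambda>n. \<omega>))"

lemma stationary_kernel:
  assumes "real_distribution \<alpha>"
  shows "(\<lambda>\<omega>. quenched_law (\<lambda>n. \<omega>)) \<in> measurable (density (env_law \<alpha>) f) (subprob_algebra path_space)"
  using measurable_prob_algebraD[OF static_kernel_measurable[OF assms]]
  by (simp add: measurable_cong_sets[OF sets_density refl])

lemma quenched_integral_measurable:
  assumes "real_distribution \<alpha>" "F \<in> borel_measurable path_space"
  shows "(\<lambda>\<omega>. \<integral>\<^sup>+z. F z \<partial>quenched_law (\<lambda>_. \<omega>)) \<in> borel_measurable (env_law \<alpha>)"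
  by (rule measurable_compose[OF measurable_prob_algebraD[OF static_kernel_measurable[OF assms(1)]]
       nn_integral_measurable_subprob_algebra[OF assms(2)]])

lemma nn_integral_stationary_law:
  assumes \<alpha>: "real_distribution \<alpha>" and F: "F \<in> borel_measurable path_space"
  shows "(\<integral>\<^sup>+z. F z \<partial>stationary_law \<alpha> c) = c * (\<integral>\<^sup>+\<omega>. particle_density \<omega> * (\<integral>\<^sup>+z. F z \<partial>quenched_law (\<lambda>_. \<omega>)) \<partial>env_law \<alpha>)"
proof -
  note [measurable] = particle_density_measurable[OF \<alpha>] quenched_integral_measurable[OF \<alpha> F]
  have "(\<integral>\<^sup>+z. F z \<partial>stationary_law \<alpha> c) = (\<integral>\<^sup>+\<omega>. \<integral>\<^sup>+z. F z \<partial>quenched_law (\<lambda>_. \<omega>) \<partial>density (env_law \<alpha>) (\<lambda>\<omega>. c * particle_density \<omega>))"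
    unfolding stationary_law_def by (rule nn_integral_bind[OF F stationary_kernel[OF \<alpha>]])
  also have "\<dots> = (\<integral>\<^sup>+\<omega>. c * (particle_density \<omega> * (\<integral>\<^sup>+z. F z \<partial>quenched_law (\<lambda>_. \<omega>))) \<partial>env_law \<alpha>)"
    by (subst nn_integral_density) (auto simp: ac_simps)
  finally show ?thesis by (subst (asm) nn_integral_cmult) auto
qed

lemma sets_stationary_law:
  assumes "real_distribution \<alpha>"
  shows "sets (stationary_law \<alpha> c) = sets path_space"
proof -
  interpret real_distribution \<alpha> by fact
  have "space (density (env_law \<alpha>) (\<lambda>\<omega>. c * particle_density \<omega>)) \<noteq> {}"
    using prob_space.not_empty[OF prob_space_env_law[OF prob_space_axioms]] by simp
  then show ?thesis unfolding stationary_law_def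
    using sets_kernel[OF stationary_kernel[OF assms]] by (intro sets_bind)
qed

text \<open>The density is strictly positive, so both environment laws have the same null sets. One
  direction brings the upper bound to the stationary law, the other returns the limit to the static
  law.\<close>

lemma AE_stationary_law_iff:
  assumes \<alpha>: "real_distribution \<alpha>" and c: "0 < c" and P: "Measurable.pred path_space P"
  shows "(AE z in stationary_law \<alpha> c. P z) \<longleftrightarrow> (AE z in static_law \<alpha>. P z)"
proof -
  note [measurable] = particle_density_measurable[OF \<alpha>]
  have "0 < c * particle_density \<omega>" for \<omega>
    using c future_weight_ge_1[of \<omega>] less_le_trans[OF zero_less_one future_weight_ge_1[of \<omega>]]
    by (simp add: particle_density_def ennreal_zero_less_mult_iff add_pos_nonneg)
  moreover have "(\<lambda>\<omega>. c * particle_density \<omega>) \<in> borel_measurable (env_law \<alpha>)" by measurable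
  ultimately show ?thesis
    unfolding stationary_law_def static_law_def
      AE_bind[OF stationary_kernel[OF \<alpha>] P] AE_bind[OF measurable_prob_algebraD[OF static_kernel_measurable[OF \<alpha>]] P]
    by (subst AE_density) auto
qed

text \<open>Condition on the first step, then use translation invariance of the product law to move
  the shift from the quenched probability \<open>q\<close> to the density. What remains is the
  stationarity equation, multiplied by \<open>q\<close>.\<close>

lemma distr_stationary_law:
  assumes \<alpha>: "real_distribution \<alpha>" and ae: "AE w in \<alpha>. 0 < w \<and> w < 1"
  shows "distr (stationary_law \<alpha> c) (stationary_law \<alpha> c) recenter = stationary_law \<alpha> c"
proof (rule measure_eqI)
  interpret real_distribution \<alpha> by fact
  fix A assume "A \<in> sets (distr (stationary_law \<alpha> c) (stationary_law \<alpha> c) recenter)"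
  then have A [measurable]: "A \<in> sets path_space" by (simp add: sets_stationary_law[OF \<alpha>])
  have [measurable_cong]: "sets (stationary_law \<alpha> c) = sets path_space" by (rule sets_stationary_law[OF \<alpha>])
  let ?F = "indicator A :: _ \<Rightarrow> ennreal"
  define q where "q \<omega> = (\<integral>\<^sup>+z. ?F z \<partial>quenched_law (\<lambda>_. \<omega>))" for \<omega>
  have q [measurable]: "q \<in> borel_measurable (env_law \<alpha>)"
    unfolding q_def by (rule quenched_integral_measurable[OF \<alpha>]) simp
  have AE: "AE \<omega> in env_law \<alpha>. \<forall>x. 0 < \<omega> x \<and> \<omega> x < 1" by (rule AE_env_law[OF prob_space_axioms ae])
  have sh: "(\<lambda>\<omega>. G (\<lambda>x. \<omega> (f x))) \<in> borel_measurable (env_law \<alpha>)" if "G \<in> borel_measurable (env_law \<alpha>)" for G :: "env \<Rightarrow> ennreal" and f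
    by (rule measurable_compose[OF measurable_env_reindex that])
  let ?d = particle_density
  note pd = particle_density_measurable[OF \<alpha>] and coord = env_coord_measurable[OF \<alpha>]
  have mR: "(\<lambda>\<omega>. ?d (\<lambda>x. \<omega> (x - 1)) * ennreal (\<omega> (- 1)) * q \<omega>) \<in> borel_measurable (env_law \<alpha>)"
    and mL: "(\<lambda>\<omega>. ?d (\<lambda>x. \<omega> (x + 1)) * ennreal (1 - \<omega> 1) * q \<omega>) \<in> borel_measurable (env_law \<alpha>)"
    and mR': "(\<lambda>\<omega>. ?d \<omega> * ennreal (\<omega> 0) * q (\<lambda>x. \<omega> (x + 1))) \<in> borel_measurable (env_law \<alpha>)"
    and mL': "(\<lambda>\<omega>. ?d \<omega> * ennreal (1 - \<omega> 0) * q (\<lambda>x. \<omega> (x - 1))) \<in> borel_measurable (env_law \<alpha>)"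
    by (intro borel_measurable_times_ennreal q pd
          sh[OF q, of "\<lambda>x. x + 1"] sh[OF q, of "\<lambda>x. x - 1"] sh[OF pd, of "\<lambda>x. x + 1"] sh[OF pd, of "\<lambda>x. x - 1"]
          measurable_compose[OF coord measurable_ennreal] measurable_compose[OF borel_measurable_diff[OF borel_measurable_const coord] measurable_ennreal])+
  have "(\<integral>\<^sup>+\<omega>. ?d \<omega> * (\<integral>\<^sup>+z. ?F (recenter z) \<partial>quenched_law (\<lambda>_. \<omega>)) \<partial>env_law \<alpha>) =
      (\<integral>\<^sup>+\<omega>. ?d \<omega> * ennreal (\<omega> 0) * q (\<lambda>x. \<omega> (x + 1)) + ?d \<omega> * ennreal (1 - \<omega> 0) * q (\<lambda>x. \<omega> (x - 1)) \<partial>env_law \<alpha>)"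
  proof (rule nn_integral_cong_AE, use AE in eventually_elim)
    fix \<omega> :: env assume "\<forall>x. 0 < \<omega> x \<and> \<omega> x < 1"
    then have "right_prob (\<omega> 0) = \<omega> 0" by (simp add: right_prob_id)
    then show "?d \<omega> * (\<integral>\<^sup>+z. ?F (recenter z) \<partial>quenched_law (\<lambda>_. \<omega>)) =
        ?d \<omega> * ennreal (\<omega> 0) * q (\<lambda>x. \<omega> (x + 1)) + ?d \<omega> * ennreal (1 - \<omega> 0) * q (\<lambda>x. \<omega> (x - 1))"
      using nn_integral_recenter[of ?F \<omega>] by (simp add: q_def distrib_left ac_simps)
  qed
  also have "\<dots> = (\<integral>\<^sup>+\<omega>. ?d \<omega> * ennreal (\<omega> 0) * q (\<lambda>x. \<omega> (x + 1)) \<partial>env_law \<alpha>) + (\<integral>\<^sup>+\<omega>. ?d \<omega> * ennreal (1 - \<omega> 0) * q (\<lambda>x. \<omega> (x - 1)) \<partial>env_law \<alpha>)"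
    by (rule nn_integral_add[OF mR' mL'])
  also have "(\<integral>\<^sup>+\<omega>. ?d \<omega> * ennreal (\<omega> 0) * q (\<lambda>x. \<omega> (x + 1)) \<partial>env_law \<alpha>) = (\<integral>\<^sup>+\<omega>. ?d (\<lambda>x. \<omega> (x - 1)) * ennreal (\<omega> (- 1)) * q \<omega> \<partial>env_law \<alpha>)"
    using nn_integral_env_reindex[OF prob_space_axioms _ mR, of "\<lambda>x. x + 1"] by (simp add: inj_def)
  also have "(\<integral>\<^sup>+\<omega>. ?d \<omega> * ennreal (1 - \<omega> 0) * q (\<lambda>x. \<omega> (x - 1)) \<partial>env_law \<alpha>) = (\<integral>\<^sup>+\<omega>. ?d (\<lambda>x. \<omega> (x + 1)) * ennreal (1 - \<omega> 1) * q \<omega> \<partial>env_law \<alpha>)"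
    using nn_integral_env_reindex[OF prob_space_axioms _ mL, of "\<lambda>x. x - 1"] by (simp add: inj_def)
  also have "(\<integral>\<^sup>+\<omega>. ?d (\<lambda>x. \<omega> (x - 1)) * ennreal (\<omega> (- 1)) * q \<omega> \<partial>env_law \<alpha>) + (\<integral>\<^sup>+\<omega>. ?d (\<lambda>x. \<omega> (x + 1)) * ennreal (1 - \<omega> 1) * q \<omega> \<partial>env_law \<alpha>)
     = (\<integral>\<^sup>+\<omega>. ?d (\<lambda>x. \<omega> (x - 1)) * ennreal (\<omega> (- 1)) * q \<omega> + ?d (\<lambda>x. \<omega> (x + 1)) * ennreal (1 - \<omega> 1) * q \<omega> \<partial>env_law \<alpha>)"
    by (rule nn_integral_add[OF mR mL, symmetric])
  also have "\<dots> = (\<integral>\<^sup>+\<omega>. ?d \<omega> * q \<omega> \<partial>env_law \<alpha>)"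
  proof (rule nn_integral_cong_AE, use AE in eventually_elim)
    fix \<omega> :: env assume "\<forall>x. 0 < \<omega> x \<and> \<omega> x < 1"
    then show "?d (\<lambda>x. \<omega> (x - 1)) * ennreal (\<omega> (- 1)) * q \<omega> + ?d (\<lambda>x. \<omega> (x + 1)) * ennreal (1 - \<omega> 1) * q \<omega> = ?d \<omega> * q \<omega>"
      using particle_density_stationary[of \<omega>] by (simp flip: distrib_right)
  qed
  finally have *: "(\<integral>\<^sup>+\<omega>. ?d \<omega> * (\<integral>\<^sup>+z. ?F (recenter z) \<partial>quenched_law (\<lambda>_. \<omega>)) \<partial>env_law \<alpha>) = (\<integral>\<^sup>+\<omega>. ?d \<omega> * q \<omega> \<partial>env_law \<alpha>)" .
  have "emeasure (distr (stationary_law \<alpha> c) (stationary_law \<alpha> c) recenter) A = (\<integral>\<^sup>+z. ?F z \<partial>distr (stationary_law \<alpha> c) (stationary_law \<alpha> c) recenter)"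
    by simp
  also have "\<dots> = (\<integral>\<^sup>+z. ?F (recenter z) \<partial>stationary_law \<alpha> c)"
    by (rule nn_integral_distr) auto
  also have "\<dots> = (\<integral>\<^sup>+z. ?F z \<partial>stationary_law \<alpha> c)"
    using * by (simp only: q_def nn_integral_stationary_law[OF \<alpha>] borel_measurable_indicator[OF A]
        measurable_compose[OF recenter_measurable borel_measurable_indicator[OF A]])
  finally show "emeasure (distr (stationary_law \<alpha> c) (stationary_law \<alpha> c) recenter) A = emeasure (stationary_law \<alpha> c) A"
    by simp
qed simp

text \<open>A form of convergence with countable quantifiers only, from which measurability of the
  event follows.\<close>

lemma LIMSEQ_iff_inverse_Suc:
  fixes f :: "nat \<Rightarrow> real"
  shows "(f \<longlonglongrightarrow> v) \<longleftrightarrow> (\<forall>k. \<exists>N. \<forall>n\<ge>N. \<bar>f n - v\<bar> < inverse (real (Suc k)))"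
proof
  assume *: "\<forall>k. \<exists>N. \<forall>n\<ge>N. \<bar>f n - v\<bar> < inverse (real (Suc k))"
  show "f \<longlonglongrightarrow> v"
  proof (rule LIMSEQ_I)
    fix e :: real assume "0 < e"
    then obtain k where k: "inverse (real (Suc k)) < e" using reals_Archimedean by blast
    with * show "\<exists>N. \<forall>n\<ge>N. norm (f n - v) < e" by (metis less_trans real_norm_def)
  qed
next
  assume "f \<longlonglongrightarrow> v"
  from LIMSEQ_D[OF this] show "\<forall>k. \<exists>N. \<forall>n\<ge>N. \<bar>f n - v\<bar> < inverse (real (Suc k))"
    by (simp del: of_nat_Suc)
qed

lemma pred_speed [measurable]: "Measurable.pred path_space (\<lambda>z. (\<lambda>n. real_of_int (z n) / real n) \<longlonglongrightarrow> v)"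
  unfolding LIMSEQ_iff_inverse_Suc by measurable

text \<open>The first step is clipped to [-1, 1] because the ergodic lemmas ask for a bound at every
  point. On paths with unit steps the clipping changes nothing and the sum telescopes.\<close>

lemma recenter_birkhoff_sum:
  assumes "\<forall>n. \<bar>z (Suc n) - z n\<bar> = 1" "z 0 = 0"
  shows "birkhoff_sum recenter (\<lambda>z. max (- 1) (min 1 (real_of_int (z 1)))) n z = real_of_int (z n)"
proof -
  have "max (- 1) (min 1 (real_of_int ((recenter ^^ i) z 1))) = real_of_int (z (Suc i)) - real_of_int (z i)" for i
    using assms(1)[rule_format, of i] assms(2) by (auto simp: recenter_funpow abs_if split: if_splits)
  then have "birkhoff_sum recenter (\<lambda>z. max (- 1) (min 1 (real_of_int (z 1)))) n z = (\<Sum>i<n. real_of_int (z (Suc i)) - real_of_int (z i))"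
    unfolding birkhoff_sum_def by (intro sum.cong) auto
  then show ?thesis using assms(2) sum_lessThan_telescope[of "\<lambda>n. real_of_int (z n)" n] by simp
qed

section \<open>The law of large numbers for the static walk\<close>

lemma static_AE:
  assumes "real_distribution \<alpha>" "Measurable.pred path_space P" "\<And>W. AE z in quenched_law W. P z"
  shows "AE z in static_law \<alpha>. P z"
  unfolding static_law_def AE_bind[OF measurable_prob_algebraD[OF static_kernel_measurable[OF assms(1)]] assms(2)]
  using assms(3) by simp

lemma static_steps:
  assumes "real_distribution \<alpha>"
  shows "AE z in static_law \<alpha>. (\<forall>n. \<bar>z (Suc n) - z n\<bar> = 1) \<and> z 0 = 0"
proof (rule static_AE[OF assms])
  show "AE z in quenched_law W. (\<forall>n. \<bar>z (Suc n) - z n\<bar> = 1) \<and> z 0 = 0" for W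
    using quenched_law_steps[of W] quenched_law_0[of W] by eventually_elim simp
qed measurable

lemma static_speed_positive:
  assumes \<alpha>: "real_distribution \<alpha>" and ae: "AE w in \<alpha>. 0 < w \<and> w < 1"
    and r: "(\<integral>\<^sup>+w. ennreal (rho w) \<partial>\<alpha>) < 1"
  shows "\<exists>v. AE z in static_law \<alpha>. (\<lambda>n. real_of_int (z n) / real n) \<longlonglongrightarrow> v"
proof -
  interpret real_distribution \<alpha> by fact
  have AE: "AE \<omega> in env_law \<alpha>. \<forall>x. 0 < \<omega> x \<and> \<omega> x < 1" by (rule AE_env_law[OF prob_space_axioms ae])
  note [measurable] = particle_density_measurable[OF \<alpha>] env_coord_measurable[OF \<alpha>] future_weight_measurable[OF \<alpha>]
  define q where "q = enn2real (\<integral>\<^sup>+w. ennreal (rho w) \<partial>\<alpha>)"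
  have rq: "(\<integral>\<^sup>+w. ennreal (rho w) \<partial>\<alpha>) = ennreal q"
    using less_trans[OF r ennreal_one_less_top] unfolding q_def by simp
  have q: "0 \<le> q" "q < 1" using r unfolding rq by (auto simp: q_def ennreal_less_iff simp flip: ennreal_1)
  have geo: "(\<Sum>j. ennreal q ^ j) = ennreal (1 / (1 - q))"
    using q by (simp add: ennreal_power suminf_ennreal2 suminf_geometric summable_geometric)
  \<comment> \<open>The mean of \<open>particle_density\<close> is (1 + q) / (1 - q), so the
    normalizing constant and the speed are the same number.\<close>
  define v where "v = (1 - q) / (1 + q)"
  have v: "0 < v" "v \<le> 1" using q by (auto simp: v_def)
  define Mst where "Mst = stationary_law \<alpha> (ennreal v)"
  have [measurable_cong]: "sets Mst = sets path_space" unfolding Mst_def by (rule sets_stationary_law[OF \<alpha>])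
  have W: "(\<integral>\<^sup>+\<omega>. F (\<omega> 0) * future_weight \<omega> \<partial>env_law \<alpha>) = (\<integral>\<^sup>+w. F w \<partial>\<alpha>) * ennreal (1 / (1 - q))"
    if "F \<in> borel_measurable borel" for F
    using nn_integral_mult_future_weight[OF \<alpha> that] unfolding rq geo .
  have wr: "ennreal w * (1 + ennreal (rho w)) = 1" "ennreal (1 - w) * (1 + ennreal (rho w)) = ennreal (rho w)"
    if "0 < w" "w < 1" for w
  proof -
    have "ennreal w * (1 + ennreal (rho w)) = ennreal (w * (1 + rho w))"
      using that rho_pos[OF that] by (simp add: ennreal_mult less_imp_le)
    also have "w * (1 + rho w) = 1" using that by (simp add: rho_def field_simps)
    finally show "ennreal w * (1 + ennreal (rho w)) = 1" by simp
    have "ennreal (1 - w) * (1 + ennreal (rho w)) = ennreal ((1 - w) * (1 + rho w))"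
      using that rho_pos[OF that] by (simp add: ennreal_mult less_imp_le)
    also have "(1 - w) * (1 + rho w) = rho w" using that by (simp add: rho_def field_simps)
    finally show "ennreal (1 - w) * (1 + ennreal (rho w)) = ennreal (rho w)" .
  qed
  have p1: "emeasure Mst {z. z 1 = 1} = ennreal (v / (1 - q))"
    and p2: "emeasure Mst {z. z 1 = - 1} = ennreal (v * q / (1 - q))"
  proof -
    have S: "{z. z 1 = c} \<in> sets path_space" for c :: int by (rule path_level_sets)
    have "emeasure Mst {z. z 1 = c} = ennreal v * (\<integral>\<^sup>+\<omega>. particle_density \<omega> * emeasure (quenched_law (\<lambda>_. \<omega>)) {z. z 1 = c} \<partial>env_law \<alpha>)" for c
      using nn_integral_stationary_law[OF \<alpha> borel_measurable_indicator[OF S[of c]], of "ennreal v"] S[of c] sets_stationary_law[OF \<alpha>]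
      by (simp add: Mst_def)
    note e = this
    have "(\<integral>\<^sup>+\<omega>. particle_density \<omega> * emeasure (quenched_law (\<lambda>_. \<omega>)) {z. z 1 = 1} \<partial>env_law \<alpha>) = (\<integral>\<^sup>+\<omega>. (\<lambda>_. 1) (\<omega> 0) * future_weight \<omega> \<partial>env_law \<alpha>)"
    proof (rule nn_integral_cong_AE, use AE in eventually_elim)
      fix \<omega> :: env assume "\<forall>x. 0 < \<omega> x \<and> \<omega> x < 1"
      then have w: "0 < \<omega> 0" "\<omega> 0 < 1" by auto
      have "particle_density \<omega> * ennreal (\<omega> 0) = (ennreal (\<omega> 0) * (1 + ennreal (rho (\<omega> 0)))) * future_weight \<omega>"
        by (simp add: particle_density_def ac_simps)
      then show "particle_density \<omega> * emeasure (quenched_law (\<lambda>_. \<omega>)) {z. z 1 = 1} = (\<lambda>_. 1) (\<omega> 0) * future_weight \<omega>"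
        unfolding emeasure_first_step right_prob_id[OF w] wr(1)[OF w] by simp
    qed
    also have "\<dots> = ennreal (1 / (1 - q))" by (subst W) (use emeasure_space_1 in auto)
    finally show "emeasure Mst {z. z 1 = 1} = ennreal (v / (1 - q))"
      unfolding e using v q by (simp add: ennreal_mult[symmetric])
    have "(\<integral>\<^sup>+\<omega>. particle_density \<omega> * emeasure (quenched_law (\<lambda>_. \<omega>)) {z. z 1 = - 1} \<partial>env_law \<alpha>) = (\<integral>\<^sup>+\<omega>. (\<lambda>w. ennreal (rho w)) (\<omega> 0) * future_weight \<omega> \<partial>env_law \<alpha>)"
    proof (rule nn_integral_cong_AE, use AE in eventually_elim)
      fix \<omega> :: env assume "\<forall>x. 0 < \<omega> x \<and> \<omega> x < 1"
      then have w: "0 < \<omega> 0" "\<omega> 0 < 1" by auto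
      have "particle_density \<omega> * ennreal (1 - \<omega> 0) = (ennreal (1 - \<omega> 0) * (1 + ennreal (rho (\<omega> 0)))) * future_weight \<omega>"
        by (simp add: particle_density_def ac_simps)
      then show "particle_density \<omega> * emeasure (quenched_law (\<lambda>_. \<omega>)) {z. z 1 = - 1} = (\<lambda>w. ennreal (rho w)) (\<omega> 0) * future_weight \<omega>"
        unfolding emeasure_first_step right_prob_id[OF w] wr(2)[OF w] by simp
    qed
    also have "\<dots> = ennreal q * ennreal (1 / (1 - q))" unfolding rq[symmetric] by (rule W) measurable
    finally show "emeasure Mst {z. z 1 = - 1} = ennreal (v * q / (1 - q))"
      unfolding e using v q by (simp add: ennreal_mult[symmetric])
  qed
  have steps: "AE z in Mst. (\<forall>n. \<bar>z (Suc n) - z n\<bar> = 1) \<and> z 0 = 0"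
    unfolding Mst_def using v static_steps[OF \<alpha>] by (subst AE_stationary_law_iff[OF \<alpha>]) auto
  have S1: "{z. z 1 = c} \<in> sets Mst" for c :: int using path_level_sets[of "\<lambda>x. x = c" 1] by (simp add: sets_stationary_law[OF \<alpha>] Mst_def)
  \<comment> \<open>The first step is 1 or -1 almost surely, so the two probabilities just found
    give the total mass; that it is 1 confirms the normalization.\<close>
  have "emeasure Mst (space Mst) = emeasure Mst ({z. z 1 = 1} \<union> {z. z 1 = - 1})"
  proof (rule emeasure_eq_AE)
    show "AE z in Mst. (z \<in> space Mst) = (z \<in> {z. z 1 = 1} \<union> {z. z 1 = - 1})"
      using steps AE_space
    proof eventually_elim
      fix z assume "(\<forall>n. \<bar>z (Suc n) - z n\<bar> = 1) \<and> z 0 = 0" "z \<in> space Mst"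
      then have "\<bar>z 1\<bar> = 1" by (metis One_nat_def diff_zero)
      then show "(z \<in> space Mst) = (z \<in> {z. z 1 = 1} \<union> {z. z 1 = - 1})" using \<open>z \<in> space Mst\<close> by auto
    qed
  qed (use S1 in auto)
  also have "\<dots> = ennreal (v / (1 - q)) + ennreal (v * q / (1 - q))"
    unfolding p1[symmetric] p2[symmetric] by (rule plus_emeasure[symmetric]) (use S1 in auto)
  also have "\<dots> = ennreal (v / (1 - q) + v * q / (1 - q))" using v q by (subst ennreal_plus) auto
  also have "v / (1 - q) + v * q / (1 - q) = 1"
  proof -
    have "v * (1 + q) = 1 - q" using q by (simp add: v_def)
    then have "v + v * q = 1 - q" by (simp add: distrib_left)
    then show ?thesis using q by (simp add: add_divide_distrib[symmetric])
  qed
  finally interpret P: prob_space Mst by (intro prob_spaceI) simp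
  let ?D = "\<lambda>z :: nat \<Rightarrow> int. max (- 1) (min 1 (real_of_int (z 1)))"
  have D: "?D \<in> borel_measurable Mst"
    using measurable_compose[OF measurable_path_coord[of 1], of "\<lambda>x. max (- 1) (min 1 (real_of_int x))" borel]
    by (simp add: Mst_def measurable_cong_sets[OF sets_stationary_law[OF \<alpha>] refl])
  have sums: "AE z in Mst. \<forall>n. birkhoff_sum recenter ?D n z = real_of_int (z n)"
    using steps by eventually_elim (intro allI recenter_birkhoff_sum; simp)
  have "AE z in Mst. (\<lambda>n. birkhoff_sum recenter ?D n z / real n) \<longlonglongrightarrow> v"
  proof (rule P.birkhoff_average_tendsto)
    show "recenter \<in> measurable Mst Mst" by measurable
    show "distr Mst Mst recenter = Mst" unfolding Mst_def by (rule distr_stationary_law[OF \<alpha> ae])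
    show "?D \<in> borel_measurable Mst" by (rule D)
    show "\<bar>?D z\<bar> \<le> 1" for z by (auto simp: abs_if max_def min_def)
    have "(\<integral>z. ?D z \<partial>Mst) = (\<integral>z. indicator {z. z 1 = 1} z - indicator {z. z 1 = - 1} z \<partial>Mst)"
    proof (rule integral_cong_AE)
      show "AE z in Mst. ?D z = indicator {z. z 1 = 1} z - indicator {z. z 1 = - 1} z"
        using steps
      proof eventually_elim
        fix z :: "nat \<Rightarrow> int" assume "(\<forall>n. \<bar>z (Suc n) - z n\<bar> = 1) \<and> z 0 = 0"
        then have "\<bar>z 1\<bar> = 1" by (metis One_nat_def diff_zero)
        then have "z 1 = 1 \<or> z 1 = - 1" by linarith
        then show "?D z = indicator {z. z 1 = 1} z - indicator {z. z 1 = - 1} z" by auto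
      qed
    qed (intro D borel_measurable_diff borel_measurable_indicator S1)+
    also have "\<dots> = measure Mst {z. z 1 = 1} - measure Mst {z. z 1 = - 1}"
      using S1 by (subst Bochner_Integration.integral_diff) (auto simp: P.emeasure_eq_measure intro!: integrable_real_indicator)
    also have "\<dots> = v / (1 - q) - v * q / (1 - q)" using p1 p2 v q by (simp add: measure_def)
    also have "\<dots> = v * (1 - q) / (1 - q)" by (simp add: diff_divide_distrib right_diff_distrib)
    also have "\<dots> = v" using q by simp
    finally show "v \<le> (\<integral>z. ?D z \<partial>Mst)" by simp
    fix u assume u: "v < u"
    have "1 / u < 1 / v" using u v by (simp add: frac_less2)
    \<comment> \<open>The mean crossing times increase to 1 / v, so for u > v a finite j already
      exceeds 1 / u.\<close>
    have "(\<lambda>j. (1 + q) * (\<Sum>i\<le>j. q ^ i)) \<longlonglongrightarrow> (1 + q) * (1 / (1 - q))"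
      using geometric_sums[of q] q by (intro tendsto_mult_left) (simp add: sums_def_le)
    also have "(1 + q) * (1 / (1 - q)) = 1 / v" using q by (simp add: v_def)
    finally have "\<forall>\<^sub>F j in sequentially. 1 / u < (1 + q) * (\<Sum>i\<le>j. q ^ i)"
      using \<open>1 / u < 1 / v\<close> by (rule order_tendstoD)
    then obtain j where j: "1 / u < (1 + q) * (\<Sum>i\<le>j. q ^ i)" by (auto simp: eventually_sequentially)
    have "ennreal (1 / u) < ennreal ((1 + q) * (\<Sum>i\<le>j. q ^ i))"
      using j u v by (subst ennreal_less_iff) auto
    also have "\<dots> = (1 + ennreal q) * (\<Sum>i\<le>j. ennreal q ^ i)"
      using q by (simp add: ennreal_mult sum_nonneg ennreal_power sum_ennreal)
    finally have "summable (\<lambda>n. measure (static_law \<alpha>) {z. u * real n \<le> real_of_int (z n)})"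
      using u v by (intro summable_static_exceed[OF \<alpha> ae, of u j]) (auto simp: rq)
    then have "AE z in static_law \<alpha>. \<forall>\<^sub>F n in sequentially. real_of_int (z n) < u * real n"
      using static_eventually_of_summable[OF \<alpha>, of "\<lambda>n x. u * real n \<le> real_of_int x"] by (simp add: not_le)
    moreover have "Measurable.pred path_space (\<lambda>z. \<forall>\<^sub>F n in sequentially. real_of_int (z n) < u * real n)"
      unfolding eventually_sequentially by measurable
    ultimately have "AE z in Mst. \<forall>\<^sub>F n in sequentially. real_of_int (z n) < u * real n"
      unfolding Mst_def using v by (subst AE_stationary_law_iff[OF \<alpha>]) auto
    then show "AE z in Mst. \<forall>\<^sub>F n in sequentially. birkhoff_sum recenter ?D n z < u * real n"
      using sums by eventually_elim (simp only:)
  qed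
  then have "AE z in Mst. (\<lambda>n. real_of_int (z n) / real n) \<longlonglongrightarrow> v"
    using sums by eventually_elim (simp only:)
  then show ?thesis
    unfolding Mst_def using v pred_speed[of v] by (subst (asm) AE_stationary_law_iff[OF \<alpha>]) auto
qed

text \<open>The definite description in \<open>rwre_speed\<close> denotes the limit because an
  almost sure constant limit is unique under a probability measure.\<close>

lemma static_speed:
  assumes \<alpha>: "real_distribution \<alpha>" and ae: "AE w in \<alpha>. 0 < w \<and> w < 1"
    and log: "ext_expectation \<alpha> (\<lambda>w. ln (rho w)) \<le> 0"
  shows "AE z in static_law \<alpha>. (\<lambda>n. real_of_int (z n) / real n) \<longlonglongrightarrow> rwre_speed \<alpha>"
proof -
  interpret prob_space "static_law \<alpha>" by (rule prob_space_static_law[OF \<alpha>])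
  obtain v where v: "AE z in static_law \<alpha>. (\<lambda>n. real_of_int (z n) / real n) \<longlonglongrightarrow> v"
    using static_speed_positive[OF \<alpha> ae] static_speed_zero[OF \<alpha> ae log] not_le by blast
  show ?thesis unfolding rwre_speed_def
  proof (rule theI2)
    fix u assume u: "AE z in static_law \<alpha>. (\<lambda>n. real_of_int (z n) / real n) \<longlonglongrightarrow> u"
    have "AE z in static_law \<alpha>. u = v"
      using u v by eventually_elim (rule LIMSEQ_unique)
    then show "u = v" using AE_const by auto
  qed (use v in auto)
qed

subsection \<open>The cooling walk\<close>

lemma epoch_eq:
  assumes "strict_mono \<tau>" "\<tau> k \<le> n" "n < \<tau> (Suc k)"
  shows "epoch \<tau> n = k"
  unfolding epoch_def
proof (rule the_equality)
  fix j assume j: "\<tau> j \<le> n \<and> n < \<tau> (Suc j)"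
  have "j < Suc k" using j assms by (meson le_less_trans strict_mono_less)
  moreover have "k < Suc j" using j assms by (meson le_less_trans strict_mono_less)
  ultimately show "j = k" by simp
qed (use assms in auto)

lemma epoch_exists:
  assumes "strict_mono \<tau>" "\<tau> 0 = (0 :: nat)"
  obtains k where "\<tau> k \<le> n" "n < \<tau> (Suc k)"
proof -
  have "\<exists>k. \<tau> k \<le> n \<and> n < \<tau> (Suc k)"
  proof (induction n)
    case 0
    have "\<tau> 0 < \<tau> (Suc 0)" using assms(1) by (simp add: strict_mono_def)
    then show ?case using assms(2) by auto
  next
    case (Suc n)
    then obtain k where k: "\<tau> k \<le> n" "n < \<tau> (Suc k)" by auto
    have "\<tau> (Suc k) < \<tau> (Suc (Suc k))" using assms(1) by (simp add: strict_mono_def)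
    with k show ?case by (cases "Suc n < \<tau> (Suc k)") (auto intro: exI[of _ k] exI[of _ "Suc k"])
  qed
  then show ?thesis using that by blast
qed

lemma epoch_less:
  assumes "strict_mono \<tau>" "\<tau> 0 = 0" "n < \<tau> k"
  shows "epoch \<tau> n < k"
proof -
  obtain j where j: "\<tau> j \<le> n" "n < \<tau> (Suc j)" using epoch_exists[OF assms(1,2)] .
  then have "j < k" using assms by (meson le_less_trans strict_mono_less)
  then show ?thesis using epoch_eq[OF assms(1) j] by simp
qed

lemma cooling_kernel_measurable:
  assumes "real_distribution \<alpha>"
  shows "(\<lambda>\<eta>. quenched_law (\<lambda>n. \<eta> (epoch \<tau> n))) \<in> measurable (\<Pi>\<^sub>M k\<in>UNIV. env_law \<alpha>) (prob_algebra path_space)"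
proof -
  interpret real_distribution \<alpha> by fact
  have "quenched_law \<in> measurable (\<Pi>\<^sub>M n\<in>UNIV. env_law \<alpha>) (prob_algebra path_space)"
    unfolding env_law_def by (intro measurable_quenched_law) simp
  moreover have "(\<lambda>\<eta> n. \<eta> (epoch \<tau> n)) \<in> measurable (\<Pi>\<^sub>M k\<in>UNIV. env_law \<alpha>) (\<Pi>\<^sub>M n\<in>UNIV. env_law \<alpha>)"
    by (rule measurable_PiM_single') (auto simp: space_PiM)
  ultimately show ?thesis by (rule measurable_compose[rotated])
qed

lemma nn_integral_rwcre_law:
  assumes \<alpha>: "real_distribution \<alpha>" and F: "F \<in> borel_measurable path_space"
  shows "(\<integral>\<^sup>+z. F z \<partial>rwcre_law \<alpha> \<tau>) = (\<integral>\<^sup>+\<eta>. \<integral>\<^sup>+z. F z \<partial>quenched_law (\<lambda>n. \<eta> (epoch \<tau> n)) \<partial>(\<Pi>\<^sub>M k\<in>UNIV. env_law \<alpha>))"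
proof -
  interpret real_distribution \<alpha> by fact
  let ?E = "\<Pi>\<^sub>M k\<in>(UNIV :: nat set). env_law \<alpha>"
  have Q: "quenched_law \<in> measurable ?E (subprob_algebra path_space)"
    unfolding env_law_def by (rule measurable_prob_algebraD) (intro measurable_quenched_law, simp)
  have R: "(\<lambda>\<eta> n. \<eta> (epoch \<tau> n)) \<in> measurable ?E ?E"
    by (rule measurable_PiM_single') (auto simp: space_PiM)
  have sets: "sets (cooling_env_law \<alpha> \<tau>) = sets ?E" by (simp add: cooling_env_law_def)
  have "(\<integral>\<^sup>+z. F z \<partial>rwcre_law \<alpha> \<tau>) = (\<integral>\<^sup>+W. \<integral>\<^sup>+z. F z \<partial>quenched_law W \<partial>cooling_env_law \<alpha> \<tau>)"
    unfolding rwcre_law_def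
    by (rule nn_integral_bind[OF F]) (use Q in \<open>simp add: measurable_cong_sets[OF sets refl]\<close>)
  also have "\<dots> = (\<integral>\<^sup>+\<eta>. \<integral>\<^sup>+z. F z \<partial>quenched_law (\<lambda>n. \<eta> (epoch \<tau> n)) \<partial>?E)"
    unfolding cooling_env_law_def
    by (rule nn_integral_distr[OF R])
      (simp add: measurable_compose[OF Q nn_integral_measurable_subprob_algebra[OF F]])
  finally show ?thesis .
qed

text \<open>A sum over the possible values of X in place of conditioning on X. It separates the
  position at the start of an epoch from the environment drawn there.\<close>

lemma nn_integral_count_split:
  fixes H :: "int \<Rightarrow> ennreal"
  assumes "X \<in> measurable M (count_space UNIV)"
  shows "(\<integral>\<^sup>+z. H (X z) \<partial>M) = (\<integral>\<^sup>+y. H y * (\<integral>\<^sup>+z. indicator {y} (X z) \<partial>M) \<partial>count_space UNIV)"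
proof -
  have m: "(\<lambda>z. indicator {y} (X z) :: ennreal) \<in> borel_measurable M" for y
    by (rule measurable_compose[OF assms]) simp
  have "(\<integral>\<^sup>+z. H (X z) \<partial>M) = (\<integral>\<^sup>+z. \<integral>\<^sup>+y. H y * indicator {y} (X z) \<partial>count_space UNIV \<partial>M)"
  proof (rule nn_integral_cong)
    fix z
    have "(\<integral>\<^sup>+y. H y * indicator {y} (X z) \<partial>count_space UNIV) = (\<integral>\<^sup>+y. H y * indicator {X z} y \<partial>count_space UNIV)"
      by (intro nn_integral_cong) (auto simp: indicator_def)
    then show "H (X z) = (\<integral>\<^sup>+y. H y * indicator {y} (X z) \<partial>count_space UNIV)"
      by (simp add: nn_integral_indicator_singleton)
  qed
  also have "\<dots> = (\<integral>\<^sup>+y. \<integral>\<^sup>+z. H y * indicator {y} (X z) \<partial>M \<partial>count_space UNIV)"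
    by (rule nn_integral_count_space_nn_integral) (auto intro: borel_measurable_times_ennreal m)
  also have "\<dots> = (\<integral>\<^sup>+y. H y * (\<integral>\<^sup>+z. indicator {y} (X z) \<partial>M) \<partial>count_space UNIV)"
    by (intro nn_integral_cong nn_integral_cmult m)
  finally show ?thesis .
qed

text \<open>The position at time \<tau>(k) depends on the environments before epoch k only, hence is
  independent of the one drawn then; by translation invariance the latter looks the same from every
  position. Single increments suffice, as the L1 norms will simply be added.\<close>

lemma nn_integral_rwcre_increment:
  assumes \<alpha>: "real_distribution \<alpha>" and \<tau>: "strict_mono \<tau>" "\<tau> 0 = 0" and t: "\<tau> k + t \<le> \<tau> (Suc k)"
  shows "(\<integral>\<^sup>+z. g (z (\<tau> k + t) - z (\<tau> k)) \<partial>rwcre_law \<alpha> \<tau>) = (\<integral>\<^sup>+z. g (z t) \<partial>static_law \<alpha>)"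
proof -
  interpret real_distribution \<alpha> by fact
  let ?E = "\<Pi>\<^sub>M k\<in>(UNIV :: nat set). env_law \<alpha>"
  let ?W = "\<lambda>\<eta> n. \<eta> (epoch \<tau> n) :: env"
  have pe: "prob_space (env_law \<alpha>)" by (rule prob_space_env_law) (rule prob_space_axioms)
  interpret E: prob_space ?E by (rule prob_space_PiM) (rule pe)
  have mg: "(\<lambda>z. g (z n)) \<in> borel_measurable path_space" for n
    by (rule measurable_compose[OF measurable_path_coord]) simp
  have mi: "(\<lambda>z. indicator {y} (z n) :: ennreal) \<in> borel_measurable path_space" for n and y :: int
    by (rule measurable_compose[OF measurable_path_coord]) simp
  have md: "(\<lambda>z. g (z n - z m)) \<in> borel_measurable path_space" for n m by measurable
  define H where "H \<omega> = (\<integral>\<^sup>+z. g (z t) \<partial>quenched_law (\<lambda>_. \<omega>))" for \<omega>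
  have H: "H \<in> borel_measurable (env_law \<alpha>)"
    unfolding H_def by (rule quenched_integral_measurable[OF \<alpha> mg])
  \<comment> \<open>The quenched mean over the epoch when the walk starts it at y; below,
    \<open>p y\<close> is the quenched probability of that start.\<close>
  define h where "h y \<omega> = H (\<lambda>x. \<omega> (x + y))" for y \<omega>
  have h: "h y \<in> borel_measurable (env_law \<alpha>)" for y
    unfolding h_def by (rule measurable_compose[OF measurable_env_reindex H])
  define p where "p y \<eta> = (\<integral>\<^sup>+z. indicator {y} (z (\<tau> k)) \<partial>quenched_law (?W \<eta>))" for y :: int and \<eta>
  have p: "p y \<in> borel_measurable ?E" for y
    unfolding p_def
    by (rule measurable_compose[OF measurable_prob_algebraD[OF cooling_kernel_measurable[OF \<alpha>]]
         nn_integral_measurable_subprob_algebra[OF mi]])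
  have coord: "(\<lambda>\<eta>. \<eta> k) \<in> measurable ?E (env_law \<alpha>)" by simp
  have hk: "(\<lambda>\<eta>. h y (\<eta> k)) \<in> borel_measurable ?E" for y by (rule measurable_compose[OF coord h])
  have quenched: "(\<integral>\<^sup>+z. g (z (\<tau> k + t) - z (\<tau> k)) \<partial>quenched_law (?W \<eta>)) = (\<integral>\<^sup>+y. h y (\<eta> k) * p y \<eta> \<partial>count_space UNIV)" for \<eta>
  proof -
    have "(\<integral>\<^sup>+z. g (z (\<tau> k + t) - z (\<tau> k)) \<partial>quenched_law (?W \<eta>)) =
       (\<integral>\<^sup>+z. (\<integral>\<^sup>+y. g (y t) \<partial>quenched_law (\<lambda>n x. ?W \<eta> (\<tau> k + n) (x + z (\<tau> k)))) \<partial>quenched_law (?W \<eta>))"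
      using nn_integral_markov[where a = "\<tau> k" and W = "?W \<eta>", OF mg[of t]] .
    also have "\<dots> = (\<integral>\<^sup>+z. h (z (\<tau> k)) (\<eta> k) \<partial>quenched_law (?W \<eta>))"
    proof (rule nn_integral_cong)
      fix z :: "nat \<Rightarrow> int"
      have "epoch \<tau> (\<tau> k + n) = k" if "n < t" for n
        by (rule epoch_eq[OF \<tau>(1)]) (use that t in auto)
      then show "(\<integral>\<^sup>+y. g (y t) \<partial>quenched_law (\<lambda>n x. ?W \<eta> (\<tau> k + n) (x + z (\<tau> k)))) = h (z (\<tau> k)) (\<eta> k)"
        unfolding h_def H_def by (intro quenched_law_local) simp
    qed
    also have "\<dots> = (\<integral>\<^sup>+y. h y (\<eta> k) * p y \<eta> \<partial>count_space UNIV)"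
      unfolding p_def by (rule nn_integral_count_split) measurable
    finally show ?thesis .
  qed
  have hE: "(\<integral>\<^sup>+\<eta>. h y (\<eta> k) \<partial>?E) = (\<integral>\<^sup>+z. g (z t) \<partial>static_law \<alpha>)" for y
  proof -
    have "(\<integral>\<^sup>+\<eta>. h y (\<eta> k) \<partial>?E) = (\<integral>\<^sup>+\<omega>. h y \<omega> \<partial>distr ?E (env_law \<alpha>) (\<lambda>\<eta>. \<eta> k))"
      by (rule nn_integral_distr[OF coord, symmetric]) (simp add: h)
    also have "distr ?E (env_law \<alpha>) (\<lambda>\<eta>. \<eta> k) = env_law \<alpha>"
      using distr_PiM_component[of UNIV "\<lambda>_. env_law \<alpha>" k] pe by simp
    also have "(\<integral>\<^sup>+\<omega>. h y \<omega> \<partial>env_law \<alpha>) = (\<integral>\<^sup>+\<omega>. H \<omega> \<partial>env_law \<alpha>)"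
      unfolding h_def by (rule nn_integral_env_reindex[OF prob_space_axioms _ H]) (simp add: inj_def)
    finally show ?thesis unfolding H_def using nn_integral_static_law[OF \<alpha> mg] by simp
  qed
  have "(\<integral>\<^sup>+z. g (z (\<tau> k + t) - z (\<tau> k)) \<partial>rwcre_law \<alpha> \<tau>) = (\<integral>\<^sup>+\<eta>. \<integral>\<^sup>+y. h y (\<eta> k) * p y \<eta> \<partial>count_space UNIV \<partial>?E)"
    unfolding nn_integral_rwcre_law[OF \<alpha> md] quenched ..
  also have "\<dots> = (\<integral>\<^sup>+y. \<integral>\<^sup>+\<eta>. h y (\<eta> k) * p y \<eta> \<partial>?E \<partial>count_space UNIV)"
    by (rule nn_integral_count_space_nn_integral) (auto intro: borel_measurable_times_ennreal hk p)
  also have "\<dots> = (\<integral>\<^sup>+y. (\<integral>\<^sup>+\<eta>. h y (\<eta> k) \<partial>?E) * (\<integral>\<^sup>+\<eta>. p y \<eta> \<partial>?E) \<partial>count_space UNIV)"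
  \<comment> \<open>All times before \<tau>(k) lie in epochs with index below k, so
    \<open>p y\<close> and \<open>h y\<close> read disjoint sets of environments.\<close>
  proof (rule nn_integral_cong, rule nn_integral_PiM_indep[where I = "{k}" and J = "{..<k}"])
    fix y and \<eta> \<eta>' :: "nat \<Rightarrow> env" assume eq: "\<And>i. i \<in> {..<k} \<Longrightarrow> \<eta> i = \<eta>' i"
    show "p y \<eta> = p y \<eta>'"
      unfolding p_def by (rule quenched_law_local) (use eq epoch_less[OF \<tau>] in auto)
  qed (use pe hk p in auto)
  also have "\<dots> = (\<integral>\<^sup>+z. g (z t) \<partial>static_law \<alpha>) * (\<integral>\<^sup>+y. (\<integral>\<^sup>+\<eta>. p y \<eta> \<partial>?E) \<partial>count_space UNIV)"
    unfolding hE by (rule nn_integral_cmult) simp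
  also have "(\<integral>\<^sup>+y. (\<integral>\<^sup>+\<eta>. p y \<eta> \<partial>?E) \<partial>count_space UNIV) = (\<integral>\<^sup>+\<eta>. (\<integral>\<^sup>+y. p y \<eta> \<partial>count_space UNIV) \<partial>?E)"
    by (rule nn_integral_count_space_nn_integral[symmetric]) (auto intro: p)
  also have "\<dots> = 1"
  proof -
    have "(\<integral>\<^sup>+y. p y \<eta> \<partial>count_space UNIV) = 1" for \<eta>
    proof -
      interpret Q: prob_space "quenched_law (?W \<eta>)" by (rule prob_space_quenched_law)
      have "(\<lambda>z. z (\<tau> k)) \<in> measurable (quenched_law (?W \<eta>)) (count_space UNIV)" by measurable
      from nn_integral_count_split[OF this, of "\<lambda>_. 1"] show ?thesis
        using Q.emeasure_space_1 by (simp add: p_def)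
    qed
    then show ?thesis using E.emeasure_space_1 by simp
  qed
  finally show ?thesis by simp
qed

text \<open>The o(t) estimate in a form that adds up over epochs and holds for every t, short or
  interrupted epochs included: the parts \<delta> t sum to \<delta> n, and each epoch pays C once.
  Since |Z_t| \<le> t, dominated convergence gives the L1 limit.\<close>

lemma static_deviation_bound:
  assumes \<alpha>: "real_distribution \<alpha>" and v: "AE z in static_law \<alpha>. (\<lambda>n. real_of_int (z n) / real n) \<longlonglongrightarrow> v"
    and \<delta>: "0 < \<delta>"
  obtains C where "0 \<le> C" "\<And>t. (\<integral>\<^sup>+z. ennreal \<bar>real_of_int (z t) - v * real t\<bar> \<partial>static_law \<alpha>) \<le> ennreal (\<delta> * real t + C)"
proof -
  interpret prob_space "static_law \<alpha>" by (rule prob_space_static_law[OF \<alpha>])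
  have [measurable_cong]: "sets (static_law \<alpha>) = sets path_space" by (rule sets_static_law[OF \<alpha>])
  have dist: "AE z in static_law \<alpha>. \<forall>t. \<bar>real_of_int (z t) - v * real t\<bar> \<le> real t * (1 + \<bar>v\<bar>)"
    using static_steps[OF \<alpha>]
  proof eventually_elim
    fix z :: "nat \<Rightarrow> int" assume z: "(\<forall>n. \<bar>z (Suc n) - z n\<bar> = 1) \<and> z 0 = 0"
    have zt: "\<bar>z t\<bar> \<le> int t" for t
    proof (induction t)
      case (Suc t)
      have "\<bar>z (Suc t) - z t\<bar> = 1" using z by blast
      with Suc show ?case by simp
    qed (use z in simp)
    show "\<forall>t. \<bar>real_of_int (z t) - v * real t\<bar> \<le> real t * (1 + \<bar>v\<bar>)"
    proof
      fix t
      have "\<bar>real_of_int (z t)\<bar> \<le> real t" using zt[of t] by linarith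
      moreover have "\<bar>v * real t\<bar> = real t * \<bar>v\<bar>" by (simp add: abs_mult)
      ultimately show "\<bar>real_of_int (z t) - v * real t\<bar> \<le> real t * (1 + \<bar>v\<bar>)"
        unfolding distrib_left by linarith
    qed
  qed
  have "(\<lambda>t. \<integral>z. \<bar>real_of_int (z t) / real t - v\<bar> \<partial>static_law \<alpha>) \<longlonglongrightarrow> (\<integral>z. 0 \<partial>static_law \<alpha>)"
  proof (rule integral_dominated_convergence[where w = "\<lambda>_. 1 + \<bar>v\<bar>"])
    show "AE z in static_law \<alpha>. (\<lambda>t. \<bar>real_of_int (z t) / real t - v\<bar>) \<longlonglongrightarrow> 0"
      using v by eventually_elim (auto intro: tendsto_rabs_zero simp: LIM_zero_iff)
    show "AE z in static_law \<alpha>. norm \<bar>real_of_int (z t) / real t - v\<bar> \<le> 1 + \<bar>v\<bar>" for t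
      using dist
    proof eventually_elim
      fix z :: "nat \<Rightarrow> int" assume *: "\<forall>t. \<bar>real_of_int (z t) - v * real t\<bar> \<le> real t * (1 + \<bar>v\<bar>)"
      show "norm \<bar>real_of_int (z t) / real t - v\<bar> \<le> 1 + \<bar>v\<bar>"
      proof (cases "t = 0")
        case False
        then have "real_of_int (z t) / real t - v = (real_of_int (z t) - v * real t) / real t"
          by (simp add: diff_divide_distrib)
        then have "\<bar>real_of_int (z t) / real t - v\<bar> = \<bar>real_of_int (z t) - v * real t\<bar> / real t"
          by simp
        then show ?thesis using *[rule_format, of t] False by (simp add: pos_divide_le_eq mult.commute)
      qed simp
    qed
  qed auto
  then have "(\<lambda>t. \<integral>z. \<bar>real_of_int (z t) / real t - v\<bar> \<partial>static_law \<alpha>) \<longlonglongrightarrow> 0" by simp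
  from order_tendstoD(2)[OF this \<delta>] obtain N
    where N: "\<And>t. N \<le> t \<Longrightarrow> (\<integral>z. \<bar>real_of_int (z t) / real t - v\<bar> \<partial>static_law \<alpha>) < \<delta>"
    by (auto simp: eventually_sequentially)
  have int: "integrable (static_law \<alpha>) (\<lambda>z. \<bar>real_of_int (z t) - v * real t\<bar>)" for t
    by (rule integrable_const_bound[of _ "real t * (1 + \<bar>v\<bar>)"]) (use dist in \<open>auto elim: eventually_mono\<close>)
  show thesis
  proof
    \<comment> \<open>This is C: for t below N the trivial bound t (1 + |v|) stays under it.\<close>
    show "0 \<le> real N * (1 + \<bar>v\<bar>)" by simp
    fix t
    have "(\<integral>z. \<bar>real_of_int (z t) - v * real t\<bar> \<partial>static_law \<alpha>) \<le> \<delta> * real t + real N * (1 + \<bar>v\<bar>)"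
    proof (cases "N \<le> t \<and> 0 < t")
      case True
      have "(\<integral>z. \<bar>real_of_int (z t) - v * real t\<bar> \<partial>static_law \<alpha>) = (\<integral>z. real t * \<bar>real_of_int (z t) / real t - v\<bar> \<partial>static_law \<alpha>)"
      proof (rule Bochner_Integration.integral_cong[OF refl])
        fix z :: "nat \<Rightarrow> int"
        have "real t * \<bar>real_of_int (z t) / real t - v\<bar> = \<bar>real t * (real_of_int (z t) / real t - v)\<bar>"
          by (simp add: abs_mult)
        then show "\<bar>real_of_int (z t) - v * real t\<bar> = real t * \<bar>real_of_int (z t) / real t - v\<bar>"
          using True by (simp add: right_diff_distrib mult.commute)
      qed
      also have "\<dots> = real t * (\<integral>z. \<bar>real_of_int (z t) / real t - v\<bar> \<partial>static_law \<alpha>)" by simp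
      also have "\<dots> \<le> real t * \<delta>" using N[of t] True by (intro mult_left_mono) auto
      also have "\<dots> \<le> \<delta> * real t + real N * (1 + \<bar>v\<bar>)" by (simp add: mult.commute)
      finally show ?thesis .
    next
      case False
      have "(\<integral>z. \<bar>real_of_int (z t) - v * real t\<bar> \<partial>static_law \<alpha>) \<le> (\<integral>z. real t * (1 + \<bar>v\<bar>) \<partial>static_law \<alpha>)"
        by (rule integral_mono_AE[OF int]) (use dist in \<open>auto elim: eventually_mono\<close>)
      also have "\<dots> = real t * (1 + \<bar>v\<bar>)" using prob_space by simp
      also have "\<dots> \<le> real N * (1 + \<bar>v\<bar>)" using False by (intro mult_right_mono) auto
      finally show ?thesis using \<delta> by (simp add: add_increasing)
    qed
    then show "(\<integral>\<^sup>+z. ennreal \<bar>real_of_int (z t) - v * real t\<bar> \<partial>static_law \<alpha>) \<le> ennreal (\<delta> * real t + real N * (1 + \<bar>v\<bar>))"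
      by (subst nn_integral_eq_integral[OF int]) (auto intro: ennreal_leI)
  qed
qed

text \<open>The triangle inequality over the k complete epochs and the current one, which accounts
  for the factor \<open>Suc k\<close>.\<close>

lemma rwcre_deviation_bound:
  assumes \<alpha>: "real_distribution \<alpha>" and \<tau>: "strict_mono \<tau>" "\<tau> 0 = 0"
    and e: "\<And>t. (\<integral>\<^sup>+z. ennreal \<bar>real_of_int (z t) - v * real t\<bar> \<partial>static_law \<alpha>) \<le> ennreal (\<delta> * real t + C)"
    and "0 \<le> \<delta>" "0 \<le> C"
    and t: "\<tau> k + t \<le> \<tau> (Suc k)"
  shows "(\<integral>\<^sup>+z. ennreal \<bar>real_of_int (z (\<tau> k + t)) - v * real (\<tau> k + t)\<bar> \<partial>rwcre_law \<alpha> \<tau>)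
    \<le> ennreal (\<delta> * real (\<tau> k + t) + C * real (Suc k))"
proof -
  have [measurable_cong]: "sets (rwcre_law \<alpha> \<tau>) = sets path_space" by (rule sets_rwcre_law[OF \<alpha>])
  let ?I = "\<lambda>n. \<integral>\<^sup>+z. ennreal \<bar>real_of_int (z n) - v * real n\<bar> \<partial>rwcre_law \<alpha> \<tau>"
  have step: "?I (\<tau> k + t) \<le> ?I (\<tau> k) + ennreal (\<delta> * real t + C)" if t: "\<tau> k + t \<le> \<tau> (Suc k)" for k t
  proof -
    have "?I (\<tau> k + t) \<le> (\<integral>\<^sup>+z. ennreal \<bar>real_of_int (z (\<tau> k)) - v * real (\<tau> k)\<bar> +
        ennreal \<bar>real_of_int (z (\<tau> k + t) - z (\<tau> k)) - v * real t\<bar> \<partial>rwcre_law \<alpha> \<tau>)"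
    proof (rule nn_integral_mono)
      fix z :: "nat \<Rightarrow> int"
      have "\<bar>real_of_int (z (\<tau> k + t)) - v * real (\<tau> k + t)\<bar> \<le> \<bar>real_of_int (z (\<tau> k)) - v * real (\<tau> k)\<bar> +
          \<bar>real_of_int (z (\<tau> k + t) - z (\<tau> k)) - v * real t\<bar>"
        by (simp add: distrib_left)
      then show "ennreal \<bar>real_of_int (z (\<tau> k + t)) - v * real (\<tau> k + t)\<bar> \<le> ennreal \<bar>real_of_int (z (\<tau> k)) - v * real (\<tau> k)\<bar> +
          ennreal \<bar>real_of_int (z (\<tau> k + t) - z (\<tau> k)) - v * real t\<bar>"
        by (subst ennreal_plus[symmetric]) (auto intro: ennreal_leI simp del: ennreal_plus)
    qed
    also have "\<dots> = ?I (\<tau> k) + (\<integral>\<^sup>+z. ennreal \<bar>real_of_int (z (\<tau> k + t) - z (\<tau> k)) - v * real t\<bar> \<partial>rwcre_law \<alpha> \<tau>)"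
      by (rule nn_integral_add) measurable
    also have "(\<integral>\<^sup>+z. ennreal \<bar>real_of_int (z (\<tau> k + t) - z (\<tau> k)) - v * real t\<bar> \<partial>rwcre_law \<alpha> \<tau>) =
        (\<integral>\<^sup>+z. ennreal \<bar>real_of_int (z t) - v * real t\<bar> \<partial>static_law \<alpha>)"
      using nn_integral_rwcre_increment[OF \<alpha> \<tau> t, of "\<lambda>x. ennreal \<bar>real_of_int x - v * real t\<bar>"] .
    finally show ?thesis using e[of t] by (meson add_left_mono order_trans)
  qed
  have base: "?I (\<tau> k) \<le> ennreal (\<delta> * real (\<tau> k) + C * real k)" for k
  proof (induction k)
    case 0
    have "?I 0 = (\<integral>\<^sup>+\<eta>. \<integral>\<^sup>+z. ennreal \<bar>real_of_int (z 0) - v * real 0\<bar> \<partial>quenched_law (\<lambda>n. \<eta> (epoch \<tau> n)) \<partial>(\<Pi>\<^sub>M k\<in>UNIV. env_law \<alpha>))"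
      by (rule nn_integral_rwcre_law[OF \<alpha>]) measurable
    also have "\<dots> = (\<integral>\<^sup>+\<eta>. 0 \<partial>(\<Pi>\<^sub>M k\<in>(UNIV :: nat set). env_law \<alpha>))"
    proof (rule nn_integral_cong)
      fix \<eta> :: "nat \<Rightarrow> env"
      have "(\<integral>\<^sup>+z. ennreal \<bar>real_of_int (z 0) - v * real 0\<bar> \<partial>quenched_law (\<lambda>n. \<eta> (epoch \<tau> n))) = (\<integral>\<^sup>+z. 0 \<partial>quenched_law (\<lambda>n. \<eta> (epoch \<tau> n)))"
        by (rule nn_integral_cong_AE, use quenched_law_0 in eventually_elim) simp
      then show "(\<integral>\<^sup>+z. ennreal \<bar>real_of_int (z 0) - v * real 0\<bar> \<partial>quenched_law (\<lambda>n. \<eta> (epoch \<tau> n))) = 0" by simp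
    qed
    finally show ?case using \<tau>(2) by simp
  next
    case (Suc k)
    have lt: "\<tau> k < \<tau> (Suc k)" using \<tau>(1) by (simp add: strict_mono_def)
    have "?I (\<tau> (Suc k)) \<le> ?I (\<tau> k) + ennreal (\<delta> * real (\<tau> (Suc k) - \<tau> k) + C)"
      using step[of k "\<tau> (Suc k) - \<tau> k"] lt by simp
    also have "\<dots> \<le> ennreal (\<delta> * real (\<tau> k) + C * real k) + ennreal (\<delta> * real (\<tau> (Suc k) - \<tau> k) + C)"
      by (intro add_right_mono Suc)
    also have "\<dots> = ennreal ((\<delta> * real (\<tau> k) + C * real k) + (\<delta> * real (\<tau> (Suc k) - \<tau> k) + C))"
      using \<open>0 \<le> \<delta>\<close> \<open>0 \<le> C\<close> by (intro ennreal_plus[symmetric]) auto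
    also have "(\<delta> * real (\<tau> k) + C * real k) + (\<delta> * real (\<tau> (Suc k) - \<tau> k) + C) = \<delta> * real (\<tau> (Suc k)) + C * real (Suc k)"
      using lt by (simp add: of_nat_diff algebra_simps)
    finally show ?case .
  qed
  have "?I (\<tau> k + t) \<le> ennreal (\<delta> * real (\<tau> k) + C * real k) + ennreal (\<delta> * real t + C)"
    using step[OF t] base[of k] by (meson add_right_mono order_trans)
  also have "\<dots> = ennreal (\<delta> * real (\<tau> k + t) + C * real (Suc k))"
    using \<open>0 \<le> \<delta>\<close> \<open>0 \<le> C\<close> by (subst ennreal_plus[symmetric]) (auto simp: algebra_simps simp del: ennreal_plus)
  finally show ?thesis .
qed

text \<open>Bounds the number k of complete epochs by (n + D) / B for n \<ge> \<tau>(k), with B as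
  large as desired. The epochs before the lengths reach B are absorbed by D.\<close>

lemma cooling_superlinear:
  fixes \<tau> :: "nat \<Rightarrow> nat"
  assumes "strict_mono \<tau>" "filterlim (\<lambda>k. \<tau> k - \<tau> (k - 1)) at_top sequentially"
  obtains D where "\<And>k. B * k \<le> \<tau> k + D"
proof -
  obtain N where N: "\<And>k. N \<le> k \<Longrightarrow> B \<le> \<tau> k - \<tau> (k - 1)"
    using assms(2) by (auto simp: filterlim_at_top eventually_sequentially)
  have "B * k \<le> \<tau> k + B * N" for k
  proof (induction k)
    case (Suc k)
    have lt: "\<tau> k < \<tau> (Suc k)" using assms(1) by (simp add: strict_mono_def)
    show ?case
    proof (cases "N \<le> Suc k")
      case True
      from N[OF True] have "B \<le> \<tau> (Suc k) - \<tau> k" by simp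
      with Suc lt show ?thesis by simp
    next
      case False
      then have "B * Suc k \<le> B * N" by (intro mult_left_mono) auto
      then show ?thesis by simp
    qed
  qed simp
  with that show ?thesis by blast
qed

lemma rwcre_mean_deviation:
  assumes \<alpha>: "real_distribution \<alpha>" and \<tau>: "strict_mono \<tau>" "\<tau> 0 = 0"
    and T: "filterlim (\<lambda>k. \<tau> k - \<tau> (k - 1)) at_top sequentially"
    and v: "AE z in static_law \<alpha>. (\<lambda>n. real_of_int (z n) / real n) \<longlonglongrightarrow> v" and \<epsilon>: "0 < \<epsilon>"
  shows "\<forall>\<^sub>F n in sequentially. (\<integral>\<^sup>+z. ennreal \<bar>real_of_int (z n) - v * real n\<bar> \<partial>rwcre_law \<alpha> \<tau>) \<le> ennreal (\<epsilon> * real n)"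
proof -
  obtain C where C: "0 \<le> C" and e: "\<And>t. (\<integral>\<^sup>+z. ennreal \<bar>real_of_int (z t) - v * real t\<bar> \<partial>static_law \<alpha>) \<le> ennreal (\<epsilon> / 3 * real t + C)"
    using static_deviation_bound[OF \<alpha> v, of "\<epsilon> / 3"] \<epsilon> by auto
  \<comment> \<open>With this B the total cost C k of the epochs is at most \<epsilon> / 3 times n +
    D.\<close>
  obtain B :: nat where B: "3 * C / \<epsilon> < real B" using reals_Archimedean2 by blast
  obtain D where D: "\<And>k. B * k \<le> \<tau> k + D" using cooling_superlinear[OF \<tau>(1) T] by blast
  \<comment> \<open>Beyond N the remaining constants, \<epsilon> D / 3 from the count of epochs and
    C for the current one, fit into the last \<epsilon> n / 3.\<close>
  obtain N :: nat where N: "3 / \<epsilon> * (\<epsilon> / 3 * real D + C) < real N" using reals_Archimedean2 by blast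
  show ?thesis unfolding eventually_sequentially
  proof (intro exI allI impI)
    fix n assume n: "N \<le> n"
    obtain k where k: "\<tau> k \<le> n" "n < \<tau> (Suc k)" using epoch_exists[OF \<tau>] .
    have Ck: "C * real k \<le> \<epsilon> / 3 * (real n + real D)"
    proof -
      have "C \<le> \<epsilon> / 3 * real B" using B \<epsilon> by (simp add: field_simps)
      then have "C * real k \<le> \<epsilon> / 3 * real B * real k" by (intro mult_right_mono) auto
      also have "\<dots> = \<epsilon> / 3 * real (B * k)" by simp
      also have "\<dots> \<le> \<epsilon> / 3 * real (n + D)" using D[of k] k \<epsilon> by (intro mult_left_mono of_nat_mono) auto
      finally show ?thesis by simp
    qed
    have "\<epsilon> / 3 * real D + C < \<epsilon> / 3 * real N" using N \<epsilon> by (simp add: field_simps)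
    also have "\<dots> \<le> \<epsilon> / 3 * real n" using n \<epsilon> by (intro mult_left_mono) auto
    finally have const: "\<epsilon> / 3 * real D + C < \<epsilon> / 3 * real n" .
    have "(\<integral>\<^sup>+z. ennreal \<bar>real_of_int (z n) - v * real n\<bar> \<partial>rwcre_law \<alpha> \<tau>) \<le> ennreal (\<epsilon> / 3 * real n + C * real (Suc k))"
      using rwcre_deviation_bound[OF \<alpha> \<tau> e, of k "n - \<tau> k"] \<epsilon> C k by simp
    also have "\<dots> \<le> ennreal (\<epsilon> * real n)"
      using Ck const by (intro ennreal_leI) (simp add: algebra_simps)
    finally show "(\<integral>\<^sup>+z. ennreal \<bar>real_of_int (z n) - v * real n\<bar> \<partial>rwcre_law \<alpha> \<tau>) \<le> ennreal (\<epsilon> * real n)" .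
  qed
qed

section \<open>From L1 deviations to convergence in distribution\<close>

lemma rwcre_tail_tendsto:
  assumes \<alpha>: "real_distribution \<alpha>" and \<tau>: "strict_mono \<tau>" "\<tau> 0 = 0"
    and T: "filterlim (\<lambda>k. \<tau> k - \<tau> (k - 1)) at_top sequentially"
    and v: "AE z in static_law \<alpha>. (\<lambda>n. real_of_int (z n) / real n) \<longlonglongrightarrow> v" and d: "0 < d"
  shows "(\<lambda>n. measure (rwcre_law \<alpha> \<tau>) {z. d \<le> \<bar>real_of_int (z n) / real n - v\<bar>}) \<longlonglongrightarrow> 0"
proof (rule tendstoI)
  fix e :: real assume "0 < e"
  interpret P: prob_space "rwcre_law \<alpha> \<tau>" by (rule prob_space_rwcre_law[OF \<alpha>])
  have [measurable_cong]: "sets (rwcre_law \<alpha> \<tau>) = sets path_space" by (rule sets_rwcre_law[OF \<alpha>])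
  \<comment> \<open>Markov's inequality at the level d n turns this into the bound e / 2, strictly
    below e.\<close>
  have "0 < e * d / 2" using \<open>0 < e\<close> d by simp
  from rwcre_mean_deviation[OF \<alpha> \<tau> T v this] eventually_gt_at_top[of 0]
  show "\<forall>\<^sub>F n in sequentially. dist (measure (rwcre_law \<alpha> \<tau>) {z. d \<le> \<bar>real_of_int (z n) / real n - v\<bar>}) 0 < e"
  proof eventually_elim
    fix n :: nat assume b: "(\<integral>\<^sup>+z. ennreal \<bar>real_of_int (z n) - v * real n\<bar> \<partial>rwcre_law \<alpha> \<tau>) \<le> ennreal (e * d / 2 * real n)" and n: "0 < n"
    let ?A = "{z. d \<le> \<bar>real_of_int (z n) / real n - v\<bar>}"
    have A: "?A \<in> sets (rwcre_law \<alpha> \<tau>)"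
      using path_level_sets[of "\<lambda>x. d \<le> \<bar>real_of_int x / real n - v\<bar>" n] sets_rwcre_law[OF \<alpha>] by simp
    have "ennreal (d * real n) * emeasure (rwcre_law \<alpha> \<tau>) ?A = (\<integral>\<^sup>+z. ennreal (d * real n) * indicator ?A z \<partial>rwcre_law \<alpha> \<tau>)"
      using A by (simp add: nn_integral_cmult_indicator)
    also have "\<dots> \<le> (\<integral>\<^sup>+z. ennreal \<bar>real_of_int (z n) - v * real n\<bar> \<partial>rwcre_law \<alpha> \<tau>)"
    proof (rule nn_integral_mono)
      fix z :: "nat \<Rightarrow> int"
      show "ennreal (d * real n) * indicator ?A z \<le> ennreal \<bar>real_of_int (z n) - v * real n\<bar>"
      proof (cases "z \<in> ?A")
        case True
        have "\<bar>real_of_int (z n) - v * real n\<bar> = \<bar>real_of_int (z n) / real n - v\<bar> * real n"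
          using n by (simp add: abs_mult_pos left_diff_distrib)
        also have "\<dots> \<ge> d * real n" using True by (intro mult_right_mono) auto
        finally show ?thesis using True by (simp add: ennreal_leI)
      qed simp
    qed
    also note b
    finally have "ennreal (d * real n * measure (rwcre_law \<alpha> \<tau>) ?A) \<le> ennreal (e * d / 2 * real n)"
      using d by (simp add: P.emeasure_eq_measure ennreal_mult)
    then have "d * real n * measure (rwcre_law \<alpha> \<tau>) ?A \<le> e * d / 2 * real n"
      using \<open>0 < e\<close> d by (subst (asm) ennreal_le_iff) auto
    also have "\<dots> = d * real n * (e / 2)" by simp
    finally have "measure (rwcre_law \<alpha> \<tau>) ?A \<le> e / 2" using d n by simp
    then show "dist (measure (rwcre_law \<alpha> \<tau>) ?A) 0 < e" using \<open>0 < e\<close> by (simp add: dist_real_def)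
  qed
qed

lemma cdf_return: "cdf (return borel v) x = (if v \<le> x then 1 else 0)"
  by (simp add: cdf_def measure_return indicator_def)

text \<open>Exempts the point v, where the tail bounds give no information on the distribution
  functions.\<close>

lemma not_isCont_cdf_return: "\<not> isCont (cdf (return borel v)) v"
proof
  assume "isCont (cdf (return borel v)) v"
  then have "(cdf (return borel v) \<longlongrightarrow> cdf (return borel v) v) (at_left v)"
    by (simp add: continuous_at_imp_continuous_at_within flip: continuous_within)
  moreover have "(cdf (return borel v) \<longlongrightarrow> 0) (at_left v)"
    by (rule tendsto_eventually) (simp add: eventually_at_filter cdf_return)
  ultimately have "cdf (return borel v) v = 0" by (rule tendsto_unique[rotated]) simp
  then show False by (simp add: cdf_return)
qed

theorem theorem2:
  fixes \<alpha> :: "real measure" and \<tau> :: "nat \<Rightarrow> nat"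
  assumes "real_distribution \<alpha>"
    and "AE w in \<alpha>. 0 < w \<and> w < 1"
    and "ext_expectation \<alpha> (\<lambda>w. ln (rho w)) \<le> 0"
    and "\<tau> 0 = 0"
    and "strict_mono \<tau>"
    and "filterlim (\<lambda>k. \<tau> k - \<tau> (k - 1)) at_top sequentially"
  shows "weak_conv_m (\<lambda>n. distr (rwcre_law \<alpha> \<tau>) borel (\<lambda>x. real_of_int (x n) / real n))
           (return borel (rwre_speed \<alpha>))"
proof -
  interpret P: prob_space "rwcre_law \<alpha> \<tau>" by (rule prob_space_rwcre_law[OF assms(1)])
  have [measurable_cong]: "sets (rwcre_law \<alpha> \<tau>) = sets path_space" by (rule sets_rwcre_law[OF assms(1)])
  have space: "space (rwcre_law \<alpha> \<tau>) = UNIV" using sets_eq_imp_space_eq[OF sets_rwcre_law[OF assms(1)]] by simp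
  have level: "{z. Q (z n)} \<in> sets (rwcre_law \<alpha> \<tau>)" for Q n
    using path_level_sets[of Q n] sets_rwcre_law[OF assms(1)] by simp
  let ?v = "rwre_speed \<alpha>"
  have tail: "(\<lambda>n. measure (rwcre_law \<alpha> \<tau>) {z. d \<le> \<bar>real_of_int (z n) / real n - ?v\<bar>}) \<longlonglongrightarrow> 0" if "0 < d" for d
    by (rule rwcre_tail_tendsto[OF assms(1,5,4,6) static_speed[OF assms(1-3)] that])
  have cdf: "cdf (distr (rwcre_law \<alpha> \<tau>) borel (\<lambda>z. real_of_int (z n) / real n)) x = measure (rwcre_law \<alpha> \<tau>) {z. real_of_int (z n) / real n \<le> x}" for n x
    unfolding cdf_def by (subst measure_distr) (auto simp: space vimage_def)
  show ?thesis unfolding weak_conv_m_def weak_conv_def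
  proof (intro allI impI)
    fix x assume "isCont (cdf (return borel ?v)) x"
    then have "x \<noteq> ?v" using not_isCont_cdf_return by auto
    then consider "x < ?v" | "?v < x" by linarith
    then show "(\<lambda>n. cdf (distr (rwcre_law \<alpha> \<tau>) borel (\<lambda>z. real_of_int (z n) / real n)) x) \<longlonglongrightarrow> cdf (return borel ?v) x"
    proof cases
      case 1
      have "(\<lambda>n. measure (rwcre_law \<alpha> \<tau>) {z. real_of_int (z n) / real n \<le> x}) \<longlonglongrightarrow> 0"
      proof (rule tendsto_sandwich[OF _ _ tendsto_const tail[of "?v - x"]])
        show "\<forall>\<^sub>F n in sequentially. measure (rwcre_law \<alpha> \<tau>) {z. real_of_int (z n) / real n \<le> x} \<le> measure (rwcre_law \<alpha> \<tau>) {z. ?v - x \<le> \<bar>real_of_int (z n) / real n - ?v\<bar>}"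
          by (intro always_eventually allI P.finite_measure_mono level) auto
      qed (use 1 in auto)
      then show ?thesis using 1 by (simp add: cdf cdf_return)
    next
      case 2
      have "(\<lambda>n. measure (rwcre_law \<alpha> \<tau>) {z. \<not> real_of_int (z n) / real n \<le> x}) \<longlonglongrightarrow> 0"
      proof (rule tendsto_sandwich[OF _ _ tendsto_const tail[of "x - ?v"]])
        show "\<forall>\<^sub>F n in sequentially. measure (rwcre_law \<alpha> \<tau>) {z. \<not> real_of_int (z n) / real n \<le> x} \<le> measure (rwcre_law \<alpha> \<tau>) {z. x - ?v \<le> \<bar>real_of_int (z n) / real n - ?v\<bar>}"
          by (intro always_eventually allI P.finite_measure_mono level) auto
      qed (use 2 in auto)
      then have "(\<lambda>n. 1 - measure (rwcre_law \<alpha> \<tau>) {z. \<not> real_of_int (z n) / real n \<le> x}) \<longlonglongrightarrow> 1 - 0"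
        by (intro tendsto_diff tendsto_const)
      moreover have "1 - measure (rwcre_law \<alpha> \<tau>) {z. \<not> real_of_int (z n) / real n \<le> x} = measure (rwcre_law \<alpha> \<tau>) {z. real_of_int (z n) / real n \<le> x}" for n
        using P.prob_neg[of "\<lambda>z. real_of_int (z n) / real n \<le> x"] level[of "\<lambda>y. real_of_int y / real n \<le> x" n] by (simp add: space)
      ultimately show ?thesis using 2 by (simp add: cdf cdf_return)
    qed
  qed
qed

end
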